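(* Assume that for every integer $k'\ge1$ and every positive integer $m$ with $\gcd(k',m)=1$ one has $G_m^{(k')}=G_m^{(1)}$. Let $k\ge1$ be an integer having at most two distinct prime factors, with prime factorization $k=p_1^{a_1}\cdots p_r^{a_r}$ ($r\le2$). Then $$L_{D_k}(t)=q_1(t^{p_1})\cdots q_r(t^{p_r})\,L_{D_1}(t)$$ for some polynomials $q_1,\dots,q_r\in\mathbb{Z}[t]$.
   Context: For $k\ge1$, $D_k$ is the smooth projective (absolutely irreducible) curve over $\mathbb{F}_2$ birational to the affine curve $y^2+y=x^{2^k+1}+x^{-1}$, and $L_{D_k}(t)\in\mathbb{Z}[t]$ is its L-polynomial over $\mathbb{F}_2$, defined by $\exp\left(\sum_{n\ge1}\#D_k(\mathbb{F}_{2^n})\frac{t^n}{n}\right)=\frac{L_{D_k}(t)}{(1-t)(1-2t)}$. For $m\ge1$, $G_m^{(k)}=\sum_{x\in\mathbb{F}_{2^m}^*}(-1)^{\mathrm{Tr}_m(x^{2^k+1}+x^{-1})}$, where $\mathrm{Tr}_m$ is the trace from $\mathbb{F}_{2^m}$ to $\mathbb{F}_2$. *)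

theory Defs
  imports
    "HOL-Library.Z2"
    "HOL-Library.FuncSet"
    "HOL-Computational_Algebra.Computational_Algebra"
    "HOL-Algebra.Generated_Fields"
    "HOL-Algebra.Algebraic_Closure_Type"
begin

text \<open>
  All finite fields of characteristic 2 are taken inside one algebraic closure of the
  two-element field \<^typ>\<open>bit\<close>; the field with \<open>2 ^ n\<close> elements (\<open>n \<ge> 1\<close>) is
  the splitting field of \<open>X ^ (2 ^ n) - X\<close>.
\<close>

definition gf2 :: "nat \<Rightarrow> bit alg_closure set" where
  "gf2 n = {a. a ^ (2 ^ n) = a}"

text \<open>
  The trace to the prime field is the sum of the Galois conjugates. On \<open>gf2 m\<close> its values
  are the elements 0 and 1 of the algebraic closure, so the case distinction
  in \<open>G_sum\<close> is the sign \<open>(-1) ^ Tr\<close>.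
\<close>

definition gf2_trace :: "nat \<Rightarrow> bit alg_closure \<Rightarrow> bit alg_closure" where
  "gf2_trace m a = (\<Sum>i<m. a ^ (2 ^ i))"

definition G_sum :: "nat \<Rightarrow> nat \<Rightarrow> int" where
  "G_sum k m = (\<Sum>x\<in>gf2 m - {0}.
     if gf2_trace m (x ^ (2 ^ k + 1) + inverse x) = 0 then 1 else -1)"

text \<open>
  The function field of the affine curve \<open>y\<^sup>2 + y = x ^ (2 ^ k + 1) + 1 / x\<close> over the
  two-element field is realised inside an algebraic closure of the rational function field.
  The two solutions \<open>y\<close> differ by 1, so adjoining both gives the same field as
  adjoining one of them.
\<close>

type_synonym ratfun_closure = "bit poly fract alg_closure"

definition ratfun_x :: ratfun_closure where
  "ratfun_x = to_ac (Fract [:0, 1:] 1)"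

definition function_field :: "nat \<Rightarrow> ratfun_closure set" where
  "function_field k = generate_field ring_of_type_algebra
     (insert ratfun_x {y. y\<^sup>2 + y = ratfun_x ^ (2 ^ k + 1) + inverse ratfun_x})"

text \<open>
  The closed points of the smooth projective curve with function field \<open>F\<close> are the
  valuation rings of \<open>F\<close> other than \<open>F\<close> itself. They contain the constant field
  automatically, since that is the prime field.
\<close>

definition valuation_rings :: "ratfun_closure set \<Rightarrow> ratfun_closure set set" where
  "valuation_rings F = {V. subring V ring_of_type_algebra \<and> V \<subset> F \<and>
     (\<forall>z\<in>F. z \<noteq> 0 \<longrightarrow> z \<in> V \<or> inverse z \<in> V)}"

text \<open>
  A point of the smooth projective curve with values in \<open>gf2 n\<close> is a closed point
  together with an embedding of its residue field into \<open>gf2 n\<close>, that is, a ring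
  homomorphism from the valuation ring to \<open>gf2 n\<close> whose kernel is the set of non-units
  (the maximal ideal). Homomorphisms are made extensional so that each is counted once.
\<close>

definition curve_points :: "nat \<Rightarrow> nat \<Rightarrow> (ratfun_closure set \<times> (ratfun_closure \<Rightarrow> bit alg_closure)) set" where
  "curve_points k n = {(V, \<phi>). V \<in> valuation_rings (function_field k) \<and>
     \<phi> \<in> extensional V \<and>
     \<phi> \<in> ring_hom (ring_of_type_algebra\<lparr>carrier := V\<rparr>) (ring_of_type_algebra\<lparr>carrier := gf2 n\<rparr>) \<and>
     (\<forall>z\<in>V. \<phi> z = 0 \<longleftrightarrow> z = 0 \<or> inverse z \<notin> V)}"

definition zeta_fps :: "nat \<Rightarrow> rat fps" where
  "zeta_fps k = fps_exp 1 oo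
     Abs_fps (\<lambda>n. if n = 0 then 0 else of_nat (card (curve_points k n)) / of_nat n)"

definition L_poly :: "nat \<Rightarrow> int poly" where
  "L_poly k = (THE L. zeta_fps k =
     fps_of_poly (map_poly of_int L) / ((1 - fps_X) * (1 - 2 * fps_X)))"

end

theory Submission
  imports Defs "HOL-Number_Theory.Cong"
begin

text \<open>
  The sign of the trace extends to a completely multiplicative character on binary polynomials with
  constant term 1, and \<open>L\<^sub>k = exp (\<Sum>n\<ge>1. G\<^sub>n t\<^sup>n / n)\<close> is its generating series. It is a polynomial, because for
  large degree flipping the second highest coefficient flips the sign, and it is congruent to \<open>1 + t\<close>
  modulo 2. So \<open>L\<^sub>k\<close> has exactly one reciprocal root \<open>u\<^sub>k\<close> that is a 2-adic unit, and \<open>G\<^sub>n\<close> approaches \<open>- u\<^sub>k\<^sup>n\<close>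
  2-adically. Letting \<open>n\<close> run through 1 modulo \<open>k\<close>, the hypothesis gives \<open>u\<^sub>k = u\<^sub>1\<close>, and as
  \<open>L\<^sub>1 = 1 + t + 2 t\<^sup>3 + 4 t\<^sup>4\<close> is irreducible, it divides \<open>L\<^sub>k\<close>. The logarithm of the quotient involves only
  powers \<open>t\<^sup>n\<close> with \<open>n\<close> divisible by some prime factor of \<open>k\<close>, which for two primes says that the quotient \<open>M\<close>
  satisfies \<open>M(t) M(\<zeta> \<xi> t) = M(\<zeta> t) M(\<xi> t)\<close> for all roots of unity \<open>\<zeta>\<close>, \<open>\<xi>\<close> of these orders. Splitting off
  the largest factor that is a polynomial in \<open>t ^ p\<^sub>1\<close> leaves a polynomial in \<open>t ^ p\<^sub>2\<close>.
\<close>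

section \<open>Characteristic two\<close>

text \<open>\<open>L_poly\<close> is defined by points of the smooth model, the overview speaks of
  character sums. The bridge is the count \<open>2 ^ n + 1 + G_n\<close>. A point is a valuation
  ring with a residue map, so every point must be traced to one of two smooth affine charts, and
  every chart point must be shown to yield a valuation ring. The hypothesis compares power sums only
  at exponents prime to \<open>k\<close>, so general reciprocal roots cannot be matched; 2-adically
  all but the unit root die out. No 2-adic numbers are built: integers \<open>u\<close> with
  \<open>u ^ d * L (1 / u)\<close> divisible by \<open>2 ^ N\<close> stand for the root, and a
  relation \<open>r L_k + s L_1 = c\<close> with a constant \<open>c\<close> would make
  \<open>c\<close> divisible by too high a power of 2. For two primes, cutting the logarithm of
  \<open>M\<close> into a series in \<open>t ^ p1\<close> and one in \<open>t ^ p2\<close> requires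
  distributing the terms at common multiples, and a bad choice gives factors that are not
  polynomials. The rotation identity involves no such choice.\<close>

declare add_bit_eq_xor [simp del] mult_bit_eq_and [simp del] power_bit_unfold [simp del]
  minus_bit_def [simp del] uminus_bit_def [simp del] inverse_bit_def [simp del]
  divide_bit_def [simp del] bit_not_zero_iff [simp del] bit_not_one_iff [simp del]

text \<open>A type class lets one set of sign-free rules serve \<open>bit\<close>, its algebraic
  closure, polynomials, fractions and power series, which all become instances.\<close>

class char2 = comm_ring_1 + assumes one_plus_one: "1 + 1 = 0"
begin

lemma add_self [simp]: "x + x = 0"
  by (metis distrib_left mult_1_right mult_zero_right one_plus_one)

lemma add_self_left [simp]: "x + (x + y) = y"
  by (simp flip: add.assoc)

lemma uminus_char2: "- x = x"
  by (simp add: minus_unique)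

lemma minus_char2: "x - y = x + y"
  by (metis add_uminus_conv_diff uminus_char2)

lemma two_eq_zero: "2 = 0"
  by (metis one_add_one one_plus_one)

lemma add_eq_0_iff_char2: "x + y = 0 \<longleftrightarrow> x = y"
  by (metis add_self minus_char2 eq_iff_diff_eq_0)

end

lemma add_power_two_power:
  fixes x y :: "'a::char2"
  shows "(x + y) ^ (2 ^ n) = x ^ (2 ^ n) + y ^ (2 ^ n)"
proof (induction n)
  case (Suc n)
  have "(x + y) ^ (2 ^ Suc n) = ((x + y) ^ (2 ^ n))\<^sup>2"
    by (simp add: power_mult [symmetric] mult.commute)
  also have "\<dots> = x ^ (2 ^ Suc n) + y ^ (2 ^ Suc n)"
    by (simp add: Suc power2_sum two_eq_zero power_mult [symmetric] mult.commute)
  finally show ?case .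
qed simp

lemma sum_power_two_power:
  fixes f :: "'b \<Rightarrow> 'a::char2"
  shows "(\<Sum>i\<in>A. f i) ^ (2 ^ n) = (\<Sum>i\<in>A. f i ^ (2 ^ n))"
  by (induction A rule: infinite_finite_induct) (auto simp: add_power_two_power zero_power)

lemma power_two_power_eq_iff:
  fixes x y :: "'a::{field,char2}"
  shows "x ^ (2 ^ n) = y ^ (2 ^ n) \<longleftrightarrow> x = y"
proof
  assume "x ^ (2 ^ n) = y ^ (2 ^ n)"
  then have "(x + y) ^ (2 ^ n) = 0"
    by (simp add: add_power_two_power)
  then show "x = y"
    by (simp add: add_eq_0_iff_char2)
qed simp

instance bit :: char2
  by standard (metis bit_2_eq_0 one_add_one)

instance poly :: (char2) char2
  by standard (simp add: one_plus_one flip: pCons_one)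

instance fract :: ("{idom, char2}") char2
proof
  have "1 + 1 = Fract (1 + 1) (1 :: 'a)"
    by (simp add: One_fract_def del: add_self)
  then show "1 + 1 = (0 :: 'a fract)"
    by (simp add: Zero_fract_def)
qed

instance alg_closure :: ("{field, char2}") char2
proof
  have "1 + 1 = to_ac (1 + 1 :: 'a)"
    by (simp del: add_self)
  then show "1 + 1 = (0 :: 'a alg_closure)"
    by simp
qed

instance fps :: (char2) char2
proof
  have "1 + 1 = fps_const (1 + 1 :: 'a)"
    by (simp only: fps_const_add [symmetric] fps_const_1_eq_1)
  then show "1 + 1 = (0 :: 'a fps)"
    by (simp add: one_plus_one del: one_add_one)
qed

text \<open>The ring homomorphism from the prime field. It is polymorphic because it is needed into
  both \<open>bit alg_closure\<close> and \<open>ratfun_closure\<close>; additivity is where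
  \<open>1 + 1 = 0\<close> enters.\<close>

definition emb :: "bit \<Rightarrow> 'a::comm_ring_1" where
  "emb b = (if b = 0 then 0 else 1)"

lemma emb_0 [simp]: "emb 0 = 0" and emb_1 [simp]: "emb 1 = 1"
  by (simp_all add: emb_def)

lemma emb_add [simp]: "emb (a + b) = emb a + (emb b :: 'a::char2)"
  by (cases a; cases b) (simp_all)

lemma emb_mult [simp]: "emb (a * b) = emb a * (emb b :: 'a::char2)"
  by (cases a; cases b) (simp_all)

lemma emb_sum: "emb (sum f A) = (\<Sum>i\<in>A. emb (f i) :: 'a::char2)"
  by (induction A rule: infinite_finite_induct) simp_all

lemma emb_eq_iff [simp]: "emb a = (emb b :: 'a::char2) \<longleftrightarrow> a = b"
  by (cases a; cases b) simp_all

lemma emb_eq_0_iff [simp]: "emb a = (0 :: 'a::char2) \<longleftrightarrow> a = 0"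
  by (cases a) simp_all

definition lift_poly :: "bit poly \<Rightarrow> 'a::char2 poly" where
  "lift_poly = map_poly emb"

lemma coeff_lift_poly [simp]: "coeff (lift_poly p) n = emb (coeff p n)"
  by (simp add: lift_poly_def coeff_map_poly)

lemma lift_poly_0 [simp]: "lift_poly 0 = 0"
  and lift_poly_1 [simp]: "lift_poly 1 = 1"
  by (simp_all add: lift_poly_def)

lemma lift_poly_pCons [simp]: "lift_poly (pCons a p) = pCons (emb a) (lift_poly p)"
  by (simp add: lift_poly_def map_poly_pCons)

lemma lift_poly_add [simp]: "lift_poly (p + q) = lift_poly p + lift_poly q"
  by (simp add: poly_eq_iff)

lemma lift_poly_mult [simp]: "lift_poly (p * q) = lift_poly p * lift_poly q"
  by (simp add: poly_eq_iff coeff_mult emb_sum)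

lemma lift_poly_power [simp]: "lift_poly (p ^ n) = lift_poly p ^ n"
  by (induction n) simp_all

lemma lift_poly_eq_iff [simp]: "lift_poly p = lift_poly q \<longleftrightarrow> p = q"
  by (simp add: poly_eq_iff)

lemma lift_poly_eq_0_iff [simp]: "lift_poly p = 0 \<longleftrightarrow> p = 0"
  by (simp add: poly_eq_iff)

lemma degree_lift_poly [simp]: "degree (lift_poly p) = degree p"
  unfolding lift_poly_def by (rule degree_map_poly) simp

lemma lift_poly_monom [simp]: "lift_poly (monom c n) = monom (emb c) n"
  by (simp add: lift_poly_def map_poly_monom)

lemma square_eq_self_imp_emb:
  fixes x :: "'a::{field,char2}"
  assumes "x\<^sup>2 = x"
  shows "\<exists>b. x = emb b"
proof -
  have "x * (x - 1) = 0"
    using assms by (simp add: algebra_simps power2_eq_square)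
  then have "x = emb 0 \<or> x = emb 1"
    by auto
  then show ?thesis
    by blast
qed

text \<open>Division with remainder over the prime field stays one after extension of scalars, since
  degrees are kept; so a remainder divisible by \<open>lift_poly p\<close> is 0. The variable
  \<open>dummy\<close> carries the sort of the larger field.\<close>

lemma lift_poly_dvd_iff:
  fixes dummy :: "'a::{field,char2}"
  shows "(lift_poly p :: 'a poly) dvd lift_poly q \<longleftrightarrow> p dvd q"
proof (cases "p = 0")
  case False
  define r where "r = q mod p"
  show ?thesis
  proof
    assume "(lift_poly p :: 'a poly) dvd lift_poly q"
    moreover have "(lift_poly q :: 'a poly) = lift_poly p * lift_poly (q div p) + lift_poly r"
      unfolding r_def by (metis lift_poly_add lift_poly_mult mult_div_mod_eq)
    ultimately have *: "(lift_poly p :: 'a poly) dvd lift_poly r"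
      by (metis dvd_add_right_iff dvd_triv_left)
    have "r = 0"
    proof (rule ccontr)
      assume "r \<noteq> 0"
      then have "degree r < degree p"
        using False degree_mod_less [of p q] by (auto simp: r_def)
      with * \<open>r \<noteq> 0\<close> show False
        using dvd_imp_degree_le [of "lift_poly p :: 'a poly" "lift_poly r"] by simp
    qed
    then show "p dvd q"
      by (simp add: r_def dvd_eq_mod_eq_0)
  qed (metis dvdE dvd_triv_left lift_poly_mult)
qed auto

subsection \<open>Finite fields\<close>

lemma gf2_0 [simp]: "0 \<in> gf2 n" and gf2_1 [simp]: "1 \<in> gf2 n"
  by (simp_all add: gf2_def)

lemma gf2_add: "a \<in> gf2 n \<Longrightarrow> b \<in> gf2 n \<Longrightarrow> a + b \<in> gf2 n"
  by (simp add: gf2_def add_power_two_power)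

lemma gf2_mult: "a \<in> gf2 n \<Longrightarrow> b \<in> gf2 n \<Longrightarrow> a * b \<in> gf2 n"
  by (simp add: gf2_def power_mult_distrib)

lemma gf2_inverse: "a \<in> gf2 n \<Longrightarrow> inverse a \<in> gf2 n"
  by (simp add: gf2_def power_inverse)

lemma gf2_divide: "a \<in> gf2 n \<Longrightarrow> b \<in> gf2 n \<Longrightarrow> a / b \<in> gf2 n"
  by (simp add: field_class.field_divide_inverse gf2_mult gf2_inverse)

lemma gf2_emb: "emb b \<in> gf2 n"
  by (simp add: emb_def)

lemma gf2_poly: "a \<in> gf2 n \<Longrightarrow> poly (lift_poly p) a \<in> gf2 n"
  by (induction p) (auto intro!: gf2_add gf2_mult gf2_emb)

lemma alg_closed_size_proots:
  fixes p :: "'a::alg_closed_field poly"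
  shows "size (proots p) = degree p"
proof (cases "p = 0")
  case False
  obtain A where A: "size A = degree p" "p = smult (lead_coeff p) (\<Prod>x\<in>#A. [:-x, 1:])"
    using alg_closed_imp_factorization [OF False] by blast
  have "proots (\<Prod>x\<in>#A. [:-x, 1:]) = A"
  proof (induction A)
    case (add x A)
    have "(\<Prod>x\<in>#A. [:-x, 1:]) \<noteq> 0"
      by auto
    then show ?case
      using add by (simp add: proots_mult del: mult_pCons_left)
  qed simp
  then show ?thesis
    using A False by (metis leading_coeff_0_iff proots_smult)
qed simp

definition frob_poly :: "nat \<Rightarrow> bit poly" where
  "frob_poly n = monom 1 (2 ^ n) + monom 1 1"

lemma poly_frob_poly [simp]: "poly (lift_poly (frob_poly n)) a = a ^ (2 ^ n) + a"
  by (simp add: frob_poly_def poly_monom)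

lemma degree_frob_poly: "n \<ge> 1 \<Longrightarrow> degree (frob_poly n) = 2 ^ n"
  unfolding frob_poly_def
  by (subst degree_add_eq_left) (use one_less_power [of "2::nat" n] in \<open>auto simp: degree_monom_eq\<close>)

lemma gf2_eq_roots: "gf2 n = {a. poly (lift_poly (frob_poly n)) a = 0}"
  by (simp add: gf2_def add_eq_0_iff_char2)

lemma frob_poly_nonzero: "n \<ge> 1 \<Longrightarrow> frob_poly n \<noteq> 0"
  using degree_frob_poly [of n] by auto

lemma finite_gf2: "n \<ge> 1 \<Longrightarrow> finite (gf2 n)"
  unfolding gf2_eq_roots by (rule poly_roots_finite) (simp add: frob_poly_nonzero)

text \<open>Separability: in characteristic 2 the derivative of \<open>X ^ (2 ^ n) + X\<close> is 1,
  so no root is repeated and the number of roots equals the degree.\<close>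

lemma card_gf2:
  assumes "n \<ge> 1"
  shows "card (gf2 n) = 2 ^ n"
proof -
  define p :: "bit alg_closure poly" where "p = lift_poly (frob_poly n)"
  have p0: "p \<noteq> 0"
    using frob_poly_nonzero [OF assms] by (simp add: p_def)
  have "pderiv p = monom (2 ^ n) (2 ^ n - 1) + monom 1 0"
    by (simp add: p_def frob_poly_def pderiv_add pderiv_monom)
  also have "(2 :: bit alg_closure) ^ n = 0"
    using assms by (simp add: two_eq_zero)
  finally have "pderiv p = 1"
    by simp
  have "order a p \<le> 1" for a
  proof (rule ccontr)
    assume "\<not> order a p \<le> 1"
    then have "[:-a, 1:]\<^sup>2 dvd p"
      using order_divides p0 by (metis linorder_not_less Suc_1 Suc_le_eq)
    then obtain q where "p = [:-a, 1:] * ([:-a, 1:] * q)"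
      by (metis dvdE mult.assoc power2_eq_square)
    then have "[:-a, 1:] dvd pderiv p"
      by (simp only: pderiv_mult) (intro dvd_add dvd_mult2 dvd_mult dvd_refl)
    then show False
      using \<open>pderiv p = 1\<close> by (auto simp: poly_eq_0_iff_dvd [symmetric])
  qed
  then have "count (proots p) a \<le> 1" for a
    by (simp add: p0)
  then have "count (proots p) a = 1" if "a \<in># proots p" for a
    using that by (metis le_antisym less_one not_in_iff linorder_not_less)
  then have "proots p = mset_set (set_mset (proots p))"
    by (intro multiset_eqI)
      (auto simp: count_mset_set' not_in_iff simp del: count_proots set_count_proots)
  then have "size (proots p) = card {a. poly p a = 0}"
    by (metis p0 set_count_proots size_mset_set)
  then show ?thesis
    using assms by (simp add: alg_closed_size_proots gf2_eq_roots p_def degree_frob_poly)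
qed

section \<open>Places\<close>

lemma ring_of_type_algebra_simps [simp]:
  "carrier (ring_of_type_algebra :: 'a::comm_ring_1 ring) = UNIV"
  "(x :: 'a) \<otimes>\<^bsub>ring_of_type_algebra\<^esub> y = x * y"
  "(x :: 'a) \<oplus>\<^bsub>ring_of_type_algebra\<^esub> y = x + y"
  "\<one>\<^bsub>ring_of_type_algebra\<^esub> = (1 :: 'a)"
  "\<zero>\<^bsub>ring_of_type_algebra\<^esub> = (0 :: 'a)"
  by (simp_all add: ring_of_type_algebra_def)

lemma a_inv_ring_of_type_algebra [simp]:
  "\<ominus>\<^bsub>ring_of_type_algebra\<^esub> (x :: 'a::comm_ring_1) = - x"
proof -
  interpret ring "ring_of_type_algebra :: 'a ring" by (rule ring_from_type_algebra)
  show ?thesis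
    by (rule minus_equality) auto
qed

lemma m_inv_ring_of_type_algebra [simp]:
  assumes "x \<noteq> 0"
  shows "inv\<^bsub>ring_of_type_algebra\<^esub> (x :: 'a::Fields.field) = inverse x"
proof -
  interpret field "ring_of_type_algebra :: 'a ring" by (rule field_from_type_algebra)
  show ?thesis
    by (rule comm_inv_char) (use assms in auto)
qed

lemma subring_type_algebra_iff:
  "subring V (ring_of_type_algebra :: 'a::{comm_ring_1,char2} ring) \<longleftrightarrow>
     1 \<in> V \<and> (\<forall>x\<in>V. \<forall>y\<in>V. x + y \<in> V \<and> x * y \<in> V)" (is "?L \<longleftrightarrow> ?R")
proof -
  interpret ring "ring_of_type_algebra :: 'a ring" by (rule ring_from_type_algebra)
  show ?thesis
  proof
    assume ?L
    then show ?R
      using subringE(3,6,7) [of V ring_of_type_algebra] by auto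
  next
    assume ?R
    then show ?L
      by (intro subringI) (auto simp: uminus_char2)
  qed
qed

text \<open>
  A place is handled through its graph: a point with values in a field is a homomorphism defined
  on a subring, so \<open>G\<close> below is the graph of a homomorphism on a coordinate ring and \<open>localised G\<close>
  the graph of its extension to the local ring.
\<close>

locale hom_graph =
  fixes G :: "('e::{field,char2} \<times> 'l::{field,char2}) set"
  assumes one_mem: "(1, 1) \<in> G"
    and add_mem: "(x, c) \<in> G \<Longrightarrow> (y, d) \<in> G \<Longrightarrow> (x + y, c + d) \<in> G"
    and mult_mem: "(x, c) \<in> G \<Longrightarrow> (y, d) \<in> G \<Longrightarrow> (x * y, c * d) \<in> G"
    and zero_unique: "(0, c) \<in> G \<Longrightarrow> c = 0"
begin

lemma zero_mem: "(0, 0) \<in> G"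
  using add_mem [OF one_mem one_mem] by simp

lemma power_mem: "(x, c) \<in> G \<Longrightarrow> (x ^ n, c ^ n) \<in> G"
  by (induction n) (auto intro: one_mem mult_mem)

lemma functional: "(x, c) \<in> G \<Longrightarrow> (x, d) \<in> G \<Longrightarrow> c = d"
  using add_mem [of x c x d] zero_unique [of "c + d"] by (simp add: add_eq_0_iff_char2)

definition localised :: "('e \<times> 'l) set" where
  "localised = {(g / h, c / d) | g h c d. (g, c) \<in> G \<and> (h, d) \<in> G \<and> d \<noteq> 0}"

text \<open>Here \<open>h\<close> need only be nonzero, not have nonzero image: this is the whole
  fraction field, in which \<open>local_ring\<close> is to be a valuation ring.\<close>

definition fractions :: "'e set" where
  "fractions = {g / h | g h c d. (g, c) \<in> G \<and> (h, d) \<in> G \<and> h \<noteq> 0}"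

definition local_ring :: "'e set" where
  "local_ring = Domain localised"

definition residue :: "'e \<Rightarrow> 'l" where
  "residue = restrict (\<lambda>z. THE c. (z, c) \<in> localised) local_ring"

lemma localisedI:
  assumes "(g, c) \<in> G" "(h, d) \<in> G" "d \<noteq> 0" "x = g / h" "y = c / d"
  shows "(x, y) \<in> localised"
  using assms unfolding localised_def by blast

lemma localisedE:
  assumes "(x, y) \<in> localised"
  obtains g c h d where "(g, c) \<in> G" "(h, d) \<in> G" "d \<noteq> 0" "x = g / h" "y = c / d"
  using assms unfolding localised_def by blast

lemma nonzero_of_image: "(h, d) \<in> G \<Longrightarrow> d \<noteq> 0 \<Longrightarrow> h \<noteq> 0"
  using zero_unique by auto

lemma localised_hom_graph: "hom_graph localised"
proof
  show "(1, 1) \<in> localised"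
    using localisedI [OF one_mem one_mem] by simp
next
  fix x c y d
  assume "(x, c) \<in> localised" "(y, d) \<in> localised"
  then obtain g h \<gamma> \<delta> g' h' \<gamma>' \<delta>' where *:
    "x = g / h" "c = \<gamma> / \<delta>" "(g, \<gamma>) \<in> G" "(h, \<delta>) \<in> G" "\<delta> \<noteq> 0"
    "y = g' / h'" "d = \<gamma>' / \<delta>'" "(g', \<gamma>') \<in> G" "(h', \<delta>') \<in> G" "\<delta>' \<noteq> 0"
    by (auto simp: localised_def)
  have nz: "h \<noteq> 0" "h' \<noteq> 0"
    using * nonzero_of_image by auto
  have hh: "(h * h', \<delta> * \<delta>') \<in> G" "\<delta> * \<delta>' \<noteq> 0"
    using * by (auto intro: mult_mem)
  have "(g * h' + g' * h, \<gamma> * \<delta>' + \<gamma>' * \<delta>) \<in> G"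
    using * by (intro add_mem mult_mem)
  moreover have "x + y = (g * h' + g' * h) / (h * h')" "c + d = (\<gamma> * \<delta>' + \<gamma>' * \<delta>) / (\<delta> * \<delta>')"
    using * nz by (auto simp: add_frac_eq)
  ultimately show "(x + y, c + d) \<in> localised"
    using hh by (intro localisedI)
  have "(g * g', \<gamma> * \<gamma>') \<in> G"
    using * by (intro mult_mem)
  moreover have "x * y = (g * g') / (h * h')" "c * d = (\<gamma> * \<gamma>') / (\<delta> * \<delta>')"
    using * by auto
  ultimately show "(x * y, c * d) \<in> localised"
    using hh by (intro localisedI)
next
  fix c
  assume "(0, c) \<in> localised"
  then obtain g h \<gamma> \<delta> where *: "0 = g / h" "c = \<gamma> / \<delta>" "(g, \<gamma>) \<in> G" "(h, \<delta>) \<in> G" "\<delta> \<noteq> 0"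
    by (auto simp: localised_def)
  then have "g = 0"
    using nonzero_of_image by auto
  then show "c = 0"
    using * zero_unique by auto
qed

lemmas loc_one_mem = hom_graph.one_mem [OF localised_hom_graph]
  and loc_add_mem = hom_graph.add_mem [OF localised_hom_graph]
  and loc_mult_mem = hom_graph.mult_mem [OF localised_hom_graph]
  and loc_zero_unique = hom_graph.zero_unique [OF localised_hom_graph]
  and loc_functional = hom_graph.functional [OF localised_hom_graph]

lemma residue_eq: "(z, c) \<in> localised \<Longrightarrow> residue z = c"
  unfolding residue_def local_ring_def using loc_functional by (auto intro!: the_equality)

lemma mem_local_ring: "(z, c) \<in> localised \<Longrightarrow> z \<in> local_ring"
  unfolding local_ring_def by blast

lemma residue_mem: "z \<in> local_ring \<Longrightarrow> (z, residue z) \<in> localised"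
  using residue_eq by (auto simp: local_ring_def)

lemma G_subset_localised: "(g, c) \<in> G \<Longrightarrow> (g, c) \<in> localised"
  using localisedI [OF _ one_mem] by simp

lemma localised_inverse:
  assumes "(z, c) \<in> localised" "c \<noteq> 0"
  shows "(inverse z, inverse c) \<in> localised"
proof -
  obtain g h \<gamma> \<delta> where *: "z = g / h" "c = \<gamma> / \<delta>" "(g, \<gamma>) \<in> G" "(h, \<delta>) \<in> G" "\<delta> \<noteq> 0"
    using assms by (auto simp: localised_def)
  then have "inverse z = h / g" "inverse c = \<delta> / \<gamma>" "\<gamma> \<noteq> 0"
    using assms by auto
  then show ?thesis
    using * by (intro localisedI)
qed

lemma local_ring_subset: "local_ring \<subseteq> fractions"
  unfolding local_ring_def localised_def fractions_def using nonzero_of_image by blast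

lemma residue_eq_0_iff:
  assumes "z \<in> local_ring"
  shows "residue z = 0 \<longleftrightarrow> z = 0 \<or> inverse z \<notin> local_ring"
proof
  assume *: "residue z = 0"
  show "z = 0 \<or> inverse z \<notin> local_ring"
  proof (rule ccontr)
    assume "\<not> ?thesis"
    then have "z \<noteq> 0" "(inverse z, residue (inverse z)) \<in> localised"
      using residue_mem by auto
    then have "(1, 0) \<in> localised"
      using loc_mult_mem [OF residue_mem [OF assms]] * by force
    then show False
      using loc_functional loc_one_mem by fastforce
  qed
next
  assume *: "z = 0 \<or> inverse z \<notin> local_ring"
  show "residue z = 0"
  proof (rule ccontr)
    assume "residue z \<noteq> 0"
    then have "(inverse z, inverse (residue z)) \<in> localised"
      using assms residue_mem localised_inverse by blast
    moreover have "z \<noteq> 0"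
      using \<open>residue z \<noteq> 0\<close> assms residue_mem loc_zero_unique by auto
    ultimately show False
      using * mem_local_ring by blast
  qed
qed

text \<open>Discrete valuation criterion. Elements of nonzero image are units of the local ring, so
  \<open>unif\<close> writes every nonzero \<open>g\<close> as a power of \<open>w\<close> times a
  unit. A fraction is then a unit times an integer power of \<open>w\<close>, and the sign of the
  exponent decides whether it or its inverse is local. As \<open>w\<close> has image 0,
  \<open>inverse w\<close> is not local, which makes the inclusion proper.\<close>

lemma valuation_ring_if_uniformizer:
  assumes w: "(w, 0) \<in> G" "w \<noteq> 0"
    and unif: "\<And>g c. (g, c) \<in> G \<Longrightarrow> g \<noteq> 0 \<Longrightarrow>
      \<exists>i x y d e. (x, d) \<in> G \<and> (y, e) \<in> G \<and> d \<noteq> 0 \<and> e \<noteq> 0 \<and> g * x = w ^ i * y"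
  shows "local_ring \<subset> fractions"
    and "\<And>z. z \<in> fractions \<Longrightarrow> z \<noteq> 0 \<Longrightarrow> z \<in> local_ring \<or> inverse z \<in> local_ring"
proof -
  have w_loc: "(w, 0) \<in> localised"
    using w by (intro G_subset_localised)
  have "inverse w \<notin> local_ring"
    using residue_eq_0_iff [OF mem_local_ring [OF w_loc]] residue_eq [OF w_loc] w by simp
  moreover have "inverse w \<in> fractions"
    unfolding fractions_def using w one_mem by (force simp: divide_inverse)
  ultimately show "local_ring \<subset> fractions"
    using local_ring_subset by blast
  fix z
  assume "z \<in> fractions" "z \<noteq> 0"
  then obtain g h c d where gh: "z = g / h" "(g, c) \<in> G" "(h, d) \<in> G" "g \<noteq> 0" "h \<noteq> 0"
    by (auto simp: fractions_def)
  obtain i x y a b where 1: "(x, a) \<in> G" "(y, b) \<in> G" "a \<noteq> 0" "b \<noteq> 0" "g * x = w ^ i * y"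
    using unif gh by meson
  obtain i' x' y' a' b' where 2:
    "(x', a') \<in> G" "(y', b') \<in> G" "a' \<noteq> 0" "b' \<noteq> 0" "h * x' = w ^ i' * y'"
    using unif gh by meson
  have nz: "x \<noteq> 0" "y \<noteq> 0" "x' \<noteq> 0" "y' \<noteq> 0"
    using 1 2 nonzero_of_image by auto
  have z: "z = (w ^ i * (y * x')) / (w ^ i' * (y' * x))"
  proof -
    have "z = (g * x) * x' / ((h * x') * x)"
      using gh nz by simp
    also have "\<dots> = (w ^ i * y) * x' / ((w ^ i' * y') * x)"
      by (simp only: 1 2)
    finally show ?thesis
      by (simp only: mult.assoc)
  qed
  have u: "(y * x', b * a') \<in> G" "(y' * x, b' * a) \<in> G" "b * a' \<noteq> 0" "b' * a \<noteq> 0"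
    using 1 2 by (auto intro: mult_mem)
  have pow: "\<exists>c. (w ^ m * v, c) \<in> G" if "(v, c) \<in> G" for m v c
    using mult_mem [OF power_mem [OF w(1)] that] by blast
  show "z \<in> local_ring \<or> inverse z \<in> local_ring"
  proof (cases "i' \<le> i")
    case True
    have "z = (w ^ (i - i') * (y * x')) / (y' * x)"
      using w nz True by (simp add: z power_diff)
    then have "z \<in> local_ring"
      using pow [OF u(1), of "i - i'"] u(2,4) mem_local_ring localisedI by metis
    then show ?thesis ..
  next
    case False
    have "inverse z = (w ^ (i' - i) * (y' * x)) / (y * x')"
      using w nz False by (simp add: z power_diff)
    then have "inverse z \<in> local_ring"
      using pow [OF u(2), of "i' - i"] u(1,3) mem_local_ring localisedI by metis
    then show ?thesis ..
  qed
qed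

end

lemma curve_pointsD:
  assumes "(V, \<phi>) \<in> curve_points k n"
  shows "1 \<in> V" "\<And>x y. x \<in> V \<Longrightarrow> y \<in> V \<Longrightarrow> x + y \<in> V" "\<And>x y. x \<in> V \<Longrightarrow> y \<in> V \<Longrightarrow> x * y \<in> V"
    "V \<subseteq> function_field k"
    "\<And>z. z \<in> function_field k \<Longrightarrow> z \<noteq> 0 \<Longrightarrow> z \<in> V \<or> inverse z \<in> V"
    "\<phi> \<in> extensional V" "\<phi> 1 = 1" "\<And>x y. x \<in> V \<Longrightarrow> y \<in> V \<Longrightarrow> \<phi> (x + y) = \<phi> x + \<phi> y"
    "\<And>x y. x \<in> V \<Longrightarrow> y \<in> V \<Longrightarrow> \<phi> (x * y) = \<phi> x * \<phi> y" "\<And>x. x \<in> V \<Longrightarrow> \<phi> x \<in> gf2 n"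
    "\<And>z. z \<in> V \<Longrightarrow> \<phi> z = 0 \<longleftrightarrow> z = 0 \<or> inverse z \<notin> V"
  using assms
  by (auto simp: curve_points_def valuation_rings_def subring_type_algebra_iff ring_hom_def)

lemma curve_pointI:
  fixes G :: "(ratfun_closure \<times> bit alg_closure) set"
  assumes G: "hom_graph G" and frac: "hom_graph.fractions G = function_field k"
    and im: "\<And>g c. (g, c) \<in> G \<Longrightarrow> c \<in> gf2 n"
    and sub: "hom_graph.local_ring G \<subset> hom_graph.fractions G"
    and val: "\<And>z. z \<in> hom_graph.fractions G \<Longrightarrow> z \<noteq> 0 \<Longrightarrow>
      z \<in> hom_graph.local_ring G \<or> inverse z \<in> hom_graph.local_ring G"
  shows "(hom_graph.local_ring G, hom_graph.residue G) \<in> curve_points k n"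
proof -
  interpret hom_graph G by (fact G)
  have mem: "residue x \<in> gf2 n" if "x \<in> local_ring" for x
    using residue_mem [OF that] by (elim localisedE) (metis gf2_divide im)
  have add: "x + y \<in> local_ring \<and> residue (x + y) = residue x + residue y"
    and mult: "x * y \<in> local_ring \<and> residue (x * y) = residue x * residue y"
    if "x \<in> local_ring" "y \<in> local_ring" for x y
    using loc_add_mem [OF residue_mem residue_mem, OF that]
      loc_mult_mem [OF residue_mem residue_mem, OF that]
    by (simp_all add: mem_local_ring residue_eq)
  have "local_ring \<in> valuation_rings (function_field k)"
    using sub val add mult mem_local_ring [OF loc_one_mem]
    by (auto simp: valuation_rings_def subring_type_algebra_iff frac)
  moreover have "residue \<in> ring_hom (ring_of_type_algebra\<lparr>carrier := local_ring\<rparr>)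
      (ring_of_type_algebra\<lparr>carrier := gf2 n\<rparr>)"
    using add mult mem residue_eq [OF loc_one_mem] by (auto simp: ring_hom_def)
  ultimately show ?thesis
    using residue_eq_0_iff by (auto simp: curve_points_def residue_def)
qed

text \<open>A valuation ring is maximal under domination. An element of \<open>V\<close> outside
  \<open>local_ring\<close> would have an inverse in \<open>local_ring\<close> with residue 0; but
  that inverse is a unit of \<open>V\<close>, where \<open>\<phi>\<close> cannot vanish.\<close>

lemma curve_point_unique:
  fixes G :: "(ratfun_closure \<times> bit alg_closure) set"
  assumes G: "hom_graph G" and frac: "hom_graph.fractions G = function_field k"
    and val: "\<And>z. z \<in> hom_graph.fractions G \<Longrightarrow> z \<noteq> 0 \<Longrightarrow>
      z \<in> hom_graph.local_ring G \<or> inverse z \<in> hom_graph.local_ring G"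
    and pt: "(V, \<phi>) \<in> curve_points k n"
    and ext: "\<And>g c. (g, c) \<in> G \<Longrightarrow> g \<in> V \<and> \<phi> g = c"
  shows "V = hom_graph.local_ring G" "\<phi> = hom_graph.residue G"
proof -
  interpret hom_graph G by (fact G)
  note pt = curve_pointsD [OF pt]
  have inv: "inverse h \<in> V \<and> \<phi> (inverse h) = inverse (\<phi> h)" if "h \<in> V" "\<phi> h \<noteq> 0" for h
  proof
    show *: "inverse h \<in> V"
      using pt(11) that by blast
    have "h \<noteq> 0"
      using that pt(11) by blast
    then have "\<phi> h * \<phi> (inverse h) = 1"
      using pt(7,9) * that by (metis right_inverse)
    then show "\<phi> (inverse h) = inverse (\<phi> h)"
      by (metis inverse_unique)
  qed
  have sub: "z \<in> V \<and> \<phi> z = c" if zc: "(z, c) \<in> localised" for z c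
  proof -
    obtain g h \<gamma> \<delta> where *: "z = g / h" "c = \<gamma> / \<delta>" "(g, \<gamma>) \<in> G" "(h, \<delta>) \<in> G" "\<delta> \<noteq> 0"
      using zc by (elim localisedE)
    have "inverse h \<in> V" "\<phi> (inverse h) = inverse \<delta>"
      using ext [OF *(4)] inv [of h] * by auto
    then show ?thesis
      using ext [OF *(3)] pt(3,9) by (simp add: * divide_inverse)
  qed
  show V: "V = local_ring"
  proof
    show "local_ring \<subseteq> V"
      using sub by (auto simp: local_ring_def)
    show "V \<subseteq> local_ring"
    proof
      fix z
      assume z: "z \<in> V"
      show "z \<in> local_ring"
      proof (rule ccontr)
        assume *: "z \<notin> local_ring"
        then have nz: "z \<noteq> 0"
          using mem_local_ring [OF G_subset_localised [OF zero_mem]] by auto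
        then have iz: "inverse z \<in> local_ring"
          using val z pt(4) frac * by blast
        have "residue (inverse z) = 0"
          using residue_eq_0_iff [OF iz] * nz by simp
        then have "inverse z \<in> V" "\<phi> (inverse z) = 0"
          using sub [OF residue_mem [OF iz]] by auto
        then show False
          using pt(11) [of "inverse z"] z nz by simp
      qed
    qed
  qed
  show "\<phi> = residue"
  proof
    fix z
    show "\<phi> z = residue z"
    proof (cases "z \<in> V")
      case True
      then show ?thesis
        using sub residue_mem V by blast
    next
      case False
      then show ?thesis
        using pt(6) V by (simp add: residue_def extensional_def)
    qed
  qed
qed

section \<open>The affine charts\<close>

definition ev :: "bit poly \<Rightarrow> 'a::char2 \<Rightarrow> 'a" where
  "ev p t = poly (lift_poly p) t"

lemma ev_simps [simp]:
  "ev 0 t = 0" "ev 1 t = 1" "ev (p + q) t = ev p t + ev q t" "ev (p * q) t = ev p t * ev q t"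
  "ev (p ^ n) t = ev p t ^ n" "ev (monom 1 n) t = t ^ n" "ev (pCons c p) t = emb c + t * ev p t"
  by (simp_all add: ev_def poly_monom)

lemma ev_0_right: "ev p 0 = emb (coeff p 0)"
  by (simp add: ev_def poly_0_coeff_0)

lemma exists_minimal_poly:
  fixes a :: "'a::{field,char2}"
  assumes "p \<noteq> 0" "ev p a = 0"
  obtains m where "m \<noteq> 0" "ev m a = 0" "\<And>q. ev q a = 0 \<Longrightarrow> m dvd q"
proof -
  define P where "P = (\<lambda>q. q \<noteq> 0 \<and> ev q a = 0)"
  define m where "m = (ARG_MIN degree q. P q)"
  have "P p"
    using assms by (simp add: P_def)
  then have m: "P m" "\<And>q. P q \<Longrightarrow> degree m \<le> degree q"
    unfolding m_def by (auto intro: arg_min_natI arg_min_nat_le)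
  have "m dvd q" if "ev q a = 0" for q
  proof -
    have "ev q a = ev (q div m) a * ev m a + ev (q mod m) a"
      by (metis div_mult_mod_eq ev_simps(3,4))
    then have "ev (q mod m) a = 0"
      using that m by (simp add: P_def)
    then have "q mod m = 0"
      using m degree_mod_less' [of m q] by (metis P_def linorder_not_less)
    then show ?thesis
      by auto
  qed
  with m show ?thesis
    using that by (auto simp: P_def)
qed

lemma split_off_power:
  fixes a :: "'a::{field,char2}"
  assumes m: "m \<noteq> 0" "ev m a = 0" "\<And>q. ev q a = 0 \<Longrightarrow> m dvd q" and "q \<noteq> 0"
  shows "\<exists>i r. q = m ^ i * r \<and> ev r a \<noteq> 0"
  using \<open>q \<noteq> 0\<close>
proof (induction "degree q" arbitrary: q rule: less_induct)
  case less
  show ?case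
  proof (cases "ev q a = 0")
    case False
    then show ?thesis
      by (intro exI [of _ 0] exI [of _ q]) simp
  next
    case True
    then obtain q' where q': "q = m * q'"
      using m by blast
    have "degree m > 0"
    proof (rule ccontr)
      assume "\<not> degree m > 0"
      then obtain c where "m = [:c:]"
        by (auto elim: degree_eq_zeroE)
      then show False
        using m by auto
    qed
    then have "degree q' < degree q"
      using q' less.prems by (auto simp: degree_mult_eq)
    then obtain i r where "q' = m ^ i * r" "ev r a \<noteq> 0"
      using less.hyps q' less.prems by (metis mult_zero_right)
    then show ?thesis
      by (intro exI [of _ "Suc i"] exI [of _ r]) (simp add: q' mult.assoc)
  qed
qed

lemma split_off_common_power:
  fixes a :: "'a::{field,char2}"
  assumes m: "m \<noteq> 0" "ev m a = 0" "\<And>q. ev q a = 0 \<Longrightarrow> m dvd q" and "u \<noteq> 0 \<or> v \<noteq> 0"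
  shows "\<exists>i u' v'. u = m ^ i * u' \<and> v = m ^ i * v' \<and> (ev u' a \<noteq> 0 \<or> ev v' a \<noteq> 0)"
proof -
  note split = split_off_power [OF m]
  consider "u = 0" "v \<noteq> 0" | "v = 0" "u \<noteq> 0" | "u \<noteq> 0" "v \<noteq> 0"
    using assms by blast
  then show ?thesis
  proof cases
    case 1
    then show ?thesis
      using split [of v] by (metis mult_zero_right)
  next
    case 2
    then show ?thesis
      using split [of u] by (metis mult_zero_right)
  next
    case 3
    obtain i r where r: "u = m ^ i * r" "ev r a \<noteq> 0"
      using split 3 by blast
    obtain l s where s: "v = m ^ l * s" "ev s a \<noteq> 0"
      using split 3 by blast
    show ?thesis
    proof (cases "i \<le> l")
      case True
      then have "v = m ^ i * (m ^ (l - i) * s)"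
        by (simp add: s flip: mult.assoc power_add)
      then show ?thesis
        using r by blast
    next
      case False
      then have "u = m ^ l * (m ^ (i - l) * r)"
        by (simp add: r flip: mult.assoc power_add)
      then show ?thesis
        using s by blast
    qed
  qed
qed

text \<open>With \<open>T = x\<close>, \<open>Y = x y\<close> or \<open>T = 1/x\<close>, \<open>Y = y / x ^ (2 ^ (k - 1) + 1)\<close> the curve has an affine
  equation of one and the same shape, smooth everywhere; these two charts cover it.\<close>

definition lin_poly :: "nat \<Rightarrow> bit poly" where
  "lin_poly j = monom 1 j"

definition cst_poly :: "nat \<Rightarrow> bit poly" where
  "cst_poly N = monom 1 1 + monom 1 N"

text \<open>The equation says that \<open>u + v Y\<close> has norm 0, so the lemma expresses that
  \<open>Y\<close> is not rational in \<open>T\<close>. Infinite descent: \<open>cst_poly N\<close>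
  is divisible by \<open>X\<close> exactly once, so \<open>X\<close> divides first \<open>u\<close>
  and then \<open>v\<close>, and the quotients satisfy the same equation.\<close>

lemma norm_form_eq_0:
  fixes u v :: "bit poly"
  assumes "j \<ge> 1" "N \<ge> 2" "u * u = lin_poly j * u * v + cst_poly N * v * v"
  shows "u = 0 \<and> v = 0"
  using assms(3)
proof (induction "degree v" arbitrary: u v rule: less_induct)
  case less
  define z :: "bit poly" where "z = monom 1 1"
  obtain j' where j': "j = Suc j'"
    using assms by (cases j) auto
  obtain N' where N': "N = Suc (Suc N')"
    using assms by (metis One_nat_def Suc_1 Suc_le_D Suc_le_mono)
  have z0: "z \<noteq> 0"
    by (simp add: z_def)
  have split: "\<exists>p'. p = z * p'" if "coeff p 0 = 0" for p
    using that by (cases p) (auto simp: z_def monom_Suc)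
  have s: "lin_poly j = z * monom 1 j'"
    by (simp add: lin_poly_def z_def j' mult_monom)
  have n: "cst_poly N = z * (1 + z * monom 1 N')"
    by (simp add: cst_poly_def z_def N' mult_monom distrib_left flip: one_poly_eq_simps(1))
  have "coeff u 0 * coeff u 0 = 0"
    using arg_cong [OF less.prems, of "\<lambda>p. coeff p 0"]
    by (simp add: coeff_mult s n z_def)
  then obtain u' where u': "u = z * u'"
    using split by auto
  have "z * (z * u' * u') = z * (z * monom 1 j' * u' * v + (1 + z * monom 1 N') * v * v)"
    using less.prems unfolding s n u' by (simp add: algebra_simps)
  then have *: "z * u' * u' = z * monom 1 j' * u' * v + (1 + z * monom 1 N') * v * v"
    using z0 by simp
  have "coeff v 0 * coeff v 0 = 0"
    using arg_cong [OF *, of "\<lambda>p. coeff p 0"]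
    by (simp add: coeff_mult z_def)
  then obtain v' where v': "v = z * v'"
    using split by auto
  have "z * (u' * u') = z * (lin_poly j * u' * v' + cst_poly N * v' * v')"
    using * unfolding s n v' by (simp add: algebra_simps)
  then have **: "u' * u' = lin_poly j * u' * v' + cst_poly N * v' * v'"
    using z0 by simp
  show ?case
  proof (cases "v = 0")
    case True
    then show ?thesis
      using less.prems by simp
  next
    case False
    then have "degree v' < degree v"
      by (auto simp: v' degree_mult_eq z0) (simp add: z_def degree_monom_eq)
    then show ?thesis
      using less.hyps [OF _ **] by (simp add: u' v')
  qed
qed

locale chart =
  fixes T Y :: "'e::{field,char2}" and j N :: nat
  assumes transc: "ev p T = 0 \<Longrightarrow> p = 0" and j: "j \<ge> 1" and N: "N \<ge> 2"
    and Y_eq: "Y * Y = T ^ j * Y + T + T ^ N"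
begin

definition el :: "bit poly \<Rightarrow> bit poly \<Rightarrow> 'e" where
  "el u v = ev u T + ev v T * Y"

definition fracs :: "'e set" where
  "fracs = {el u v / el u' v' | u v u' v'. el u' v' \<noteq> 0}"

lemma el_add: "el u v + el u' v' = el (u + u') (v + v')"
  by (simp add: el_def algebra_simps)

lemma ev_eqs: "ev (lin_poly j) t = t ^ j" "ev (cst_poly N) t = t + t ^ N"
  by (simp_all add: lin_poly_def cst_poly_def)

lemma el_mult: "el u v * el u' v' =
  el (u * u' + cst_poly N * v * v') (u * v' + u' * v + lin_poly j * v * v')"
proof -
  have "el u v * el u' v' = ev u T * ev u' T + (ev u T * ev v' T + ev u' T * ev v T) * Y
      + ev v T * ev v' T * (Y * Y)"
    by (simp add: el_def algebra_simps)
  then show ?thesis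
    by (simp only: Y_eq) (simp add: el_def ev_eqs algebra_simps)
qed

lemma el_eq_0: "el u v = 0 \<longleftrightarrow> u = 0 \<and> v = 0"
proof
  assume "el u v = 0"
  then have u: "ev u T = ev v T * Y"
    by (simp add: el_def add_eq_0_iff_char2)
  have "ev u T * ev u T = ev v T * ev v T * (Y * Y)"
    by (simp add: u mult_ac)
  also have "\<dots> = T ^ j * (ev v T * Y) * ev v T + (T + T ^ N) * ev v T * ev v T"
    by (simp only: Y_eq) (simp add: algebra_simps)
  finally have "ev (u * u + (lin_poly j * u * v + cst_poly N * v * v)) T = 0"
    by (simp add: ev_eqs flip: u)
  then have "u * u = lin_poly j * u * v + cst_poly N * v * v"
    using transc add_eq_0_iff_char2 by blast
  then show "u = 0 \<and> v = 0"
    using norm_form_eq_0 j N by blast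
qed (simp add: el_def)

lemma one_el: "1 = el 1 0" and T_el: "T = el (monom 1 1) 0" and Y_el: "Y = el 0 1"
  by (simp_all add: el_def)

lemma el_in_fracs: "el u v \<in> fracs"
proof -
  have "el u v = el u v / el 1 0" "el 1 0 \<noteq> 0"
    by (simp_all flip: one_el)
  then show ?thesis
    unfolding fracs_def by blast
qed

lemma one_in_fracs: "1 \<in> fracs"
  using el_in_fracs [of 1 0] by (simp flip: one_el)

lemma fracs_add:
  assumes "x \<in> fracs" "y \<in> fracs"
  shows "x + y \<in> fracs"
proof -
  obtain u v u' v' p q p' q' where *: "x = el u v / el u' v'" "el u' v' \<noteq> 0"
      "y = el p q / el p' q'" "el p' q' \<noteq> 0"
    using assms by (auto simp: fracs_def)
  then have "x + y = (el u v * el p' q' + el p q * el u' v') / (el u' v' * el p' q')"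
      "el u' v' * el p' q' \<noteq> 0"
    by (auto simp: add_frac_eq)
  then show ?thesis
    unfolding el_mult el_add fracs_def by blast
qed

lemma fracs_mult:
  assumes "x \<in> fracs" "y \<in> fracs"
  shows "x * y \<in> fracs"
proof -
  obtain u v u' v' p q p' q' where *: "x = el u v / el u' v'" "el u' v' \<noteq> 0"
      "y = el p q / el p' q'" "el p' q' \<noteq> 0"
    using assms by (auto simp: fracs_def)
  then have "x * y = (el u v * el p q) / (el u' v' * el p' q')"
      "el u' v' * el p' q' \<noteq> 0"
    by auto
  then show ?thesis
    unfolding el_mult el_add fracs_def by blast
qed

lemma fracs_inverse:
  assumes "x \<in> fracs"
  shows "inverse x \<in> fracs"
proof -
  obtain u v u' v' where *: "x = el u v / el u' v'" "el u' v' \<noteq> 0"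
    using assms by (auto simp: fracs_def)
  show ?thesis
  proof (cases "el u v = 0")
    case True
    then show ?thesis
      using el_in_fracs [of 0 0] * by (simp add: el_def)
  next
    case False
    moreover have "inverse x = el u' v' / el u v"
      using * by simp
    ultimately show ?thesis
      unfolding fracs_def by blast
  qed
qed

lemma fracs_power: "x \<in> fracs \<Longrightarrow> x ^ n \<in> fracs"
  by (induction n) (auto intro: fracs_mult one_in_fracs)

lemma generate_field_eq_fracs:
  assumes "S \<subseteq> fracs" "T \<in> generate_field ring_of_type_algebra S"
    "Y \<in> generate_field ring_of_type_algebra S"
  shows "generate_field ring_of_type_algebra S = fracs"
proof
  show "generate_field ring_of_type_algebra S \<subseteq> fracs"
  proof
    fix x
    assume "x \<in> generate_field ring_of_type_algebra S"
    then show "x \<in> fracs"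
    proof (induction rule: generate_field.induct)
      case one
      then show ?case
        using one_in_fracs by simp
    qed (use assms in \<open>auto simp: uminus_char2 intro: fracs_add fracs_mult fracs_inverse\<close>)
  qed
next
  let ?F = "generate_field ring_of_type_algebra S"
  have add: "x + y \<in> ?F" and mult: "x * y \<in> ?F" if "x \<in> ?F" "y \<in> ?F" for x y
    using generate_field.eng_add [OF that] generate_field.eng_mult [OF that] by auto
  have one: "1 \<in> ?F"
    using generate_field.one [of ring_of_type_algebra S] by simp
  then have zero: "0 \<in> ?F"
    using add [of 1 1] by simp
  have inv: "inverse x \<in> ?F" if "x \<in> ?F" for x
    using generate_field.m_inv [OF that] that by (cases "x = 0") auto
  have ev: "ev p T \<in> ?F" for p
    by (induction p) (use assms in \<open>auto intro!: add mult zero simp: emb_def one\<close>)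
  have "el u v \<in> ?F" for u v
    unfolding el_def by (intro add mult ev assms)
  then show "fracs \<subseteq> ?F"
    unfolding fracs_def by (auto simp: divide_inverse intro!: mult inv)
qed

end

text \<open>A point \<open>(a, b)\<close> of the chart with coordinates in another field.
  Algebraicity of \<open>a\<close> excludes the generic point and supplies the minimal polynomial
  from which a uniformizer is made.\<close>

locale chart_point = chart T Y j N for T Y :: "'e::{field,char2}" and j N +
  fixes a b :: "'l::{field,char2}"
  assumes b_eq: "b * b = a ^ j * b + a + a ^ N"
    and algebraic: "\<exists>p. p \<noteq> 0 \<and> ev p a = 0"
begin

definition im :: "bit poly \<Rightarrow> bit poly \<Rightarrow> 'l" where
  "im u v = ev u a + ev v a * b"

definition G :: "('e \<times> 'l) set" where
  "G = {(el u v, im u v) | u v. True}"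

lemma im_add: "im u v + im u' v' = im (u + u') (v + v')"
  by (simp add: im_def algebra_simps)

lemma im_mult: "im u v * im u' v' =
  im (u * u' + cst_poly N * v * v') (u * v' + u' * v + lin_poly j * v * v')"
proof -
  have "im u v * im u' v' = ev u a * ev u' a + (ev u a * ev v' a + ev u' a * ev v a) * b
      + ev v a * ev v' a * (b * b)"
    by (simp add: im_def algebra_simps)
  then show ?thesis
    by (simp only: b_eq) (simp add: im_def ev_eqs algebra_simps)
qed

lemma mem_G: "(el u v, im u v) \<in> G"
  by (auto simp: G_def)

sublocale hom_graph G
proof
  show "(1, 1) \<in> G"
    using mem_G [of 1 0] by (simp add: el_def im_def)
next
  fix x c y d
  assume "(x, c) \<in> G" "(y, d) \<in> G"
  then obtain u v u' v' where "x = el u v" "c = im u v" "y = el u' v'" "d = im u' v'"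
    by (auto simp: G_def)
  then show "(x + y, c + d) \<in> G" "(x * y, c * d) \<in> G"
    by (simp_all only: el_add im_add el_mult im_mult mem_G)
next
  fix c
  assume "(0, c) \<in> G"
  then obtain u v where "el u v = 0" "c = im u v"
    by (auto simp: G_def)
  then show "c = 0"
    by (simp add: el_eq_0 im_def)
qed

lemma fractions_eq: "fractions = fracs"
proof
  show "fractions \<subseteq> fracs"
  proof
    fix x
    assume "x \<in> fractions"
    then obtain g h c d where "x = g / h" "(g, c) \<in> G" "(h, d) \<in> G" "h \<noteq> 0"
      unfolding fractions_def by blast
    then show "x \<in> fracs"
      unfolding fracs_def by (auto simp: G_def)
  qed
  show "fracs \<subseteq> fractions"
    unfolding fractions_def fracs_def using mem_G by blast
qed

lemma T_mem: "(T, a) \<in> G"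
  using mem_G [of "monom 1 1" 0] by (simp add: el_def im_def)

lemma Y_mem: "(Y, b) \<in> G"
  using mem_G [of 0 1] by (simp add: el_def im_def)

lemma poly_mem: "(ev p T, ev p a) \<in> G"
  using mem_G [of p 0] by (simp add: el_def im_def)

lemma ev_T_nonzero: "p \<noteq> 0 \<Longrightarrow> ev p T \<noteq> 0"
  using transc by blast

text \<open>The chart equation has \<open>Y\<close>-derivative \<open>T ^ j\<close>, nonzero at
  \<open>a\<close>. So the projection to \<open>T\<close> is unramified here, and the minimal
  polynomial of \<open>a\<close>, evaluated at \<open>T\<close>, is a uniformizer.\<close>

lemma uniformizer_unramified:
  assumes "a \<noteq> 0"
  shows "\<exists>w. (w, 0) \<in> G \<and> w \<noteq> 0 \<and> (\<forall>g c. (g, c) \<in> G \<longrightarrow> g \<noteq> 0 \<longrightarrow>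
      (\<exists>i x y d e. (x, d) \<in> G \<and> (y, e) \<in> G \<and> d \<noteq> 0 \<and> e \<noteq> 0 \<and> g * x = w ^ i * y))"
proof -
  obtain m where m: "m \<noteq> 0" "ev m a = 0" "\<And>q. ev q a = 0 \<Longrightarrow> m dvd q"
    using algebraic exists_minimal_poly by metis
  define w where "w = ev m T"
  have w: "(w, 0) \<in> G" "w \<noteq> 0"
    using poly_mem [of m] m ev_T_nonzero by (auto simp: w_def)
  have "\<exists>i x y d e. (x, d) \<in> G \<and> (y, e) \<in> G \<and> d \<noteq> 0 \<and> e \<noteq> 0 \<and> g * x = w ^ i * y"
    if gG: "(g, c) \<in> G" and g0: "g \<noteq> 0" for g c
  proof -
    obtain u v where g: "g = el u v" "c = im u v"
      using gG by (auto simp: G_def)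
    have "u \<noteq> 0 \<or> v \<noteq> 0"
      using g0 g by (auto simp: el_eq_0)
    then obtain i u1 v1 where uv: "u = m ^ i * u1" "v = m ^ i * v1" "ev u1 a \<noteq> 0 \<or> ev v1 a \<noteq> 0"
      using split_off_common_power [OF m] by blast
    have g_eq: "g = w ^ i * el u1 v1"
      by (simp add: g el_def uv w_def algebra_simps)
    show ?thesis
    proof (cases "im u1 v1 = 0")
      case False
      then show ?thesis
        using g_eq one_mem mem_G by (metis mult.right_neutral one_neq_zero)
    next
      case True
      \<comment> \<open>\<open>el u2 v1\<close> is the conjugate of \<open>el u1 v1\<close> under
        \<open>Y \<mapsto> Y + T ^ j\<close>. It does not vanish at the point, and the product of
        the two is the norm, a polynomial in \<open>T\<close> alone, from which powers of
        \<open>m\<close> split off.\<close>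
      define u2 where "u2 = u1 + lin_poly j * v1"
      have im2: "im u2 v1 = ev v1 a * a ^ j"
      proof -
        have "im u2 v1 = im u1 v1 + ev v1 a * a ^ j"
          by (simp add: im_def u2_def ev_eqs algebra_simps)
        then show ?thesis
          using True by simp
      qed
      have nz: "ev v1 a \<noteq> 0"
      proof
        assume v0: "ev v1 a = 0"
        then have u0: "ev u1 a = 0"
          using True by (simp add: im_def)
        show False
          using v0 u0 uv by simp
      qed
      define n where "n = u1 * u2 + cst_poly N * v1 * v1"
      have prod: "el u1 v1 * el u2 v1 = ev n T"
      proof -
        have "u1 * v1 + u2 * v1 + lin_poly j * v1 * v1 = 0"
          by (simp add: u2_def algebra_simps)
        then show ?thesis
          unfolding el_mult by (simp add: n_def el_def)
      qed
      have im2': "im u2 v1 \<noteq> 0"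
        using im2 nz assms by simp
      have "el u1 v1 \<noteq> 0" "el u2 v1 \<noteq> 0"
        using nz by (auto simp: el_eq_0)
      then have "n \<noteq> 0"
        using prod by auto
      then obtain l n' where n': "n = m ^ l * n'" "ev n' a \<noteq> 0"
        using split_off_power [OF m] by blast
      have "g * el u2 v1 = w ^ i * (el u1 v1 * el u2 v1)"
        by (simp add: g_eq mult_ac)
      also have "\<dots> = w ^ (i + l) * ev n' T"
        by (simp add: prod n' w_def power_add mult_ac)
      finally have eq: "g * el u2 v1 = w ^ (i + l) * ev n' T" .
      show ?thesis
        using n'(2) poly_mem eq im2' mem_G by blast
    qed
  qed
  then show ?thesis
    using w by blast
qed

text \<open>At the ramified point \<open>T\<close> is a unit times \<open>Y\<^sup>2\<close>.\<close>

lemma uniformizer_ramified: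
  assumes a: "a = 0"
  shows "\<exists>w. (w, 0) \<in> G \<and> w \<noteq> 0 \<and> (\<forall>g c. (g, c) \<in> G \<longrightarrow> g \<noteq> 0 \<longrightarrow>
      (\<exists>i x y d e. (x, d) \<in> G \<and> (y, e) \<in> G \<and> d \<noteq> 0 \<and> e \<noteq> 0 \<and> g * x = w ^ i * y))"
proof -
  have b: "b = 0"
    using b_eq a j N by (simp add: power_0_left)
  have Y: "(Y, 0) \<in> G" "Y \<noteq> 0"
    using Y_mem b el_eq_0 [of 0 1] by (auto simp flip: Y_el)
  have m: "(monom 1 1 :: bit poly) \<noteq> 0" "ev (monom 1 1) a = 0"
    by (simp_all add: a)
  have m3: "monom 1 1 dvd q" if "ev q a = 0" for q
    using that by (simp add: a ev_0_right monom_1_dvd_iff')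
  obtain j' where j': "j = Suc j'"
    using j by (cases j) auto
  obtain N' where N': "N = Suc (Suc N')"
    using N by (metis One_nat_def Suc_1 Suc_le_D Suc_le_mono)
  \<comment> \<open>Factor of \<open>T\<close> in \<open>Y ^ 2\<close>. Its value is 1 even for
    \<open>j = 1\<close>, where the last term is \<open>Y\<close> itself, because \<open>Y\<close>
    vanishes at this point.\<close>
  define \<epsilon> where "\<epsilon> = 1 + T ^ Suc N' + T ^ j' * Y"
  have T\<epsilon>: "T * \<epsilon> = Y ^ 2"
    by (simp add: power2_eq_square Y_eq \<epsilon>_def j' N' algebra_simps)
  have T_mem0: "(T, 0) \<in> G"
    using T_mem a by simp
  have "(\<epsilon>, 1 + 0 ^ Suc N' + 0 ^ j' * 0) \<in> G"
    unfolding \<epsilon>_def by (intro add_mem mult_mem power_mem one_mem T_mem0 Y)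
  then have \<epsilon>: "(\<epsilon>, 1) \<in> G"
    by simp
  have \<epsilon>pow: "(\<epsilon> ^ n, 1) \<in> G" for n
    using power_mem [OF \<epsilon>, of n] by simp
  have T\<epsilon>pow: "T ^ i * \<epsilon> ^ i = Y ^ (2 * i)" for i
    by (simp add: T\<epsilon> power_mult flip: power_mult_distrib)
  have Ypow: "(Y ^ Suc n * z, 0) \<in> G" if "(z, d) \<in> G" for n z d
    using mult_mem [OF power_mem [OF Y(1), of "Suc n"] that] by simp
  have "\<exists>i x y d e. (x, d) \<in> G \<and> (y, e) \<in> G \<and> d \<noteq> 0 \<and> e \<noteq> 0 \<and> g * x = Y ^ i * y"
    if gG: "(g, c) \<in> G" and g0: "g \<noteq> 0" for g c
  proof -
    obtain u v where g: "g = ev u T + ev v T * Y"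
      using gG by (auto simp: G_def el_def)
    consider "u \<noteq> 0" "v = 0" | "u = 0" "v \<noteq> 0" | "u \<noteq> 0" "v \<noteq> 0"
      using g0 g by fastforce
    then show ?thesis
    proof cases
      case 1
      obtain i r where "u = monom 1 1 ^ i * r" "ev r a \<noteq> 0"
        using split_off_power [OF m m3 1(1)] by blast
      then have "g * \<epsilon> ^ i = Y ^ (2 * i) * ev r T"
        using T\<epsilon>pow [of i] 1 by (simp add: g mult_ac)
      then show ?thesis
        using \<epsilon>pow poly_mem \<open>ev r a \<noteq> 0\<close> one_neq_zero by blast
    next
      case 2
      obtain i r where "v = monom 1 1 ^ i * r" "ev r a \<noteq> 0"
        using split_off_power [OF m m3 2(2)] by blast
      then have "g * \<epsilon> ^ i = Y ^ Suc (2 * i) * ev r T"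
        using T\<epsilon>pow [of i] 2 by (simp add: g mult_ac)
      then show ?thesis
        using \<epsilon>pow poly_mem \<open>ev r a \<noteq> 0\<close> one_neq_zero by blast
    next
      case 3
      obtain i r where r: "u = monom 1 1 ^ i * r" "ev r a \<noteq> 0"
        using split_off_power [OF m m3 3(1)] by blast
      obtain l s where s: "v = monom 1 1 ^ l * s" "ev s a \<noteq> 0"
        using split_off_power [OF m m3 3(2)] by blast
      \<comment> \<open>The two summands have orders \<open>2 * i\<close> and
        \<open>2 * l + 1\<close> in \<open>Y\<close>. These differ in parity, so no cancellation can
        occur: the lower power factors out and leaves a unit.\<close>
      have "g * \<epsilon> ^ (i + l) = (T ^ i * \<epsilon> ^ i) * (\<epsilon> ^ l * ev r T) + (T ^ l * \<epsilon> ^ l) * Y * (\<epsilon> ^ i * ev s T)"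
        by (simp add: g r s algebra_simps power_add)
      then have eq: "g * \<epsilon> ^ (i + l) =
          Y ^ (2 * i) * (\<epsilon> ^ l * ev r T) + Y ^ Suc (2 * l) * (\<epsilon> ^ i * ev s T)"
        by (simp only: T\<epsilon>pow) (simp add: mult_ac)
      have R: "(\<epsilon> ^ l * ev r T, ev r a) \<in> G" and S: "(\<epsilon> ^ i * ev s T, ev s a) \<in> G"
        using mult_mem [OF \<epsilon>pow poly_mem] by force+
      show ?thesis
      proof (cases "i \<le> l")
        case True
        then have "Suc (2 * l) = 2 * i + Suc (2 * (l - i))"
          by simp
        then have "g * \<epsilon> ^ (i + l) =
          Y ^ (2 * i) * (\<epsilon> ^ l * ev r T + Y ^ Suc (2 * (l - i)) * (\<epsilon> ^ i * ev s T))"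
          unfolding eq by (simp only: power_add distrib_left mult.assoc)
        moreover have "(\<epsilon> ^ l * ev r T + Y ^ Suc (2 * (l - i)) * (\<epsilon> ^ i * ev s T), ev r a) \<in> G"
          using add_mem [OF R Ypow [OF S]] by force
        ultimately show ?thesis
          using \<epsilon>pow r(2) one_neq_zero by blast
      next
        case False
        then have "2 * i = Suc (2 * l) + Suc (2 * (i - Suc l))"
          by simp
        then have "g * \<epsilon> ^ (i + l) =
          Y ^ Suc (2 * l) * (Y ^ Suc (2 * (i - Suc l)) * (\<epsilon> ^ l * ev r T) + \<epsilon> ^ i * ev s T)"
          unfolding eq by (simp only: power_add distrib_left mult.assoc)
        moreover have "(Y ^ Suc (2 * (i - Suc l)) * (\<epsilon> ^ l * ev r T) + \<epsilon> ^ i * ev s T, ev s a) \<in> G"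
          using add_mem [OF Ypow [OF R] S] by force
        ultimately show ?thesis
          using \<epsilon>pow s(2) one_neq_zero by blast
      qed
    qed
  qed
  then show ?thesis
    using Y by blast
qed

lemma local_ring_is_valuation_ring:
  shows "local_ring \<subset> fractions"
    and "\<And>z. z \<in> fractions \<Longrightarrow> z \<noteq> 0 \<Longrightarrow> z \<in> local_ring \<or> inverse z \<in> local_ring"
proof -
  obtain w where w: "(w, 0) \<in> G" "w \<noteq> 0" "\<And>g c. (g, c) \<in> G \<Longrightarrow> g \<noteq> 0 \<Longrightarrow>
      \<exists>i x y d e. (x, d) \<in> G \<and> (y, e) \<in> G \<and> d \<noteq> 0 \<and> e \<noteq> 0 \<and> g * x = w ^ i * y"
    using uniformizer_ramified uniformizer_unramified by (metis (no_types, lifting))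
  show "local_ring \<subset> fractions"
    by (rule valuation_ring_if_uniformizer(1) [OF w(1,2)]) (rule w(3))
  show "\<And>z. z \<in> fractions \<Longrightarrow> z \<noteq> 0 \<Longrightarrow> z \<in> local_ring \<or> inverse z \<in> local_ring"
    by (rule valuation_ring_if_uniformizer(2) [OF w(1,2)]) (rule w(3))
qed

end

section \<open>Points of the curve\<close>

lemma ev_ratfun_x: "ev p ratfun_x = to_ac (Fract p 1)"
proof (induction p)
  case 0
  then show ?case
    by (simp add: fract_collapse)
next
  case (pCons c p)
  have "Fract (pCons c p) 1 = Fract [:c:] 1 + Fract [:0, 1:] 1 * Fract p 1"
    by simp
  moreover have "emb c = to_ac (Fract [:c:] 1)"
    by (cases c) (simp_all add: fract_collapse pCons_one)
  ultimately show ?case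
    using pCons by (simp only: to_ac_add to_ac_mult ev_simps ratfun_x_def)
qed

lemma ratfun_x_transcendental: "ev p ratfun_x = 0 \<Longrightarrow> p = 0"
  by (simp add: ev_ratfun_x Zero_fract_def eq_fract)

lemma ratfun_x_nonzero: "ratfun_x \<noteq> 0"
  using ratfun_x_transcendental [of "monom 1 1"] by auto

lemma ev_reflect_poly:
  fixes t :: "'a::{field,char2}"
  assumes "t \<noteq> 0"
  shows "ev (reflect_poly p) t = t ^ degree p * ev p (inverse t)"
proof -
  have "reflect_poly (lift_poly p :: 'a poly) = lift_poly (reflect_poly p)"
    by (simp add: poly_eq_iff coeff_reflect_poly)
  then show ?thesis
    using poly_reflect_poly_nz [OF assms, of "lift_poly p"] by (simp add: ev_def)
qed

lemma inverse_ratfun_x_transcendental: "ev p (inverse ratfun_x) = 0 \<Longrightarrow> p = 0"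
  using ev_reflect_poly [OF ratfun_x_nonzero, of p] ratfun_x_transcendental by fastforce

lemma artin_schreier_root:
  fixes c :: "'a::alg_closed_field"
  shows "\<exists>y. y\<^sup>2 + y = c"
proof -
  obtain y where "poly [:- c, 1, 1:] y = 0"
    using alg_closed_imp_poly_has_root [of "[:- c, 1, 1:]"] by auto
  then show ?thesis
    by (intro exI [of _ y]) (simp add: algebra_simps power2_eq_square eq_neg_iff_add_eq_0)
qed

lemma artin_schreier_roots:
  fixes y :: "'a::{field,char2}"
  assumes "y\<^sup>2 + y = c"
  shows "z\<^sup>2 + z = c \<longleftrightarrow> z = y \<or> z = y + 1"
proof -
  have "z\<^sup>2 + z = c \<longleftrightarrow> (z + y) * (z + y + 1) = 0"
    unfolding assms [symmetric]
    by (subst add_eq_0_iff_char2 [symmetric]) (simp add: algebra_simps power2_eq_square)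
  then show ?thesis
    by (auto simp: add_eq_0_iff_char2 add.assoc)
qed

locale curve =
  fixes k n :: nat and y0 :: ratfun_closure
  assumes k: "k \<ge> 1" and n: "n \<ge> 1"
    and y0: "y0\<^sup>2 + y0 = ratfun_x ^ (2 ^ k + 1) + inverse ratfun_x"
begin

abbreviation "x \<equiv> ratfun_x"

text \<open>Clearing denominators produces \<open>x ^ 2 * x ^ (2 ^ k + 1)\<close> in the first chart
  and, with \<open>t = inverse x\<close>, \<open>t ^ (2 * h) * t\<close> in the second; both
  exponents are \<open>2 ^ k + 3\<close>.\<close>

abbreviation "N \<equiv> 2 ^ k + 3 :: nat"

text \<open>Half of \<open>2 ^ k + 2\<close>, which is one more than the pole order of
  \<open>x ^ (2 ^ k + 1)\<close> at infinity: multiplying by \<open>inverse x ^ (2 * h)\<close>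
  leaves exactly one factor \<open>inverse x\<close>, as smoothness there demands.\<close>

definition h :: nat where "h = 2 ^ (k - 1) + 1"

lemma h2: "2 * h = 2 ^ k + 2"
  using power_Suc [of "2::nat" "k - 1"] k by (simp add: h_def)

lemma y0_sq: "y0 * y0 = y0 + (x ^ (2 ^ k + 1) + inverse x)"
  using y0 unfolding power2_eq_square by (metis add_self_left add.commute)

sublocale A: chart x "x * y0" 1 N
proof
  have "x * y0 * (x * y0) = x * x * (y0 * y0)"
    by (simp add: mult_ac)
  also have "\<dots> = x ^ 1 * (x * y0) + x + x ^ N"
    unfolding y0_sq using ratfun_x_nonzero
    by (simp add: algebra_simps power_add numeral_3_eq_3)
  finally show "x * y0 * (x * y0) = x ^ 1 * (x * y0) + x + x ^ N" .
qed (use ratfun_x_transcendental in auto)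

sublocale B: chart "inverse x" "inverse x ^ h * y0" h N
proof
  define t where "t = inverse x"
  have xt: "x * t = 1"
    using ratfun_x_nonzero by (simp add: t_def)
  have pow: "t ^ (2 * h) * x ^ (2 ^ k + 1) = t"
  proof -
    have "t ^ (2 * h) * x ^ (2 ^ k + 1) = (x * t) ^ (2 ^ k + 1) * t"
      unfolding h2 by (simp add: power_mult_distrib mult_ac)
    then show ?thesis
      by (simp add: xt)
  qed
  have "t ^ h * y0 * (t ^ h * y0) = t ^ (2 * h) * (y0 * y0)"
    by (simp only: mult_2 power_add) (simp only: mult_ac)
  also have "\<dots> = t ^ h * (t ^ h * y0) + (t ^ (2 * h) * x ^ (2 ^ k + 1) + t ^ (2 * h) * t)"
    unfolding y0_sq mult_2 power_add t_def by (simp only: distrib_left mult.assoc)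
  also have "t ^ (2 * h) * t = t ^ N"
    unfolding h2 by (simp add: numeral_3_eq_3 mult_ac)
  also note pow
  finally show "inverse x ^ h * y0 * (inverse x ^ h * y0) =
      inverse x ^ h * (inverse x ^ h * y0) + inverse x + inverse x ^ N"
    by (simp add: t_def add.assoc)
qed (use inverse_ratfun_x_transcendental in \<open>auto simp: h_def\<close>)

definition gens :: "ratfun_closure set" where
  "gens = insert x {y. y\<^sup>2 + y = x ^ (2 ^ k + 1) + inverse x}"

lemma gens_eq: "gens = {x, y0, y0 + 1}"
  unfolding gens_def using artin_schreier_roots [OF y0] by auto

lemma function_field_eq: "function_field k = generate_field ring_of_type_algebra gens"
  by (simp add: function_field_def gens_def)

lemma function_field_closed:
  "a \<in> function_field k \<Longrightarrow> b \<in> function_field k \<Longrightarrow> a * b \<in> function_field k"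
  "a \<in> function_field k \<Longrightarrow> inverse a \<in> function_field k"
  "1 \<in> function_field k"
proof -
  show one: "1 \<in> function_field k"
    using generate_field.one [of ring_of_type_algebra gens] by (simp add: function_field_eq)
  have zero: "0 \<in> function_field k"
    using generate_field.eng_add [of 1 ring_of_type_algebra gens 1] one
    by (simp add: function_field_eq)
  show "a * b \<in> function_field k" if "a \<in> function_field k" "b \<in> function_field k"
    using generate_field.eng_mult [of a ring_of_type_algebra gens b] that
    by (simp add: function_field_eq)
  show "inverse a \<in> function_field k" if "a \<in> function_field k"
    using generate_field.m_inv [of a ring_of_type_algebra gens] that zero
    by (cases "a = 0") (simp_all add: function_field_eq)
qed

lemma function_field_power: "a \<in> function_field k \<Longrightarrow> a ^ m \<in> function_field k"
  by (induction m) (auto intro: function_field_closed)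

lemma gens_mem: "x \<in> function_field k" "y0 \<in> function_field k"
  unfolding function_field_eq by (auto intro: generate_field.incl simp: gens_eq)

lemma A_fracs: "A.fracs = function_field k"
  unfolding function_field_eq
proof (rule A.generate_field_eq_fracs [symmetric])
  show "x \<in> generate_field ring_of_type_algebra gens"
    "x * y0 \<in> generate_field ring_of_type_algebra gens"
    using gens_mem function_field_closed(1) by (simp_all flip: function_field_eq)
  have 1: "x \<in> A.fracs"
    using A.el_in_fracs [of "monom 1 1" 0] by (simp only: A.T_el [symmetric])
  have "x * y0 \<in> A.fracs"
    using A.el_in_fracs [of 0 1] by (simp flip: A.Y_el)
  then have "inverse x * (x * y0) \<in> A.fracs"
    by (rule A.fracs_mult [OF A.fracs_inverse [OF 1]])
  moreover have "inverse x * (x * y0) = y0"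
    using ratfun_x_nonzero by (simp flip: mult.assoc)
  ultimately have "y0 \<in> A.fracs"
    by simp
  then show "gens \<subseteq> A.fracs"
    using 1 A.one_in_fracs A.fracs_add unfolding gens_eq by blast
qed

lemma B_fracs: "B.fracs = function_field k"
  unfolding function_field_eq
proof (rule B.generate_field_eq_fracs [symmetric])
  show "inverse x \<in> generate_field ring_of_type_algebra gens"
    "inverse x ^ h * y0 \<in> generate_field ring_of_type_algebra gens"
    using gens_mem function_field_closed function_field_power by (simp_all flip: function_field_eq)
  have 1: "inverse x \<in> B.fracs"
    using B.el_in_fracs [of "monom 1 1" 0] by (simp only: B.T_el [symmetric])
  then have 2: "x \<in> B.fracs"
    using B.fracs_inverse by fastforce
  have "inverse x ^ h * y0 \<in> B.fracs"
    using B.el_in_fracs [of 0 1] by (simp flip: B.Y_el)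
  then have "x ^ h * (inverse x ^ h * y0) \<in> B.fracs"
    by (rule B.fracs_mult [OF B.fracs_power [OF 2]])
  moreover have "x ^ h * (inverse x ^ h * y0) = y0"
    using ratfun_x_nonzero by (simp flip: mult.assoc power_mult_distrib)
  ultimately have "y0 \<in> B.fracs"
    by simp
  then show "gens \<subseteq> B.fracs"
    using 2 B.one_in_fracs B.fracs_add unfolding gens_eq by blast
qed

definition Aff :: "(bit alg_closure \<times> bit alg_closure) set" where
  "Aff = {(a, b). a \<in> gf2 n \<and> b \<in> gf2 n \<and> b * b = a * b + a + a ^ N}"

definition ptA where
  "ptA a b = (hom_graph.local_ring (chart_point.G x (x * y0) a b),
     hom_graph.residue (chart_point.G x (x * y0) a b))"

text \<open>The one point at which \<open>x\<close> has a pole. There \<open>inverse x\<close> is 0,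
  and the equation of the second chart forces its other coordinate to be 0.\<close>

definition ptB :: "ratfun_closure set \<times> (ratfun_closure \<Rightarrow> bit alg_closure)" where
  "ptB = (let G = chart_point.G (inverse x) (inverse x ^ h * y0) 0 (0 :: bit alg_closure)
     in (hom_graph.local_ring G, hom_graph.residue G))"

lemma algebraic_gf2: "a \<in> gf2 n \<Longrightarrow> \<exists>p. p \<noteq> 0 \<and> ev p a = 0"
  using frob_poly_nonzero [OF n] by (intro exI [of _ "frob_poly n"]) (simp add: ev_def gf2_def)

lemma chart_pointA: "(a, b) \<in> Aff \<Longrightarrow> chart_point x (x * y0) 1 N a b"
  by (intro chart_point.intro A.chart_axioms chart_point_axioms.intro)
    (auto simp: Aff_def algebraic_gf2)

lemma chart_pointB:
  "chart_point (inverse x) (inverse x ^ h * y0) h N 0 (0 :: bit alg_closure)"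
  by (intro chart_point.intro B.chart_axioms chart_point_axioms.intro)
    (auto simp: algebraic_gf2 h_def)

lemma ptA_mem:
  assumes "(a, b) \<in> Aff"
  shows "ptA a b \<in> curve_points k n" "x \<in> fst (ptA a b)"
    "snd (ptA a b) x = a" "snd (ptA a b) (x * y0) = b"
proof -
  interpret P: chart_point x "x * y0" 1 N a b
    by (rule chart_pointA [OF assms])
  have "c \<in> gf2 n" if "(g, c) \<in> P.G" for g c
    using that assms
    by (auto simp: P.G_def P.im_def Aff_def ev_def intro!: gf2_add gf2_mult gf2_poly)
  then show "ptA a b \<in> curve_points k n"
    unfolding ptA_def
    using P.fractions_eq A_fracs P.local_ring_is_valuation_ring
    by (intro curve_pointI P.hom_graph_axioms) simp_all
  show "x \<in> fst (ptA a b)" "snd (ptA a b) x = a" "snd (ptA a b) (x * y0) = b"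
    unfolding ptA_def
    using P.G_subset_localised [OF P.T_mem] P.G_subset_localised [OF P.Y_mem]
    by (simp_all add: P.mem_local_ring P.residue_eq)
qed

lemma ptB_mem: "ptB \<in> curve_points k n" "x \<notin> fst ptB"
proof -
  interpret P: chart_point "inverse x" "inverse x ^ h * y0" h N 0 "0 :: bit alg_closure"
    by (rule chart_pointB)
  have "c \<in> gf2 n" if "(g, c) \<in> P.G" for g c
    using that
    by (auto simp: P.G_def P.im_def ev_0_right gf2_emb)
  then show *: "ptB \<in> curve_points k n"
    unfolding ptB_def Let_def
    using P.fractions_eq B_fracs P.local_ring_is_valuation_ring
    by (intro curve_pointI P.hom_graph_axioms) simp_all
  have "inverse x \<in> P.local_ring" "P.residue (inverse x) = 0"
    using P.G_subset_localised [OF P.T_mem] P.mem_local_ring P.residue_eq by blast+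
  then show "x \<notin> fst ptB"
    using P.residue_eq_0_iff [of "inverse x"] ratfun_x_nonzero unfolding ptB_def Let_def by simp
qed

text \<open>A valuation ring is integrally closed: if \<open>Y\<close> were outside,
  \<open>inverse Y\<close> would lie in \<open>V\<close>, and dividing the equation by
  \<open>Y\<close> gives \<open>Y = s + c * inverse Y\<close>.\<close>

lemma integral_mem:
  assumes pt: "(V, \<phi>) \<in> curve_points k n" and "Y \<in> function_field k"
    and "s \<in> V" "c \<in> V" "Y * Y = s * Y + c"
  shows "Y \<in> V"
proof (rule ccontr)
  note pt = curve_pointsD [OF pt]
  assume *: "Y \<notin> V"
  have "Y \<noteq> 0"
    using * pt(1) pt(2) [of 1 1] by auto
  then have iY: "inverse Y \<in> V"
    using pt(5) assms * by blast
  have "Y = (Y * Y) * inverse Y"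
    using \<open>Y \<noteq> 0\<close> by simp
  also have "\<dots> = s + c * inverse Y"
    using \<open>Y \<noteq> 0\<close> by (simp add: assms(5) algebra_simps)
  finally show False
    using pt(2,3) iY assms(3,4) * by metis
qed

text \<open>On the coordinate ring \<open>\<phi>\<close> is determined by its values at
  \<open>T\<close> and \<open>Y\<close>. So it extends the graph of the chart point, and
  \<open>curve_point_unique\<close> applies.\<close>

lemma chart_point_complete:
  fixes T Y :: ratfun_closure
  assumes pt: "(V, \<phi>) \<in> curve_points k n"
    and P: "chart_point T Y j M a b" and "a = \<phi> T" "b = \<phi> Y" "T \<in> V" "Y \<in> V"
    and fr: "chart.fracs T Y = function_field k"
  shows "(V, \<phi>) = (hom_graph.local_ring (chart_point.G T Y a b),
    hom_graph.residue (chart_point.G T Y a b))"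
proof -
  interpret P: chart_point T Y j M a b
    by (fact P)
  note ptD = curve_pointsD [OF pt]
  have zero: "0 \<in> V" "\<phi> 0 = 0"
    using ptD(1) ptD(2,8) [of 1 1] by auto
  have evV: "ev p T \<in> V \<and> \<phi> (ev p T) = ev p (\<phi> T)" for p
  proof (induction p)
    case (pCons c p)
    have "emb c \<in> V" "\<phi> (emb c) = emb c"
      using zero ptD by (cases c; simp)+
    then show ?case
      using pCons ptD(2,3,8,9) assms by auto
  qed (simp add: zero)
  have ext: "g \<in> V \<and> \<phi> g = c" if gc: "(g, c) \<in> P.G" for g c
  proof -
    obtain u v where "g = P.el u v" "c = P.im u v"
      using gc by (auto simp: P.G_def)
    moreover have "P.im u v = ev u (\<phi> T) + ev v (\<phi> T) * \<phi> Y"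
      by (subst P.im_def) (simp add: assms(3,4))
    ultimately show ?thesis
      using evV ptD(2,3,8,9) assms(5,6) by (auto simp: P.el_def)
  qed
  have "P.fractions = function_field k"
    by (simp add: P.fractions_eq fr)
  then show ?thesis
    using curve_point_unique [OF P.hom_graph_axioms _ _ pt ext] P.local_ring_is_valuation_ring(2)
    by simp
qed

lemma pt_cases_A:
  assumes pt: "(V, \<phi>) \<in> curve_points k n" and x: "x \<in> V"
  shows "(\<phi> x, \<phi> (x * y0)) \<in> Aff \<and> (V, \<phi>) = ptA (\<phi> x) (\<phi> (x * y0))"
proof -
  note ptD = curve_pointsD [OF pt]
  have xp: "x ^ m \<in> V \<and> \<phi> (x ^ m) = \<phi> x ^ m" for m
    by (induction m) (use x ptD in auto)
  have Y: "x * y0 \<in> V"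
    by (rule integral_mem [OF pt, of _ "x ^ 1" "x + x ^ N"])
      (use A.Y_eq xp x ptD gens_mem in \<open>auto simp: add.assoc intro: function_field_closed\<close>)
  have "\<phi> (x * y0 * (x * y0)) = \<phi> (x ^ 1 * (x * y0) + x + x ^ N)"
    using A.Y_eq by simp
  then have "\<phi> (x * y0) * \<phi> (x * y0) = \<phi> x * \<phi> (x * y0) + \<phi> x + \<phi> x ^ N"
    using Y x xp [of N] ptD(2,3,8,9) by (simp del: power_Suc power_add)
  then have aff: "(\<phi> x, \<phi> (x * y0)) \<in> Aff"
    using Y x ptD(10) by (auto simp: Aff_def)
  then show ?thesis
    using chart_point_complete [OF pt chart_pointA [OF aff] refl refl x Y A_fracs]
    by (simp add: ptA_def)
qed

lemma pt_cases_B: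
  assumes pt: "(V, \<phi>) \<in> curve_points k n" and x: "x \<notin> V"
  shows "(V, \<phi>) = ptB"
proof -
  define t where "t = inverse x"
  define Y where "Y = t ^ h * y0"
  note ptD = curve_pointsD [OF pt]
  have t: "t \<in> V"
    using ptD(5) [OF gens_mem(1)] x ratfun_x_nonzero by (simp add: t_def)
  have t0: "\<phi> t = 0"
    using ptD(11) [OF t] x by (simp add: t_def)
  have tp: "t ^ m \<in> V \<and> \<phi> (t ^ m) = \<phi> t ^ m" for m
    by (induction m) (use t ptD in auto)
  have eq: "Y * Y = t ^ h * Y + (t + t ^ N)"
    using B.Y_eq by (simp add: t_def Y_def add.assoc)
  have Y: "Y \<in> V"
    by (rule integral_mem [OF pt _ _ _ eq])
      (use tp t ptD gens_mem in
        \<open>auto simp: t_def Y_def intro: function_field_closed function_field_power\<close>)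
  have "\<phi> (Y * Y) = \<phi> (t ^ h * Y + (t + t ^ N))"
    using eq by simp
  also have "\<dots> = \<phi> t ^ h * \<phi> Y + (\<phi> t + \<phi> t ^ N)"
    using Y t tp [of N] tp [of h] ptD(2,3,8,9) by (simp del: power_Suc power_add)
  also have "\<dots> = 0"
    by (simp add: t0 h_def)
  finally have "\<phi> Y = 0"
    using Y ptD(9) by simp
  then show ?thesis
    using chart_point_complete [OF pt chart_pointB _ _ _ _ B_fracs] t t0 Y
    by (simp add: ptB_def Let_def t_def Y_def)
qed

lemma curve_points_eq: "curve_points k n = case_prod ptA ` Aff \<union> {ptB}"
proof
  show "curve_points k n \<subseteq> case_prod ptA ` Aff \<union> {ptB}"
    using pt_cases_A pt_cases_B by force
  show "case_prod ptA ` Aff \<union> {ptB} \<subseteq> curve_points k n"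
    using ptA_mem ptB_mem by auto
qed

lemma finite_Aff: "finite Aff"
  by (rule finite_subset [of _ "gf2 n \<times> gf2 n"]) (use finite_gf2 [OF n] in \<open>auto simp: Aff_def\<close>)

lemma card_curve_points_Aff: "card (curve_points k n) = card Aff + 1"
proof -
  have "inj_on (case_prod ptA) Aff"
  proof (rule inj_onI, clarify)
    fix a b a' b'
    assume "(a, b) \<in> Aff" "(a', b') \<in> Aff" "ptA a b = ptA a' b'"
    then show "a = a' \<and> b = b'"
      using ptA_mem(3,4) by metis
  qed
  moreover have "ptB \<notin> case_prod ptA ` Aff"
    using ptA_mem(2) ptB_mem(2) by auto
  ultimately show ?thesis
    unfolding curve_points_eq by (simp add: card_image finite_Aff)
qed

end

section \<open>Artin-Schreier fibres and the number of points\<close>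

lemma artin_schreier_frob:
  fixes y :: "bit alg_closure"
  assumes "y\<^sup>2 + y = c"
  shows "y ^ (2 ^ n) = y + gf2_trace n c"
proof (induction n)
  case (Suc n)
  have y2: "y\<^sup>2 = y + c"
    using assms by (metis add_self_left add.commute)
  have "y ^ (2 ^ Suc n) = (y\<^sup>2) ^ (2 ^ n)"
    by (simp add: power_mult)
  also have "\<dots> = y + gf2_trace n c + c ^ (2 ^ n)"
    by (simp add: y2 add_power_two_power Suc)
  finally show ?case
    by (simp add: gf2_trace_def add.assoc)
qed (simp add: gf2_trace_def)

text \<open>Additive Hilbert 90: by \<open>artin_schreier_frob\<close> a root \<open>y\<close> in
  the closure is fixed by the \<open>2 ^ n\<close>-th power map exactly when the trace of
  \<open>c\<close> is 0. The roots are \<open>y\<close> and \<open>y + 1\<close>, so both lie in the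
  field or neither does.\<close>

lemma card_artin_schreier:
  assumes "n \<ge> 1"
  shows "card {y \<in> gf2 n. y\<^sup>2 + y = c} = (if gf2_trace n c = 0 then 2 else 0)"
proof -
  obtain y where y: "y\<^sup>2 + y = c"
    using artin_schreier_root by blast
  have "z \<in> gf2 n \<longleftrightarrow> gf2_trace n c = 0" if "z\<^sup>2 + z = c" for z
    using artin_schreier_frob [OF that, of n] by (simp add: gf2_def)
  then have "{y \<in> gf2 n. y\<^sup>2 + y = c} = (if gf2_trace n c = 0 then {y, y + 1} else {})"
    using artin_schreier_roots [OF y] by auto
  then show ?thesis
    by simp
qed

text \<open>Over \<open>a \<noteq> 0\<close> the substitution \<open>b = a * y\<close> turns the
  chart equation into the Artin-Schreier equation, with 1 plus the trace sign many solutions. To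
  these \<open>2 ^ n - 1\<close> fibres come the single point over \<open>a = 0\<close> and
  \<open>ptB\<close>.\<close>

theorem card_curve_points:
  assumes "k \<ge> 1" "n \<ge> 1"
  shows "int (card (curve_points k n)) = 2 ^ n + 1 + G_sum k n"
proof -
  obtain y0 where y0: "y0\<^sup>2 + y0 = ratfun_x ^ (2 ^ k + 1) + inverse ratfun_x"
    using artin_schreier_root by blast
  interpret curve k n y0
    by standard (use assms y0 in auto)
  define fib where "fib = (\<lambda>a. {b \<in> gf2 n. b * b = a * b + a + a ^ N})"
  have "Aff = Sigma (gf2 n) fib"
    by (auto simp: Aff_def fib_def)
  then have "int (card Aff) = (\<Sum>a\<in>gf2 n. int (card (fib a)))"
    using finite_gf2 [OF n] by (simp add: fib_def)
  also have "\<dots> = int (card (fib 0)) + (\<Sum>a\<in>gf2 n - {0}. int (card (fib a)))"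
    by (intro sum.remove finite_gf2 [OF n]) simp
  also have "fib 0 = {0}"
    by (auto simp: fib_def power_0_left)
  also have "(\<Sum>a\<in>gf2 n - {0}. int (card (fib a))) = (\<Sum>a\<in>gf2 n - {0}.
      1 + (if gf2_trace n (a ^ (2 ^ k + 1) + inverse a) = 0 then 1 else - 1))"
  proof (rule sum.cong)
    fix a
    assume a: "a \<in> gf2 n - {0}"
    let ?c = "a ^ (2 ^ k + 1) + inverse a"
    have *: "(a * y) * (a * y) = a * (a * y) + a + a ^ N \<longleftrightarrow> y\<^sup>2 + y = ?c" for y
    proof -
      have "a + a ^ N = a * a * ?c"
        using a by (simp add: algebra_simps power_add numeral_3_eq_3)
      then have "(a * y) * (a * y) = a * (a * y) + a + a ^ N \<longleftrightarrow> a * a * (y * y) = a * a * (y + ?c)"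
        by (simp only: add.assoc) (simp add: algebra_simps)
      also have "\<dots> \<longleftrightarrow> y\<^sup>2 = y + ?c"
        using a by (simp add: power2_eq_square)
      also have "\<dots> \<longleftrightarrow> y\<^sup>2 + y = ?c"
        by (metis add_self_left add.commute)
      finally show ?thesis .
    qed
    have "fib a = (\<lambda>y. a * y) ` {y \<in> gf2 n. y\<^sup>2 + y = ?c}"
    proof
      show "fib a \<subseteq> (\<lambda>y. a * y) ` {y \<in> gf2 n. y\<^sup>2 + y = ?c}"
      proof
        fix b
        assume b: "b \<in> fib a"
        then have "b = a * (b / a)" "b / a \<in> gf2 n"
          using a by (auto simp: fib_def intro: gf2_divide)
        moreover have "(b / a)\<^sup>2 + b / a = ?c"
          using b a * [of "b / a"] by (simp add: fib_def)
        ultimately show "b \<in> (\<lambda>y. a * y) ` {y \<in> gf2 n. y\<^sup>2 + y = ?c}"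
          by blast
      qed
      show "(\<lambda>y. a * y) ` {y \<in> gf2 n. y\<^sup>2 + y = ?c} \<subseteq> fib a"
        using a * by (auto simp: fib_def intro: gf2_mult)
    qed
    moreover have "inj_on (\<lambda>y. a * y) S" for S
      using a by (auto intro: inj_onI)
    ultimately show "int (card (fib a)) = 1 + (if gf2_trace n ?c = 0 then 1 else - 1)"
      using card_artin_schreier [OF n, of ?c] by (simp add: card_image)
  qed simp
  also have "\<dots> = int (card (gf2 n - {0})) + G_sum k n"
    by (simp add: sum.distrib G_sum_def)
  also have "int (card (gf2 n - {0})) = 2 ^ n - 1"
    by (simp add: card_Diff_singleton card_gf2 [OF n] of_nat_diff)
  finally show ?thesis
    by (simp add: card_curve_points_Aff)
qed

section \<open>A multiplicative character on binary polynomials\<close>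

text \<open>\<open>f' / f\<close> as a power series. For a product of factors \<open>1 + r X\<close>
  in characteristic 2 its coefficient at \<open>m\<close> is the power sum of the
  \<open>r ^ (m + 1)\<close>. The later relation \<open>log_deriv\<close> has an extra factor
  \<open>X\<close>.\<close>

definition logder :: "'a::field poly \<Rightarrow> 'a fps" where
  "logder f = fps_deriv (fps_of_poly f) * inverse (fps_of_poly f)"

lemma logder_mult_self:
  assumes "coeff f 0 \<noteq> 0"
  shows "logder f * fps_of_poly f = fps_deriv (fps_of_poly f)"
  using inverse_mult_eq_1 [of "fps_of_poly f"] assms by (simp add: logder_def mult.assoc)

lemma logder_unique:
  assumes "coeff f 0 \<noteq> 0" "K * fps_of_poly f = fps_deriv (fps_of_poly f)"
  shows "logder f = K"
proof -
  have "(logder f - K) * fps_of_poly f = 0"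
    by (simp only: left_diff_distrib logder_mult_self [OF assms(1)] assms(2) diff_self)
  moreover have "fps_of_poly f \<noteq> 0"
    using assms(1) by auto
  ultimately show ?thesis
    by simp
qed

lemma logder_mult:
  assumes "coeff f 0 \<noteq> 0" "coeff g 0 \<noteq> 0"
  shows "logder (f * g) = logder f + logder g"
proof (rule logder_unique)
  show "coeff (f * g) 0 \<noteq> 0"
    using assms by (simp add: coeff_mult_0)
  have "(logder f + logder g) * fps_of_poly (f * g) =
      (logder f * fps_of_poly f) * fps_of_poly g + (logder g * fps_of_poly g) * fps_of_poly f"
    by (simp add: fps_of_poly_mult algebra_simps)
  also have "\<dots> = fps_deriv (fps_of_poly (f * g))"
    unfolding logder_mult_self [OF assms(1)] logder_mult_self [OF assms(2)]
    by (simp add: fps_of_poly_mult algebra_simps)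
  finally show "(logder f + logder g) * fps_of_poly (f * g) = fps_deriv (fps_of_poly (f * g))" .
qed

text \<open>If \<open>f\<close> is the product of \<open>1 + r X\<close> over the elements \<open>r\<close> of a multiset, then \<open>lam m f\<close> is the sum of
  the values \<open>r ^ (m + 1) + 1 / r\<close> (in characteristic 2).\<close>

definition lam :: "nat \<Rightarrow> 'a::field poly \<Rightarrow> 'a" where
  "lam m f = fps_nth (logder f) m + coeff (reflect_poly f) 1 / lead_coeff f"

lemma coeff_mult_1: "coeff (f * g) (Suc 0) = coeff f 0 * coeff g (Suc 0) + coeff f (Suc 0) * coeff g 0"
  by (simp add: coeff_mult)

lemma lam_mult:
  assumes "coeff f 0 \<noteq> 0" "coeff g 0 \<noteq> 0"
  shows "lam m (f * g) = lam m f + lam m g"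
proof -
  have "lead_coeff f \<noteq> 0" "lead_coeff g \<noteq> 0"
    using assms by auto
  then show ?thesis
    by (simp add: lam_def logder_mult assms reflect_poly_mult coeff_mult_1 lead_coeff_mult
        field_simps)
qed

lemma lam_1 [simp]: "lam m 1 = 0"
  by (simp add: lam_def logder_def)

lemma lam_prod:
  assumes "\<And>i. i \<in> I \<Longrightarrow> coeff (f i) 0 \<noteq> 0"
  shows "lam m (\<Prod>i\<in>I. f i) = (\<Sum>i\<in>I. lam m (f i))"
  using assms
  by (induction I rule: infinite_finite_induct) (auto simp: lam_mult poly_prod simp flip: poly_0_coeff_0)

lemma lam_linear:
  fixes r :: "'a::{field,char2}"
  assumes "r \<noteq> 0"
  shows "lam m [:1, r:] = r ^ (m + 1) + inverse r"
proof -
  have "logder [:1, r:] = Abs_fps (\<lambda>n. r ^ (n + 1))"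
  proof (rule logder_unique)
    have "Abs_fps (\<lambda>n. r ^ (n + 1)) * (1 + fps_const r * fps_X) = fps_const r"
    proof (rule fps_ext)
      fix n
      show "fps_nth (Abs_fps (\<lambda>n. r ^ (n + 1)) * (1 + fps_const r * fps_X)) n = fps_nth (fps_const r) n"
        by (cases n) (simp_all add: distrib_left mult.assoc [symmetric] two_eq_zero)
    qed
    then show "Abs_fps (\<lambda>n. r ^ (n + 1)) * fps_of_poly [:1, r:] = fps_deriv (fps_of_poly [:1, r:])"
      by (simp add: fps_of_poly_linear')
  qed simp
  moreover have "reflect_poly [:1, r:] = [:r, 1:]"
    using assms by (simp add: reflect_poly_def)
  ultimately show ?thesis
    using assms by (simp add: lam_def divide_inverse)
qed

lemma emb_of_nat: "emb (of_nat n) = (of_nat n :: 'a::char2)"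
  by (induction n) simp_all

text \<open>The recursion that determines \<open>logder f\<close> has coefficients in the prime
  field, and the division in \<open>lam\<close> is harmless because a nonzero leading coefficient
  over \<open>bit\<close> is 1.\<close>

lemma lam_lift_poly:
  assumes "coeff f 0 = 1"
  shows "lam m (lift_poly f :: 'a::{field,char2} poly) = emb (lam m f)"
proof -
  have "logder (lift_poly f :: 'a poly) = Abs_fps (\<lambda>n. emb (fps_nth (logder f) n))"
  proof (rule logder_unique)
    have "(\<Sum>i=0..n. emb (fps_nth (logder f) i) * emb (coeff f (n - i))) =
        (of_nat (n + 1) * emb (coeff f (n + 1)) :: 'a)" for n
    proof -
      have "(\<Sum>i=0..n. fps_nth (logder f) i * coeff f (n - i)) = of_nat (n + 1) * coeff f (n + 1)"
        using arg_cong [OF logder_mult_self [of f], of "\<lambda>F. fps_nth F n"] assms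
        by (simp add: fps_mult_nth)
      then have "emb (\<Sum>i=0..n. fps_nth (logder f) i * coeff f (n - i)) =
          (emb (of_nat (n + 1) * coeff f (n + 1)) :: 'a)"
        by (rule arg_cong)
      then show ?thesis
        by (simp only: emb_sum emb_mult emb_of_nat)
    qed
    then show "Abs_fps (\<lambda>n. emb (fps_nth (logder f) n)) * fps_of_poly (lift_poly f) =
        fps_deriv (fps_of_poly (lift_poly f :: 'a poly))"
      by (simp add: fps_eq_iff fps_mult_nth)
  qed (simp add: assms)
  moreover have "lead_coeff f = 1"
    using assms by (cases "lead_coeff f") auto
  moreover have "coeff (reflect_poly (lift_poly f :: 'a poly)) 1 = emb (coeff (reflect_poly f) 1)"
    by (simp add: coeff_reflect_poly)
  ultimately show ?thesis
    by (simp add: lam_def)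
qed

text \<open>Normalised at the constant term, these are the products of factors
  \<open>1 + r X\<close> with nonzero \<open>r\<close>; over \<open>bit\<close> they are monic as
  well.\<close>

definition unit_polys :: "nat \<Rightarrow> bit poly set" where
  "unit_polys d = {f. degree f = d \<and> coeff f 0 = 1}"

definition sgn_bit :: "bit \<Rightarrow> int" where
  "sgn_bit b = (if b = 0 then 1 else - 1)"

lemma sgn_bit_add: "sgn_bit (a + b) = sgn_bit a * sgn_bit b"
  by (cases a; cases b) (simp_all add: sgn_bit_def)

lemma odd_sgn_bit: "odd (sgn_bit a)"
  by (simp add: sgn_bit_def)

text \<open>The index is \<open>2 ^ k\<close> because \<open>lam m\<close> sums
  \<open>r ^ (m + 1) + inverse r\<close>, and \<open>r ^ (2 ^ k + 1) + inverse r\<close> is what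
  \<open>G_sum\<close> takes the trace of.\<close>

definition chi :: "nat \<Rightarrow> bit poly \<Rightarrow> int" where
  "chi k f = sgn_bit (lam (2 ^ k) f)"

definition chi_sum :: "nat \<Rightarrow> nat \<Rightarrow> int" where
  "chi_sum k d = (\<Sum>f\<in>unit_polys d. chi k f)"

lemma finite_unit_polys: "finite (unit_polys d)"
proof (rule finite_subset)
  show "unit_polys d \<subseteq> Poly ` {xs. set xs \<subseteq> UNIV \<and> length xs = d + 1}"
  proof
    fix f
    assume f: "f \<in> unit_polys d"
    then have "f = Poly (coeffs f)" "length (coeffs f) = d + 1"
      by (auto simp: unit_polys_def intro!: length_coeffs_degree)
    then show "f \<in> Poly ` {xs. set xs \<subseteq> UNIV \<and> length xs = d + 1}"
      by (intro image_eqI [of _ _ "coeffs f"]) auto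
  qed
  have "(UNIV :: bit set) = {0, 1}"
    by (auto simp: bit_not_zero_iff)
  then have "finite (UNIV :: bit set)"
    by (metis finite.emptyI finite.insertI)
  then show "finite (Poly ` {xs :: bit list. set xs \<subseteq> UNIV \<and> length xs = d + 1})"
    by (intro finite_imageI finite_lists_length_eq)
qed

lemma chi_mult: "coeff f 0 = 1 \<Longrightarrow> coeff g 0 = 1 \<Longrightarrow> chi k (f * g) = chi k f * chi k g"
  by (simp add: chi_def lam_mult sgn_bit_add)

lemma unit_polys_lead: "f \<in> unit_polys d \<Longrightarrow> lead_coeff f = 1"
  by (cases "lead_coeff f") (auto simp: unit_polys_def)

text \<open>\<open>X ^ (d - 1)\<close> flips the second highest coefficient, the numerator of the
  sum of the \<open>inverse r\<close>. It alters \<open>logder\<close> only from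
  \<open>X ^ (d - 2)\<close> on, which lies beyond position \<open>m\<close> because
  \<open>d \<ge> m + 3\<close>.\<close>

lemma lam_add_monom:
  assumes f: "f \<in> unit_polys d" and d: "d \<ge> m + 3"
  shows "lam m (f + monom 1 (d - 1)) = lam m f + 1"
proof -
  define g where "g = f + monom 1 (d - 1)"
  have deg: "degree f = d" "coeff f 0 = 1"
    using f by (auto simp: unit_polys_def)
  have g: "degree g = d"
    unfolding g_def using d deg
    by (subst degree_add_eq_left) (auto intro: le_less_trans [OF degree_monom_le])
  have g0: "coeff g 0 = 1"
    using d deg by (simp add: g_def)
  have lead: "coeff f d = 1" "coeff g d = 1"
    using unit_polys_lead [OF f] deg d by (auto simp: g_def)
  define F H where "F = fps_of_poly f" and "H = fps_of_poly g"
  have FH: "F + H = fps_X ^ (d - 1)"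
    by (simp add: F_def H_def g_def fps_of_poly_add fps_of_poly_monom' flip: add.assoc)
  have der: "fps_deriv (F + H) = fps_X ^ (d - 2) * of_nat (d - 1)"
    unfolding FH by (simp only: fps_deriv_power fps_deriv_fps_X fps_of_nat diff_diff_left
        one_add_one mult_1_right mult_1_left mult.commute)
  have K: "logder f * F = fps_deriv F" "logder g * H = fps_deriv H"
    unfolding F_def H_def by (rule logder_mult_self; simp add: deg g0)+
  have "(logder f + logder g) * F = logder f * F + logder g * H + logder g * (F + H)"
    by (simp add: algebra_simps)
  also have "\<dots> = fps_deriv (F + H) + logder g * fps_X ^ (d - 1)"
    by (simp only: K fps_deriv_add) (simp only: FH)
  also have "\<dots> = fps_X ^ (d - 2) * (of_nat (d - 1) + logder g * fps_X)"
  proof -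
    have "d - 1 = Suc (d - 2)"
      using d by simp
    then have "logder g * fps_X ^ (d - 1) = fps_X ^ (d - 2) * (logder g * fps_X)"
      by (simp only: power_Suc mult_ac)
    then show ?thesis
      by (simp only: der distrib_left)
  qed
  finally have "(logder f + logder g) * F * inverse F =
      fps_X ^ (d - 2) * ((of_nat (d - 1) + logder g * fps_X) * inverse F)"
    by (simp only: mult.assoc)
  moreover have "F * inverse F = 1"
    using inverse_mult_eq_1' [of F] deg by (simp add: F_def)
  ultimately have "logder f + logder g =
      fps_X ^ (d - 2) * ((of_nat (d - 1) + logder g * fps_X) * inverse F)"
    by (simp add: mult.assoc)
  then have "fps_nth (logder f + logder g) m = 0"
    using d by (simp only: fps_X_power_mult_nth) simp
  then have 1: "fps_nth (logder g) m = fps_nth (logder f) m"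
    by (simp add: add_eq_0_iff_char2)
  have "coeff g (d - 1) = coeff f (d - 1) + 1"
    by (simp add: g_def)
  then have "coeff (reflect_poly g) 1 = coeff (reflect_poly f) 1 + 1"
    using d by (simp add: coeff_reflect_poly g deg)
  then show ?thesis
    unfolding lam_def g_def [symmetric] by (simp add: g deg lead 1 add.assoc)
qed

lemma chi_sum_eq_0:
  assumes "d \<ge> 2 ^ k + 3"
  shows "chi_sum k d = 0"
proof -
  let ?t = "\<lambda>f :: bit poly. f + monom 1 (d - 1)"
  have mem: "?t f \<in> unit_polys d" if "f \<in> unit_polys d" for f
    using that assms
    by (auto simp: unit_polys_def intro!: le_less_trans [OF degree_monom_le] degree_add_eq_left)
  have neg: "chi k (?t f) = - chi k f" if "f \<in> unit_polys d" for f
    using lam_add_monom [OF that, of "2 ^ k"] assms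
    by (simp add: chi_def sgn_bit_add) (simp add: sgn_bit_def)
  have "chi_sum k d = (\<Sum>f\<in>unit_polys d. - chi k f)"
    unfolding chi_sum_def
    by (rule sum.reindex_bij_witness [of _ ?t ?t]) (auto simp: mem neg add.assoc simp del: One_nat_def)
  then show ?thesis
    by (simp add: chi_sum_def sum_negf)
qed

text \<open>Flipping the coefficient of \<open>X\<close> keeps the degree and so pairs up the
  polynomials; the two signs of a pair are odd and have even sum.\<close>

lemma even_chi_sum:
  assumes "d \<ge> 2"
  shows "even (chi_sum k d)"
proof -
  let ?t = "\<lambda>f :: bit poly. f + monom 1 1"
  let ?P = "{f \<in> unit_polys d. coeff f 1 = 0}" and ?Q = "{f \<in> unit_polys d. coeff f 1 = 1}"
  have mem: "?t f \<in> unit_polys d" if "f \<in> unit_polys d" for f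
    using that assms
    by (auto simp: unit_polys_def intro!: le_less_trans [OF degree_monom_le] degree_add_eq_left)
  have "unit_polys d = ?P \<union> ?Q"
    using bit.exhaust by blast
  then have "chi_sum k d = (\<Sum>f\<in>?P \<union> ?Q. chi k f)"
    by (simp only: chi_sum_def)
  also have "\<dots> = (\<Sum>f\<in>?P. chi k f) + (\<Sum>f\<in>?Q. chi k f)"
    by (rule sum.union_disjoint) (auto simp: finite_unit_polys)
  also have "(\<Sum>f\<in>?Q. chi k f) = (\<Sum>f\<in>?P. chi k (?t f))"
    by (rule sum.reindex_bij_witness [of _ ?t ?t]) (auto simp: mem add.assoc simp del: One_nat_def)
  finally have "chi_sum k d = (\<Sum>f\<in>?P. chi k f + chi k (?t f))"
    by (simp add: sum.distrib)
  also have "even \<dots>"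
    by (intro dvd_sum) (simp add: chi_def odd_sgn_bit)
  finally show ?thesis .
qed

lemma unit_polys_0: "unit_polys 0 = {1}"
proof -
  have "f = 1" if "degree f = 0" "coeff f 0 = 1" for f :: "bit poly"
    using that by (auto elim!: degree_eq_zeroE)
  then show ?thesis
    by (auto simp: unit_polys_def)
qed

lemma unit_polys_Suc: "f \<in> unit_polys (Suc d) \<Longrightarrow> coeff f 0 = 1 \<and> coeff f (Suc d) = 1 \<and>
    (\<forall>i > Suc d. coeff f i = 0)"
  using unit_polys_lead [of f "Suc d"] by (auto simp: unit_polys_def coeff_eq_0)

section \<open>The coefficients of \<open>L_1\<close>: enumeration up to degree 4, where
  \<open>2 ^ 1 + 2 = 4\<close>\<close>

lemma unit_polys_1: "unit_polys 1 = {[:1, 1:]}"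
proof -
  have "f = [:1, 1:]" if "f \<in> unit_polys 1" for f
    using unit_polys_Suc [of f 0] that
    by (auto simp: poly_eq_iff coeff_pCons split: nat.splits)
  then show ?thesis
    by (auto simp: unit_polys_def)
qed

lemma bit_mem: "b \<in> {0, 1 :: bit}"
  by (cases b) auto

lemma unit_polys_2: "unit_polys 2 = (\<lambda>a. [:1, a, 1:]) ` {0, 1}"
proof -
  have "f = [:1, coeff f 1, 1:]" if "f \<in> unit_polys 2" for f
    using unit_polys_Suc [of f 1] that
    by (auto simp: poly_eq_iff coeff_pCons numeral_2_eq_2 split: nat.splits)
  note * = this
  have "unit_polys 2 \<subseteq> (\<lambda>a. [:1, a, 1:]) ` {0, 1}"
  proof
    fix f
    assume "f \<in> unit_polys 2"
    then have "f = (\<lambda>a. [:1, a, 1:]) (coeff f 1)"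
      using * by simp
    then show "f \<in> (\<lambda>a. [:1, a, 1:]) ` {0, 1}"
      by (rule image_eqI) (simp only: bit_mem mem_Times_iff fst_conv snd_conv simp_thms)
  qed
  then show ?thesis
    by (auto simp: unit_polys_def)
qed

lemma unit_polys_3: "unit_polys 3 = (\<lambda>(a, b). [:1, a, b, 1:]) ` ({0, 1} \<times> {0, 1})"
proof -
  have "f = [:1, coeff f 1, coeff f 2, 1:]" if "f \<in> unit_polys 3" for f
    using unit_polys_Suc [of f 2] that
    by (auto simp: poly_eq_iff coeff_pCons numeral_2_eq_2 numeral_3_eq_3 split: nat.splits)
  note * = this
  have "unit_polys 3 \<subseteq> (\<lambda>(a, b). [:1, a, b, 1:]) ` ({0, 1} \<times> {0, 1})"
  proof
    fix f
    assume "f \<in> unit_polys 3"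
    then have "f = (\<lambda>(a, b). [:1, a, b, 1:]) ((coeff f 1, coeff f 2))"
      using * by simp
    then show "f \<in> (\<lambda>(a, b). [:1, a, b, 1:]) ` ({0, 1} \<times> {0, 1})"
      by (rule image_eqI) (simp only: bit_mem mem_Times_iff fst_conv snd_conv simp_thms)
  qed
  then show ?thesis
    by (auto simp: unit_polys_def)
qed

lemma unit_polys_4:
  "unit_polys 4 = (\<lambda>(a, b, c). [:1, a, b, c, 1:]) ` ({0, 1} \<times> {0, 1} \<times> {0, 1})"
proof -
  have "f = [:1, coeff f 1, coeff f 2, coeff f 3, 1:]" if "f \<in> unit_polys 4" for f
    using unit_polys_Suc [of f 3] that
    by (auto simp: poly_eq_iff coeff_pCons eval_nat_numeral split: nat.splits)
  note * = this
  have "unit_polys 4 \<subseteq> (\<lambda>(a, b, c). [:1, a, b, c, 1:]) ` ({0, 1} \<times> {0, 1} \<times> {0, 1})"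
  proof
    fix f
    assume "f \<in> unit_polys 4"
    then have "f = (\<lambda>(a, b, c). [:1, a, b, c, 1:]) ((coeff f 1, coeff f 2, coeff f 3))"
      using * by simp
    then show "f \<in> (\<lambda>(a, b, c). [:1, a, b, c, 1:]) ` ({0, 1} \<times> {0, 1} \<times> {0, 1})"
      by (rule image_eqI) (simp only: bit_mem mem_Times_iff fst_conv snd_conv simp_thms)
  qed
  then show ?thesis
    by (auto simp: unit_polys_def)
qed

text \<open>Newton's identities for the third power sum, simplified by \<open>b * b = b\<close>. The
  index 2 is \<open>2 ^ k\<close> for \<open>k = 1\<close>.\<close>

lemma lam_2_eq:
  fixes f :: "bit poly"
  assumes "f \<in> unit_polys d"
  shows "lam 2 f = coeff f 3 + coeff f 1 + coeff f 1 * coeff f 2 + coeff (reflect_poly f) 1"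
proof -
  have f0: "coeff f 0 = 1"
    using assms by (auto simp: unit_polys_def)
  define K where "K = fps_nth (logder f)"
  have K: "(\<Sum>i=0..n. K i * coeff f (n - i)) = of_nat (n + 1) * coeff f (n + 1)" for n
    using arg_cong [OF logder_mult_self [of f], of "\<lambda>F. fps_nth F n"] f0
    by (simp add: fps_mult_nth K_def)
  have sq: "b * b = b" for b :: bit
    by (cases b) auto
  have K0: "K 0 = coeff f 1"
    using K [of 0] f0 by simp
  have "K 0 * coeff f 1 + K 1 = 0"
    using K [of 1] f0 by (simp add: two_eq_zero)
  then have K1: "K 1 = coeff f 1"
    by (simp add: K0 sq add_eq_0_iff_char2)
  have "K 0 * coeff f 2 + K 1 * coeff f 1 + K 2 = coeff f 3"
    using K [of 2] f0 by (simp add: numeral_2_eq_2 numeral_3_eq_3 add.assoc)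
  then have "K 2 = coeff f 3 + (coeff f 1 * coeff f 2 + coeff f 1)"
    unfolding K0 K1 sq by (metis add_self_left add.commute)
  then show ?thesis
    using unit_polys_lead [OF assms] by (simp add: lam_def K_def add_ac)
qed

lemma chi_sum_0 [simp]: "chi_sum k 0 = 1"
  by (simp add: chi_sum_def unit_polys_0 chi_def sgn_bit_def)

lemma odd_chi_sum_1: "odd (chi_sum k (Suc 0))"
  using unit_polys_1 by (simp add: chi_sum_def chi_def odd_sgn_bit)

lemma chi_1: "f \<in> unit_polys d \<Longrightarrow> chi 1 f = sgn_bit (coeff f 3 + coeff f 1 + coeff f 1 * coeff f 2 + coeff (reflect_poly f) 1)"
  by (simp add: chi_def lam_2_eq)

lemma chi_sum_1_values: "chi_sum 1 1 = 1" "chi_sum 1 2 = 0" "chi_sum 1 3 = 2" "chi_sum 1 4 = 4"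
proof -
  have "chi_sum 1 d = (\<Sum>f\<in>unit_polys d. sgn_bit (coeff f 3 + coeff f 1 + coeff f 1 * coeff f 2 + coeff (reflect_poly f) 1))" for d
    unfolding chi_sum_def by (intro sum.cong refl chi_1)
  note * = this
  show "chi_sum 1 1 = 1"
    unfolding * unit_polys_1 by (simp add: coeff_reflect_poly sgn_bit_def eval_nat_numeral)
  show "chi_sum 1 2 = 0"
    unfolding * unit_polys_2 by (subst sum.reindex) (auto intro!: inj_onI simp: coeff_reflect_poly sgn_bit_def eval_nat_numeral)
  show "chi_sum 1 3 = 2"
    unfolding * unit_polys_3 by (subst sum.reindex) (auto intro!: inj_onI simp: coeff_reflect_poly sgn_bit_def eval_nat_numeral
      simp flip: sum.cartesian_product)
  show "chi_sum 1 4 = 4"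
    unfolding * unit_polys_4 by (subst sum.reindex) (auto intro!: inj_onI simp: coeff_reflect_poly sgn_bit_def eval_nat_numeral
      simp flip: sum.cartesian_product)
qed

section \<open>The power sums of the character\<close>

lemma gf2_multiple:
  assumes "x \<in> gf2 e"
  shows "x ^ (2 ^ (e * q + r)) = x ^ (2 ^ r)"
proof (induction q)
  case (Suc q)
  have "x ^ (2 ^ (e * Suc q + r)) = (x ^ (2 ^ e)) ^ (2 ^ (e * q + r))"
    by (simp add: add.assoc power_add flip: power_mult)
  then show ?case
    using assms Suc by (simp add: gf2_def)
qed simp

text \<open>The reversed characteristic polynomial of an \<open>x\<close> in \<open>gf2 n\<close>
  over the prime field. If \<open>x\<close> lies in a smaller field its conjugates recur, and the
  result is a power of the polynomial for that field.\<close>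

definition norm_poly :: "nat \<Rightarrow> 'a::{field,char2} \<Rightarrow> 'a poly" where
  "norm_poly n x = (\<Prod>i<n. [:1, x ^ (2 ^ i):])"

lemma coeff_0_norm_poly [simp]: "coeff (norm_poly n x) 0 = 1"
  by (simp add: norm_poly_def poly_prod flip: poly_0_coeff_0)

lemma degree_norm_poly: "x \<noteq> 0 \<Longrightarrow> degree (norm_poly n x) = n"
  unfolding norm_poly_def by (subst degree_prod_eq_sum_degree) auto

lemma prod_lessThan_add: "(\<Prod>i<m + n. g i) = (\<Prod>i<m. g i) * (\<Prod>i<n. g (m + i))"
  for g :: "nat \<Rightarrow> 'a::comm_monoid_mult"
  by (induction n) (simp_all add: mult.assoc)

lemma norm_poly_mult:
  assumes "x \<in> gf2 e"
  shows "norm_poly (e * j) x = norm_poly e x ^ j"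
proof (induction j)
  case (Suc j)
  have "norm_poly (e * Suc j) x = (\<Prod>i<e * j + e. [:1, x ^ (2 ^ i):])"
    by (simp add: norm_poly_def add.commute)
  also have "\<dots> = norm_poly (e * j) x * (\<Prod>i<e. [:1, x ^ (2 ^ (e * j + i)):])"
    unfolding norm_poly_def by (rule prod_lessThan_add)
  also have "\<dots> = norm_poly (e * j) x * norm_poly e x"
    unfolding gf2_multiple [OF assms] by (simp add: norm_poly_def)
  finally show ?case
    by (simp add: Suc)
qed (simp add: norm_poly_def)

text \<open>Frobenius on the coefficients; its fixed points are the polynomials over the prime
  field.\<close>

definition sq_poly :: "'a::{field,char2} poly \<Rightarrow> 'a poly" where
  "sq_poly p = map_poly (\<lambda>c. c\<^sup>2) p"

lemma coeff_sq_poly [simp]: "coeff (sq_poly p) n = (coeff p n)\<^sup>2"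
  by (simp add: sq_poly_def coeff_map_poly)

lemma sum_square_char2: "(\<Sum>i\<in>A. f i)\<^sup>2 = (\<Sum>i\<in>A. (f i)\<^sup>2 :: 'a::char2)"
  using sum_power_two_power [of f A 1] by simp

lemma sq_poly_mult: "sq_poly (p * q) = sq_poly p * sq_poly q"
  by (simp add: poly_eq_iff coeff_mult sum_square_char2 power_mult_distrib)

lemma sq_poly_1 [simp]: "sq_poly 1 = 1"
  by (auto simp: poly_eq_iff coeff_1 power_0_left)

lemma sq_poly_prod: "sq_poly (prod f A) = (\<Prod>i\<in>A. sq_poly (f i))"
  by (induction A rule: infinite_finite_induct) (simp_all add: sq_poly_mult)

lemma norm_poly_descends:
  assumes "x \<in> gf2 n"
  shows "\<exists>P. lift_poly P = norm_poly n x"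
proof -
  have "sq_poly (norm_poly n x) = (\<Prod>i<n. [:1, x ^ (2 ^ Suc i):])"
  proof -
    have "sq_poly [:1, y:] = [:1, y\<^sup>2:]" for y :: "bit alg_closure"
      by (auto simp: poly_eq_iff coeff_pCons split: nat.splits)
    then show ?thesis
      by (simp add: norm_poly_def sq_poly_prod mult.commute flip: power_mult)
  qed
  \<comment> \<open>Frobenius shifts the factors by one. Multiplying by the missing factor at index
    0 and using \<open>x ^ (2 ^ n) = x\<close> for the surplus factor at index \<open>n\<close>
    shows that the product is unchanged.\<close>
  also have "[:1, x ^ (2 ^ 0):] * \<dots> = (\<Prod>i<Suc n. [:1, x ^ (2 ^ i):])"
    by (rule prod.lessThan_Suc_shift [symmetric])
  then have "(\<Prod>i<n. [:1, x ^ (2 ^ Suc i):]) * [:1, x:] = norm_poly n x * [:1, x ^ (2 ^ n):]"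
    by (simp only: prod.lessThan_Suc norm_poly_def mult.commute power_0 power_one_right)
  then have "(\<Prod>i<n. [:1, x ^ (2 ^ Suc i):]) * [:1, x:] = norm_poly n x * [:1, x:]"
    using assms by (simp only: gf2_def mem_Collect_eq)
  then have "(\<Prod>i<n. [:1, x ^ (2 ^ Suc i):]) = norm_poly n x"
    by (rule mult_right_cancel [THEN iffD1, rotated]) simp
  finally have sq: "sq_poly (norm_poly n x) = norm_poly n x" .
  define P :: "bit poly" where "P = map_poly (\<lambda>c. if c = 0 then 0 else 1) (norm_poly n x)"
  have "coeff (lift_poly P) i = coeff (norm_poly n x) i" for i
  proof -
    have "(coeff (norm_poly n x) i)\<^sup>2 = coeff (norm_poly n x) i"
      using arg_cong [OF sq, of "\<lambda>p. coeff p i"] by simp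
    then obtain b where "coeff (norm_poly n x) i = emb b"
      using square_eq_self_imp_emb by blast
    then show ?thesis
      by (cases b) (simp_all add: P_def coeff_map_poly)
  qed
  then show ?thesis
    using poly_eqI by blast
qed

definition bit_norm :: "nat \<Rightarrow> bit alg_closure \<Rightarrow> bit poly" where
  "bit_norm n x = (SOME P. lift_poly P = norm_poly n x)"

lemma lift_bit_norm: "x \<in> gf2 n \<Longrightarrow> lift_poly (bit_norm n x) = norm_poly n x"
  unfolding bit_norm_def by (rule someI_ex) (rule norm_poly_descends)

lemma bit_norm_mem:
  assumes "x \<in> gf2 n" "x \<noteq> 0"
  shows "bit_norm n x \<in> unit_polys n"
proof -
  have "emb (coeff (bit_norm n x) 0) = (1 :: bit alg_closure)"
    using lift_bit_norm [OF assms(1)] by (metis coeff_lift_poly coeff_0_norm_poly)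
  then have "coeff (bit_norm n x) 0 = 1"
    by (cases "coeff (bit_norm n x) 0") simp_all
  moreover have "degree (bit_norm n x) = n"
    using lift_bit_norm [OF assms(1)] degree_norm_poly [OF assms(2)] by (metis degree_lift_poly)
  ultimately show ?thesis
    by (simp add: unit_polys_def)
qed

text \<open>\<open>lam\<close> is additive over the linear factors, and the factor at
  \<open>i\<close> contributes the \<open>i\<close>-th Frobenius conjugate of
  \<open>x ^ (2 ^ k + 1) + inverse x\<close>; together they form the trace.\<close>

lemma chi_bit_norm:
  assumes "x \<in> gf2 n" "x \<noteq> 0"
  shows "chi k (bit_norm n x) = (if gf2_trace n (x ^ (2 ^ k + 1) + inverse x) = 0 then 1 else - 1)"
proof -
  have "emb (lam (2 ^ k) (bit_norm n x)) = lam (2 ^ k) (norm_poly n x)"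
    using lam_lift_poly [of "bit_norm n x" "2 ^ k", where 'a = "bit alg_closure"]
      bit_norm_mem [OF assms] lift_bit_norm [OF assms(1)]
    by (simp add: unit_polys_def)
  also have "\<dots> = (\<Sum>i<n. lam (2 ^ k) [:1, x ^ (2 ^ i):])"
    unfolding norm_poly_def by (rule lam_prod) simp
  also have "\<dots> = gf2_trace n (x ^ (2 ^ k + 1) + inverse x)"
  proof -
    have "lam (2 ^ k) [:1, x ^ (2 ^ i):] = (x ^ (2 ^ k + 1) + inverse x) ^ (2 ^ i)" for i
      using assms lam_linear [of "x ^ (2 ^ i)" "2 ^ k"]
      by (simp add: add_power_two_power power_inverse power_mult_distrib mult.commute flip: power_mult)
    then show ?thesis
      by (simp add: gf2_trace_def)
  qed
  finally have "gf2_trace n (x ^ (2 ^ k + 1) + inverse x) = 0 \<longleftrightarrow> lam (2 ^ k) (bit_norm n x) = 0"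
    by (metis emb_eq_0_iff)
  then show ?thesis
    by (simp add: chi_def sgn_bit_def)
qed

definition conj_degree :: "bit alg_closure \<Rightarrow> nat" where
  "conj_degree x = (LEAST e. e \<ge> 1 \<and> x \<in> gf2 e)"

text \<open>The definition demands \<open>e \<ge> 1\<close> since \<open>gf2 0\<close> is the whole
  closure. Divisibility comes from division with remainder: a nonzero \<open>n mod e\<close> would
  be a smaller candidate.\<close>

lemma conj_degree:
  assumes "n \<ge> 1" "x \<in> gf2 n"
  shows "conj_degree x \<ge> 1" "x \<in> gf2 (conj_degree x)" "conj_degree x dvd n"
proof -
  define e where "e = conj_degree x"
  have e: "e \<ge> 1 \<and> x \<in> gf2 e"
    unfolding e_def conj_degree_def by (rule LeastI [of _ n]) (use assms in auto)
  then show "conj_degree x \<ge> 1" "x \<in> gf2 (conj_degree x)"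
    by (auto simp: e_def)
  have "x \<in> gf2 (n mod e)"
    using gf2_multiple [of x e "n div e" "n mod e"] e assms by (simp add: gf2_def)
  moreover have "n mod e < e"
    using e by simp
  ultimately have "n mod e = 0"
    using not_less_Least [of "n mod e" "\<lambda>e. e \<ge> 1 \<and> x \<in> gf2 e"]
    unfolding e_def conj_degree_def by (metis One_nat_def Suc_leI gr0I)
  then show "conj_degree x dvd n"
    by (auto simp: e_def)
qed

lemma conjugates_distinct:
  assumes "n \<ge> 1" "x \<in> gf2 n" "i < j" "j < conj_degree x"
  shows "x ^ (2 ^ i) \<noteq> x ^ (2 ^ j)"
proof
  assume *: "x ^ (2 ^ i) = x ^ (2 ^ j)"
  have "x ^ (2 ^ j) = (x ^ (2 ^ (j - i))) ^ (2 ^ i)"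
    using assms by (simp flip: power_mult power_add)
  then have "x \<in> gf2 (j - i)"
    using * power_two_power_eq_iff [of x i] by (simp add: gf2_def)
  then have "conj_degree x dvd j - i"
    using assms by (intro conj_degree) auto
  then show False
    using assms dvd_imp_le [of "conj_degree x" "j - i"] by auto
qed

lemma poly_lift_poly_frob:
  "poly (lift_poly f) (a ^ (2 ^ i)) = poly (lift_poly f) a ^ (2 ^ i)"
  for a :: "'a::{field,char2}"
proof (induction f)
  case (pCons c f)
  have "(emb c :: 'a) = emb c ^ (2 ^ i)"
    by (cases c) simp_all
  then show ?case
    using pCons by (simp add: add_power_two_power power_mult_distrib)
qed simp

lemma linear_dvd_iff:
  fixes y :: "'a::field"
  assumes "y \<noteq> 0"
  shows "[:1, y:] dvd p \<longleftrightarrow> poly p (- inverse y) = 0"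
proof -
  have "[:1, y:] = smult y [:- (- inverse y), 1:]"
    using assms by simp
  then show ?thesis
    using assms by (simp only: smult_dvd_iff poly_eq_0_iff_dvd) auto
qed

text \<open>A binary polynomial that vanishes at \<open>inverse x\<close> vanishes at all its
  conjugates. These are distinct below \<open>conj_degree x\<close>, so the linear factors of the
  norm split off one after the other.\<close>

lemma bit_norm_dvd:
  assumes n: "n \<ge> 1" "x \<in> gf2 n" and x: "x \<noteq> 0"
    and f: "poly (lift_poly f) (inverse x) = 0"
  shows "bit_norm (conj_degree x) x dvd f"
proof -
  have root: "poly (lift_poly f) (inverse (x ^ (2 ^ i))) = 0" for i
    using poly_lift_poly_frob [of f "inverse x" i] f by (simp add: power_inverse)
  have "norm_poly m x dvd lift_poly f" if "m \<le> conj_degree x" for m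
    using that
  proof (induction m)
    case (Suc m)
    then obtain q where q: "lift_poly f = norm_poly m x * q"
      by auto
    have "poly (norm_poly m x) (inverse (x ^ (2 ^ m))) \<noteq> 0"
    proof
      assume "poly (norm_poly m x) (inverse (x ^ (2 ^ m))) = 0"
      then obtain i where i: "i < m" "1 + x ^ (2 ^ i) * inverse (x ^ (2 ^ m)) = 0"
        by (auto simp: norm_poly_def poly_prod mult.commute)
      then have "1 = x ^ (2 ^ i) * inverse (x ^ (2 ^ m))"
        by (simp add: add_eq_0_iff_char2)
      then have "x ^ (2 ^ i) = x ^ (2 ^ m)"
        using x by (simp add: field_simps)
      then show False
        using conjugates_distinct [OF n i(1)] Suc.prems by auto
    qed
    then have "poly q (inverse (x ^ (2 ^ m))) = 0"
      using root [of m] by (auto simp: q)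
    then have "[:1, x ^ (2 ^ m):] dvd q"
      using x by (simp add: linear_dvd_iff uminus_char2)
    then have "norm_poly m x * [:1, x ^ (2 ^ m):] dvd norm_poly m x * q"
      by (intro mult_dvd_mono dvd_refl)
    then show ?case
      by (simp only: q norm_poly_def prod.lessThan_Suc)
  qed (simp add: norm_poly_def)
  then have "lift_poly (bit_norm (conj_degree x) x) dvd (lift_poly f :: bit alg_closure poly)"
    using lift_bit_norm conj_degree [OF n] by simp
  then show ?thesis
    by (simp only: lift_poly_dvd_iff)
qed

lemma order_norm_poly:
  assumes n: "n \<ge> 1" "x \<in> gf2 n" and x: "x \<noteq> 0"
  shows "order (inverse x) (norm_poly (conj_degree x) x) = 1"
proof -
  obtain e where e: "conj_degree x = Suc e"
    using conj_degree(1) [OF n] by (cases "conj_degree x") auto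
  define R where "R = (\<Prod>i<e. [:1, x ^ (2 ^ Suc i):])"
  have split: "norm_poly (conj_degree x) x = [:1, x:] * R"
    unfolding norm_poly_def R_def e by (subst prod.lessThan_Suc_shift) simp
  have "poly R (inverse x) \<noteq> 0"
  proof
    assume "poly R (inverse x) = 0"
    then obtain i where i: "i < e" "1 + x ^ (2 ^ Suc i) * inverse x = 0"
      unfolding R_def by (auto simp: poly_prod mult.commute)
    then have "1 = x ^ (2 ^ Suc i) * inverse x"
      by (simp add: add_eq_0_iff_char2)
    then have "x ^ (2 ^ 0) = x ^ (2 ^ Suc i)"
      using x by (simp add: field_simps)
    then show False
      using conjugates_distinct [OF n, of 0 "Suc i"] i e by auto
  qed
  then have "order (inverse x) R = 0" "R \<noteq> 0"
    by (auto intro: order_0I)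
  moreover have "order (inverse x) [:1, x:] = 1"
  proof -
    have "poly [:1, x:] (inverse x) = 0"
      using x by (simp add: one_plus_one del: one_add_one)
    then have "order (inverse x) [:1, x:] \<noteq> 0"
      by (simp only: order_root pCons_eq_0_iff) simp
    moreover have "order (inverse x) [:1, x:] \<le> 1"
      using order_degree [of "[:1, x:]" "inverse x"] x by simp
    ultimately show ?thesis
      by simp
  qed
  moreover from \<open>R \<noteq> 0\<close> have "[:1, x:] * R \<noteq> 0"
    by (simp only: mult_eq_0_iff pCons_eq_0_iff) simp
  moreover from this have "order (inverse x) ([:1, x:] * R) = order (inverse x) [:1, x:] + order (inverse x) R"
    by (rule order_mult)
  ultimately show ?thesis
    by (simp only: split)
qed

text \<open>\<open>inverse x\<close> is a simple root of the norm, so every factor taken out lowers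
  its multiplicity in \<open>f\<close> by exactly one.\<close>

lemma bit_norm_power_dvd_iff:
  assumes n: "n \<ge> 1" "x \<in> gf2 n" and x: "x \<noteq> 0" and f: "f \<noteq> 0"
  shows "bit_norm (conj_degree x) x ^ j dvd f \<longleftrightarrow> j \<le> order (inverse x) (lift_poly f)"
proof
  let ?P = "bit_norm (conj_degree x) x"
  have lift: "(lift_poly ?P :: bit alg_closure poly) = norm_poly (conj_degree x) x"
    using lift_bit_norm conj_degree [OF n] by simp
  show "j \<le> order (inverse x) (lift_poly f)" if "?P ^ j dvd f"
  proof -
    have "poly (norm_poly (conj_degree x) x) (inverse x) = 0"
      using order_norm_poly [OF n x] by (metis order_root one_neq_zero)
    then have "[:- inverse x, 1:] dvd norm_poly (conj_degree x) x"
      by (simp only: poly_eq_0_iff_dvd)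
    then have "[:- inverse x, 1:] ^ j dvd norm_poly (conj_degree x) x ^ j"
      by (rule dvd_power_same)
    also have "norm_poly (conj_degree x) x ^ j = lift_poly (?P ^ j)"
      by (simp add: lift)
    also have "\<dots> dvd (lift_poly f :: bit alg_closure poly)"
      using \<open>?P ^ j dvd f\<close> by (simp only: lift_poly_dvd_iff)
    finally show ?thesis
      using f by (simp add: order_divides)
  qed
  show "?P ^ j dvd f" if "j \<le> order (inverse x) (lift_poly f)"
    using that f
  proof (induction j arbitrary: f)
    case (Suc j)
    then have "poly (lift_poly f) (inverse x) = 0"
      by (simp add: order_root)
    then obtain g where g: "f = ?P * g"
      using bit_norm_dvd [OF n x] by blast
    have "(lift_poly f :: bit alg_closure poly) = norm_poly (conj_degree x) x * lift_poly g"
      by (simp add: g lift)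
    moreover have "(lift_poly f :: bit alg_closure poly) \<noteq> 0"
      using Suc.prems by simp
    ultimately have "order (inverse x) (lift_poly f) = 1 + order (inverse x) (lift_poly g)"
      using order_norm_poly [OF n x] by (metis order_mult)
    then have "?P ^ j dvd g"
      using Suc g by auto
    then show ?case
      by (simp add: g mult_dvd_mono)
  qed simp
qed

text \<open>The Frobenius orbit of \<open>a\<close> stays inside the finite root set of
  \<open>f\<close>, hence repeats, and injectivity of Frobenius turns the repetition into
  periodicity from the start.\<close>

lemma root_in_gf2:
  fixes a :: "bit alg_closure"
  assumes "f \<noteq> 0" "poly (lift_poly f) a = 0"
  shows "\<exists>n \<ge> 1. a \<in> gf2 n"
proof -
  have "range (\<lambda>i. a ^ (2 ^ i)) \<subseteq> {b. poly (lift_poly f) b = 0}"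
    using assms by (auto simp: poly_lift_poly_frob)
  moreover have "finite {b :: bit alg_closure. poly (lift_poly f) b = 0}"
    using assms by (intro poly_roots_finite) simp
  ultimately have "finite (range (\<lambda>i. a ^ (2 ^ i :: nat)))"
    by (rule finite_subset)
  then have "\<not> inj (\<lambda>i. a ^ (2 ^ i :: nat))"
    using range_inj_infinite by blast
  then obtain i j where ij: "i < j" "a ^ (2 ^ i :: nat) = a ^ (2 ^ j :: nat)"
    unfolding inj_def by (metis linorder_neqE_nat)
  have "a ^ (2 ^ j) = (a ^ (2 ^ (j - i))) ^ (2 ^ i)"
    using ij by (simp flip: power_mult power_add)
  then have "a \<in> gf2 (j - i)"
    using ij power_two_power_eq_iff [of a i] by (simp add: gf2_def)
  then show ?thesis
    using ij by (intro exI [of _ "j - i"]) simp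
qed

text \<open>Double counting. An \<open>x\<close> of degree \<open>e\<close> is counted at
  \<open>n = e * j\<close>, where its norm is the \<open>j\<close>-th power of the minimal one, for
  \<open>j\<close> from 1 to the multiplicity of \<open>inverse x\<close> as a root of
  \<open>f\<close>. These multiplicities add up to the degree.\<close>

lemma card_norm_divisors:
  assumes f: "f \<in> unit_polys d"
  shows "(\<Sum>n=1..d. card {x \<in> gf2 n - {0}. bit_norm n x dvd f}) = d"
proof -
  let ?F = "lift_poly f :: bit alg_closure poly"
  have f0: "f \<noteq> 0" "degree f = d" "coeff f 0 = 1"
    using f by (auto simp: unit_polys_def)
  have F0: "?F \<noteq> 0"
    using f0 by simp
  define Q where "Q = (\<lambda>x. {n \<in> {1..d}. x \<in> gf2 n \<and> bit_norm n x dvd f})"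
  define R where "R = inverse ` {a. poly ?F a = 0}"
  have root_nz: "a \<noteq> 0" if "poly ?F a = 0" for a
    using that f0 by (auto simp: poly_0_coeff_0)
  have finR: "finite R"
    unfolding R_def by (intro finite_imageI poly_roots_finite F0)
  have Q: "card (Q x) = order (inverse x) ?F" and Rmem: "Q x \<noteq> {} \<Longrightarrow> x \<in> R"
    if n: "n \<ge> 1" "x \<in> gf2 n" and x: "x \<noteq> 0" for n x
  proof -
    let ?e = "conj_degree x"
    note e = conj_degree [OF n]
    have "Q x = (\<lambda>j. ?e * j) ` {1..order (inverse x) ?F}"
    proof (intro equalityI subsetI)
      fix m
      assume m: "m \<in> Q x"
      then have "?e dvd m"
        by (intro conj_degree(3)) (auto simp: Q_def)
      then obtain j where j: "m = ?e * j"
        by auto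
      have "lift_poly (bit_norm m x) = (lift_poly (bit_norm ?e x ^ j) :: bit alg_closure poly)"
        using m e by (simp add: Q_def lift_bit_norm j norm_poly_mult)
      then have "bit_norm m x = bit_norm ?e x ^ j"
        by (simp only: lift_poly_eq_iff)
      then have "j \<le> order (inverse x) ?F"
        using m bit_norm_power_dvd_iff [OF n x f0(1)] by (simp add: Q_def)
      moreover have "j \<ge> 1"
        using m j by (cases j) (auto simp: Q_def)
      ultimately show "m \<in> (\<lambda>j. ?e * j) ` {1..order (inverse x) ?F}"
        using j by auto
    next
      fix m
      assume "m \<in> (\<lambda>j. ?e * j) ` {1..order (inverse x) ?F}"
      then obtain j where "m = ?e * j" "j \<in> {1..order (inverse x) ?F}"
        by (rule imageE)
      then have j: "m = ?e * j" "1 \<le> j" "j \<le> order (inverse x) ?F"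
        by simp_all
      have xm: "x \<in> gf2 m"
        using gf2_multiple [OF e(2), of j 0] by (simp add: j gf2_def)
      have "lift_poly (bit_norm m x) = (lift_poly (bit_norm ?e x ^ j) :: bit alg_closure poly)"
        using xm e by (simp add: lift_bit_norm j norm_poly_mult)
      then have "bit_norm m x = bit_norm ?e x ^ j"
        by (simp only: lift_poly_eq_iff)
      then have dvd: "bit_norm m x dvd f"
        using j bit_norm_power_dvd_iff [OF n x f0(1)] by simp
      then have "degree (bit_norm m x) \<le> d"
        using f0 dvd_imp_degree_le by blast
      then have "m \<le> d"
        using bit_norm_mem [OF xm x] by (simp add: unit_polys_def)
      moreover have "m \<ge> 1"
        using e(1) j by (cases m) auto
      ultimately show "m \<in> Q x"
        using dvd xm by (simp add: Q_def)
    qed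
    moreover have "inj_on (\<lambda>j. ?e * j) A" for A
      using e(1) by (auto intro: inj_onI)
    ultimately show *: "card (Q x) = order (inverse x) ?F"
      by (simp add: card_image)
    show "x \<in> R" if "Q x \<noteq> {}"
    proof -
      have "finite (Q x)"
        by (simp add: Q_def)
      then have "order (inverse x) ?F \<noteq> 0"
        using that * by auto
      then have "poly ?F (inverse x) = 0"
        using order_root F0 by blast
      then show ?thesis
        unfolding R_def by (intro image_eqI [of _ _ "inverse x"]) auto
    qed
  qed
  have R_gf2: "x \<noteq> 0 \<and> (\<exists>n\<ge>1. x \<in> gf2 n)" if xR: "x \<in> R" for x
  proof -
    obtain a where a: "x = inverse a" "poly ?F a = 0"
      using xR by (auto simp: R_def)
    then show ?thesis
      using root_in_gf2 [OF f0(1) a(2)] root_nz [OF a(2)] gf2_inverse by auto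
  qed
  have "(\<Sum>n=1..d. card {x \<in> gf2 n - {0}. bit_norm n x dvd f}) =
      card (Sigma {1..d} (\<lambda>n. {x \<in> gf2 n - {0}. bit_norm n x dvd f}))"
    by (subst card_SigmaI) (auto simp: finite_gf2)
  also have "\<dots> = card (Sigma R Q)"
  proof (rule bij_betw_same_card [of prod.swap], rule bij_betw_imageI)
    show "inj_on prod.swap (Sigma {1..d} (\<lambda>n. {x \<in> gf2 n - {0}. bit_norm n x dvd f}))"
      by simp
    show "prod.swap ` (Sigma {1..d} (\<lambda>n. {x \<in> gf2 n - {0}. bit_norm n x dvd f})) = Sigma R Q"
    proof (intro equalityI subsetI)
      fix z
      assume "z \<in> prod.swap ` (Sigma {1..d} (\<lambda>n. {x \<in> gf2 n - {0}. bit_norm n x dvd f}))"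
      then obtain n x where nx: "z = (x, n)" "n \<in> {1..d}" "x \<in> gf2 n" "x \<noteq> 0" "bit_norm n x dvd f"
        by auto
      then have "n \<in> Q x"
        by (simp add: Q_def)
      moreover from this have "x \<in> R"
        using Rmem [of n x] nx by auto
      ultimately show "z \<in> Sigma R Q"
        using nx by simp
    next
      fix z
      assume "z \<in> Sigma R Q"
      then obtain x n where "z = (x, n)" "x \<in> R" "n \<in> Q x"
        by auto
      then show "z \<in> prod.swap ` (Sigma {1..d} (\<lambda>n. {x \<in> gf2 n - {0}. bit_norm n x dvd f}))"
        using R_gf2 [of x] by (intro image_eqI [of _ _ "(n, x)"]) (auto simp: Q_def)
    qed
  qed
  also have "\<dots> = (\<Sum>x\<in>R. card (Q x))"
    by (rule card_SigmaI) (auto simp: finR Q_def)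
  also have "\<dots> = (\<Sum>x\<in>R. order (inverse x) ?F)"
    using Q R_gf2 by (intro sum.cong refl) blast
  also have "\<dots> = (\<Sum>a\<in>{a. poly ?F a = 0}. order a ?F)"
    unfolding R_def by (subst sum.reindex) (auto simp: inj_on_def)
  also have "\<dots> = size (proots ?F)"
    using F0 by (simp add: size_multiset_overloaded_eq)
  also have "\<dots> = d"
    by (simp add: alg_closed_size_proots f0)
  finally show ?thesis .
qed

text \<open>Logarithmic derivative of the Euler product, without infinite products:
  \<open>card_norm_divisors\<close> replaces the factor \<open>d\<close> by pairs
  \<open>(n, x)\<close>. After swapping the sums, \<open>f\<close> is the norm of \<open>x\<close>
  times a polynomial of degree \<open>d - n\<close>, and \<open>chi\<close> is
  multiplicative.\<close>

theorem chi_sum_recurrence: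
  "int d * chi_sum k d = (\<Sum>n=1..d. G_sum k n * chi_sum k (d - n))"
proof -
  have "int d * chi_sum k d = (\<Sum>f\<in>unit_polys d. chi k f *
      int (\<Sum>n=1..d. card {x \<in> gf2 n - {0}. bit_norm n x dvd f}))"
    unfolding chi_sum_def sum_distrib_left
    by (intro sum.cong refl) (simp only: card_norm_divisors mult.commute)
  also have "\<dots> = (\<Sum>f\<in>unit_polys d. \<Sum>n=1..d. \<Sum>x\<in>gf2 n - {0}.
      if bit_norm n x dvd f then chi k f else 0)"
  proof (rule sum.cong)
    fix f
    have "(\<Sum>x\<in>gf2 n - {0}. if bit_norm n x dvd f then chi k f else 0) =
        chi k f * int (card {x \<in> gf2 n - {0}. bit_norm n x dvd f})" if "n \<in> {1..d}" for n
      using that finite_gf2 [of n] by (simp flip: sum.inter_filter)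
    then show "chi k f * int (\<Sum>n=1..d. card {x \<in> gf2 n - {0}. bit_norm n x dvd f}) =
        (\<Sum>n=1..d. \<Sum>x\<in>gf2 n - {0}. if bit_norm n x dvd f then chi k f else 0)"
      by (simp add: sum_distrib_left)
  qed simp
  also have "\<dots> = (\<Sum>n=1..d. \<Sum>x\<in>gf2 n - {0}. \<Sum>f\<in>unit_polys d.
      if bit_norm n x dvd f then chi k f else 0)"
    by (subst sum.swap, rule sum.cong [OF refl], rule sum.swap)
  also have "\<dots> = (\<Sum>n=1..d. \<Sum>x\<in>gf2 n - {0}. chi k (bit_norm n x) * chi_sum k (d - n))"
  proof (intro sum.cong refl)
    fix n x
    assume n: "n \<in> {1..d}" and x: "x \<in> gf2 n - {0}"
    let ?P = "bit_norm n x"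
    have P: "?P \<in> unit_polys n"
      using x by (intro bit_norm_mem) auto
    then have P': "degree ?P = n" "coeff ?P 0 = 1" "?P \<noteq> 0"
      by (auto simp: unit_polys_def)
    have "{f \<in> unit_polys d. ?P dvd f} = (\<lambda>g. ?P * g) ` unit_polys (d - n)"
    proof (intro equalityI subsetI)
      fix f
      assume f: "f \<in> {f \<in> unit_polys d. ?P dvd f}"
      then obtain g where g: "f = ?P * g"
        by auto
      have "g \<noteq> 0"
        using f g by (auto simp: unit_polys_def)
      then have "degree g = d - n" "coeff g 0 = 1"
        using f P' by (auto simp: g unit_polys_def degree_mult_eq coeff_mult_0)
      then show "f \<in> (\<lambda>g. ?P * g) ` unit_polys (d - n)"
        using g by (auto simp: unit_polys_def)
    next
      fix f
      assume "f \<in> (\<lambda>g. ?P * g) ` unit_polys (d - n)"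
      then obtain g where g: "f = ?P * g" "g \<in> unit_polys (d - n)"
        by auto
      then have "g \<noteq> 0"
        by (auto simp: unit_polys_def)
      then show "f \<in> {f \<in> unit_polys d. ?P dvd f}"
        using g n P' by (auto simp: unit_polys_def degree_mult_eq coeff_mult_0)
    qed
    moreover have "inj_on (\<lambda>g. ?P * g) A" for A
      using P' by (auto intro: inj_onI)
    moreover have "chi k (?P * g) = chi k ?P * chi k g" if "g \<in> unit_polys (d - n)" for g
      using that P' by (intro chi_mult) (auto simp: unit_polys_def)
    ultimately have "(\<Sum>f | f \<in> unit_polys d \<and> ?P dvd f. chi k f) = chi k ?P * chi_sum k (d - n)"
      by (simp add: sum.reindex chi_sum_def sum_distrib_left)
    then show "(\<Sum>f\<in>unit_polys d. if ?P dvd f then chi k f else 0) = chi k ?P * chi_sum k (d - n)"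
      by (simp add: sum.inter_filter finite_unit_polys)
  qed
  also have "\<dots> = (\<Sum>n=1..d. G_sum k n * chi_sum k (d - n))"
  proof (intro sum.cong refl)
    fix n
    have "G_sum k n = (\<Sum>x\<in>gf2 n - {0}. chi k (bit_norm n x))"
      unfolding G_sum_def by (intro sum.cong refl) (simp add: chi_bit_norm)
    then show "(\<Sum>x\<in>gf2 n - {0}. chi k (bit_norm n x) * chi_sum k (d - n)) =
        G_sum k n * chi_sum k (d - n)"
      by (simp add: sum_distrib_right)
  qed
  finally show ?thesis .
qed

section \<open>Integrality and rotation-invariant factors\<close>

lemma coeff_pcompose_monom:
  fixes q :: "'a::comm_ring_1 poly"
  assumes "p > 0"
  shows "coeff (pcompose q (monom 1 p)) n = (if p dvd n then coeff q (n div p) else 0)"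
proof (induction q arbitrary: n)
  case (pCons a q)
  have *: "coeff (pcompose (pCons a q) (monom 1 p)) n =
      (if n = 0 then a else 0) + (if n < p then 0 else coeff (pcompose q (monom 1 p)) (n - p))"
    by (auto simp: pcompose_pCons coeff_monom_mult coeff_pCons split: nat.splits)
  show ?case
  proof (cases "n < p")
    case True
    then show ?thesis
      using assms unfolding * by (auto simp: coeff_pCons dvd_imp_le dest: nat_dvd_not_less)
  next
    case False
    then obtain m where m: "n = p + m"
      using le_Suc_ex linorder_not_less by blast
    then show ?thesis
      unfolding * using assms by (simp add: pCons.IH)
  qed
qed simp

text \<open>The polynomials \<open>f_j\<close> in the decomposition of \<open>f\<close> as the sum
  of the \<open>X ^ j * f_j (X ^ p)\<close>.\<close>

definition poly_section :: "nat \<Rightarrow> nat \<Rightarrow> 'a::comm_monoid_add poly \<Rightarrow> 'a poly" where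
  "poly_section p j f = (\<Sum>i\<le>degree f. monom (coeff f (p * i + j)) i)"

lemma coeff_poly_section:
  assumes "p > 0"
  shows "coeff (poly_section p j f) i = coeff f (p * i + j)"
proof (cases "i \<le> degree f")
  case True
  then show ?thesis
    by (simp add: poly_section_def coeff_sum)
next
  case False
  have "i \<le> p * i + j"
    using assms by (simp add: trans_le_add1)
  then show ?thesis
    using False by (simp add: poly_section_def coeff_sum coeff_eq_0)
qed

lemma poly_in_power:
  fixes f :: "'a::comm_ring_1 poly"
  assumes "p > 0" "\<And>n. \<not> p dvd n \<Longrightarrow> coeff f n = 0"
  shows "f = pcompose (poly_section p 0 f) (monom 1 p)"
  using assms by (auto simp: poly_eq_iff coeff_pcompose_monom coeff_poly_section)

lemma coeff_monom_times_pcompose: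
  fixes q :: "'a::comm_ring_1 poly"
  assumes "j < p"
  shows "coeff (monom 1 j * pcompose q (monom 1 p)) n =
    (if n mod p = j then coeff q (n div p) else 0)"
proof -
  have "p dvd n - j \<and> j \<le> n \<longleftrightarrow> n mod p = j"
    using assms
    by (metis dvd_minus_mod mod_eq_dvd_iff_nat mod_less mod_less_eq_dividend)
  moreover have "(n - j) div p = n div p" if "n mod p = j"
    using that by (metis assms div_mult_self_is_m gr_implies_not0 gr0I minus_mod_eq_mult_div
        mult.commute)
  ultimately show ?thesis
    using assms by (auto simp: coeff_monom_mult coeff_pcompose_monom)
qed

lemma sum_poly_sections:
  fixes f :: "'a::comm_ring_1 poly"
  assumes "p > 0"
  shows "(\<Sum>j<p. monom 1 j * pcompose (poly_section p j f) (monom 1 p)) = f"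
proof (rule poly_eqI)
  fix n
  have "coeff (\<Sum>j<p. monom 1 j * pcompose (poly_section p j f) (monom 1 p)) n =
      (\<Sum>j<p. if n mod p = j then coeff f (p * (n div p) + j) else 0)"
    by (simp add: coeff_sum coeff_monom_times_pcompose coeff_poly_section assms cong: if_cong)
  also have "\<dots> = coeff f n"
    using assms by simp
  finally show "coeff (\<Sum>j<p. monom 1 j * pcompose (poly_section p j f) (monom 1 p)) n = coeff f n" .
qed

lemma poly_section_sum:
  fixes q :: "nat \<Rightarrow> 'a::comm_ring_1 poly"
  assumes "j < p"
  shows "poly_section p j (\<Sum>j<p. monom 1 j * pcompose (q j) (monom 1 p)) = q j"
proof (rule poly_eqI)
  fix i
  have p: "p > 0"
    using assms by simp
  have "coeff (\<Sum>j<p. monom 1 j * pcompose (q j) (monom 1 p)) (p * i + j) =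
      (\<Sum>l<p. if (p * i + j) mod p = l then coeff (q l) ((p * i + j) div p) else 0)"
    by (simp add: coeff_sum coeff_monom_times_pcompose cong: if_cong)
  also have "\<dots> = coeff (q j) i"
    using assms by simp
  finally show "coeff (poly_section p j (\<Sum>j<p. monom 1 j * pcompose (q j) (monom 1 p))) i = coeff (q j) i"
    by (simp only: coeff_poly_section [OF p])
qed

text \<open>The combination is the gcd up to a unit. Its cofactors are what matters later: they show
  that the quotients by the gcd generate the unit ideal.\<close>

lemma bezout_finite:
  fixes f :: "'i \<Rightarrow> rat poly"
  assumes "finite I"
  shows "\<exists>a. \<forall>i\<in>I. (\<Sum>j\<in>I. a j * f j) dvd f i"
  using assms
proof (induction I rule: finite_induct)
  case (insert i I)
  then obtain a where a: "\<forall>j\<in>I. (\<Sum>j\<in>I. a j * f j) dvd f j"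
    by blast
  define h where "h = (\<Sum>j\<in>I. a j * f j)"
  obtain r s where rs: "r * h + s * f i = gcd h (f i)"
    using bezout_coefficients_fst_snd by blast
  define b where "b = (\<lambda>j. if j = i then s else r * a j)"
  have "(\<Sum>j\<in>insert i I. b j * f j) = s * f i + (\<Sum>j\<in>I. b j * f j)"
    using insert by (simp add: b_def)
  also have "(\<Sum>j\<in>I. b j * f j) = r * h"
    unfolding h_def sum_distrib_left using insert by (intro sum.cong) (auto simp: b_def mult.assoc)
  finally have "(\<Sum>j\<in>insert i I. b j * f j) = gcd h (f i)"
    using rs by (simp add: add.commute)
  moreover have "gcd h (f i) dvd f j" if "j \<in> insert i I" for j
    using that a by (auto simp: h_def intro: dvd_trans [OF gcd_dvd1])
  ultimately show ?case
    by (intro exI [of _ b]) simp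
qed simp

lemma map_poly_hom_add:
  assumes "\<And>x y. \<phi> (x + y) = \<phi> x + \<phi> y" "\<phi> 0 = 0"
  shows "map_poly \<phi> (p + q) = map_poly \<phi> p + map_poly \<phi> q"
  using assms by (simp add: poly_eq_iff coeff_map_poly)

lemma map_poly_hom_mult:
  assumes "\<And>x y. \<phi> (x + y) = \<phi> x + \<phi> y" "\<And>x y. \<phi> (x * y) = \<phi> x * \<phi> y" "\<phi> 0 = 0"
  shows "map_poly \<phi> (p * q) = map_poly \<phi> p * map_poly \<phi> q"
proof -
  have "\<phi> (sum f A) = (\<Sum>i\<in>A. \<phi> (f i))" for f :: "nat \<Rightarrow> _" and A
    using assms by (induction A rule: infinite_finite_induct) auto
  then show ?thesis
    using assms by (simp add: poly_eq_iff coeff_map_poly coeff_mult)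
qed

section \<open>Gauss's lemma for factors with constant term 1\<close>

definition rat_poly :: "int poly \<Rightarrow> rat poly" where
  "rat_poly = map_poly of_int"

lemma coeff_rat_poly [simp]: "coeff (rat_poly p) n = of_int (coeff p n)"
  by (simp add: rat_poly_def coeff_map_poly)

lemma rat_poly_add: "rat_poly (p + q) = rat_poly p + rat_poly q"
  unfolding rat_poly_def by (rule map_poly_hom_add) simp_all

lemma rat_poly_mult: "rat_poly (p * q) = rat_poly p * rat_poly q"
  unfolding rat_poly_def by (rule map_poly_hom_mult) simp_all

lemma rat_poly_smult: "rat_poly (smult c p) = smult (of_int c) (rat_poly p)"
  by (simp add: poly_eq_iff)

lemma rat_poly_eq_iff [simp]: "rat_poly p = rat_poly q \<longleftrightarrow> p = q"
  by (simp add: poly_eq_iff)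

lemma rat_poly_1 [simp]: "rat_poly 1 = 1"
  by (simp add: rat_poly_def)

lemma common_denominator:
  fixes p :: "rat poly"
  shows "\<exists>D q. D > 0 \<and> smult (of_int D) p = rat_poly q"
proof (induction p)
  case 0
  then show ?case
    by (intro exI [of _ 1] exI [of _ 0]) (simp add: poly_eq_iff)
next
  case (pCons a p)
  then obtain D q where Dq: "D > 0" "smult (of_int D) p = rat_poly q"
    by blast
  obtain n d where nd: "a = of_int n / of_int d" "d > 0"
    by (metis Rat_cases Fract_of_int_quotient)
  have "smult (of_int (D * d)) (pCons a p) = rat_poly (pCons (D * n) (smult d q))"
  proof -
    have "smult (of_int (D * d)) p = smult (of_int d) (rat_poly q)"
      by (simp add: Dq(2) [symmetric] mult.commute)
    moreover have "of_int (D * d) * a = (of_int (D * n) :: rat)"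
      using nd by simp
    ultimately show ?thesis
      by (simp add: rat_poly_def map_poly_pCons rat_poly_smult [unfolded rat_poly_def])
  qed
  then show ?case
    using Dq nd by (metis mult_pos_pos)
qed

text \<open>After clearing denominators the contents divide the constant coefficients
  \<open>D\<close> and \<open>E\<close>, and their product is \<open>D * E\<close> because
  \<open>f\<close> has content 1. So both bounds are attained and \<open>D\<close> can be divided
  out again.\<close>

lemma gauss_constant_1:
  fixes g h :: "rat poly"
  assumes gh: "g * h = rat_poly f" and g: "coeff g 0 = 1" and h: "coeff h 0 = 1"
  shows "\<exists>g'. g = rat_poly g'"
proof -
  obtain D g1 where D: "D > 0" "smult (of_int D) g = rat_poly g1"
    using common_denominator by blast
  obtain E h1 where E: "E > 0" "smult (of_int E) h = rat_poly h1"
    using common_denominator by blast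
  have f0: "coeff f 0 = 1"
    using arg_cong [OF gh, of "\<lambda>p. coeff p 0"] g h by (simp add: coeff_mult_0)
  have g10: "coeff g1 0 = D"
    using arg_cong [OF D(2), of "\<lambda>p. coeff p 0"] g by simp
  have h10: "coeff h1 0 = E"
    using arg_cong [OF E(2), of "\<lambda>p. coeff p 0"] h by simp
  have "rat_poly (g1 * h1) = rat_poly (smult (D * E) f)"
    by (simp add: rat_poly_mult rat_poly_smult D(2) [symmetric] E(2) [symmetric] gh [symmetric]
        mult.commute)
  then have "content g1 * content h1 = content (smult (D * E) f)"
    by (simp only: rat_poly_eq_iff content_mult [symmetric])
  moreover have "content f = 1"
    using content_dvd_coeff [of f 0] f0 by (metis is_unit_content_iff)
  ultimately have c: "content g1 * content h1 = D * E"
    using D E by simp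
  have "content g1 dvd D" "content h1 dvd E"
    using content_dvd_coeff [of g1 0] content_dvd_coeff [of h1 0] g10 h10 by auto
  then have le: "content g1 \<le> D" "content h1 \<le> E"
    using D E by (auto dest: zdvd_imp_le)
  have "content g1 > 0" "content h1 > 0"
    using c D E normalize_content [of g1] normalize_content [of h1]
    by (metis abs_ge_zero mult_eq_0_iff normalize_int_def not_less order_antisym_conv
        less_irrefl mult_pos_pos)+
  have "content g1 = D"
  proof (rule ccontr)
    assume "content g1 \<noteq> D"
    then have "content g1 * content h1 < D * E"
      using le \<open>content g1 > 0\<close> \<open>content h1 > 0\<close> D by (intro mult_less_le_imp_less) auto
    then show False
      using c by simp
  qed
  then obtain g' where "g1 = smult D g'"
    using content_times_primitive_part [of g1] by metis
  then have "smult (of_int D) g = smult (of_int D) (rat_poly g')"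
    by (simp add: D(2) rat_poly_smult)
  then have "g = rat_poly g'"
    using D(1) by (metis of_int_eq_0_iff less_irrefl smult_cancel)
  then show ?thesis
    by blast
qed

section \<open>Rotations of polynomials by complex roots of unity\<close>

definition cpoly :: "rat poly \<Rightarrow> complex poly" where
  "cpoly = map_poly of_rat"

lemma coeff_cpoly [simp]: "coeff (cpoly p) n = of_rat (coeff p n)"
  by (simp add: cpoly_def coeff_map_poly)

lemma cpoly_mult: "cpoly (p * q) = cpoly p * cpoly q"
  unfolding cpoly_def by (rule map_poly_hom_mult) (simp_all add: of_rat_add of_rat_mult)

definition scale_poly :: "complex \<Rightarrow> complex poly \<Rightarrow> complex poly" where
  "scale_poly z f = pcompose f [:0, z:]"

lemma coeff_scale_poly [simp]: "coeff (scale_poly z f) n = z ^ n * coeff f n"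
  by (simp add: scale_poly_def coeff_pcompose_linear)

lemma scale_poly_mult: "scale_poly z (f * g) = scale_poly z f * scale_poly z g"
  by (simp add: scale_poly_def pcompose_mult)

lemma exists_primitive_root:
  assumes "p > 0"
  shows "\<exists>z :: complex. \<forall>n. z ^ n = 1 \<longleftrightarrow> p dvd n"
proof -
  define z where "z = cis (2 * pi / p)"
  have "z ^ n = 1 \<longleftrightarrow> p dvd n" for n
  proof
    assume "z ^ n = 1"
    then have "cos (n * (2 * pi / p)) = 1"
      by (simp add: z_def DeMoivre complex_eq_iff)
    then obtain m :: int where "n * (2 * pi / p) = m * 2 * pi"
      by (auto simp: cos_one_2pi_int)
    then have "real n = m * real p"
      using assms by (simp add: field_simps)
    then have "int n = m * int p"
      by (metis of_int_eq_iff of_int_mult of_int_of_nat_eq)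
    then show "p dvd n"
      by (metis dvd_triv_right int_dvd_int_iff)
  next
    assume "p dvd n"
    then obtain m where "n = p * m"
      by auto
    moreover have "z ^ p = 1"
      using assms by (simp add: z_def DeMoivre)
    ultimately show "z ^ n = 1"
      by (simp add: power_mult)
  qed
  then show ?thesis
    by blast
qed

text \<open>\<open>P\<close> is prime to \<open>X\<close> because its constant coefficient is
  nonzero.\<close>

lemma dvd_of_dvd_mult_monom:
  fixes P Q :: "'a::field poly"
  assumes "coeff P 0 \<noteq> 0" "P dvd Q * monom 1 m"
  shows "P dvd Q"
  using assms(2)
proof (induction m)
  case (Suc m)
  then obtain S where S: "Q * monom 1 (Suc m) = P * S"
    by auto
  have "coeff P 0 * coeff S 0 = 0"
    using arg_cong [OF S, of "\<lambda>p. coeff p 0"] by (simp add: coeff_mult_0)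
  then have "coeff S 0 = 0"
    using assms(1) by simp
  then obtain S' where S': "S = pCons 0 S'"
    by (cases S) auto
  have "pCons 0 (Q * monom 1 m) = pCons 0 (P * S')"
    using S by (simp add: S' monom_Suc)
  then show ?case
    using Suc.IH by simp
qed simp

text \<open>If \<open>z = \<omega> ^ n\<close> has \<open>z ^ p = 1\<close> then the sum of the powers of \<open>z\<close> is \<open>p\<close> or \<open>0\<close>; hence averaging
  the rotations of a polynomial extracts the part with exponents in one residue class.\<close>

lemma average_scale_poly:
  assumes "p > 0" and w: "\<And>n. w ^ n = 1 \<longleftrightarrow> p dvd n" and "j < p"
  shows "(\<Sum>i<p. smult (w ^ (i * (p - j))) (scale_poly (w ^ i) f)) =
    smult (of_nat p) (monom 1 j * pcompose (poly_section p j f) (monom 1 p))"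
proof (rule poly_eqI)
  fix n
  have "coeff (\<Sum>i<p. smult (w ^ (i * (p - j))) (scale_poly (w ^ i) f)) n =
      (\<Sum>i<p. (w ^ (n + (p - j))) ^ i) * coeff f n"
    by (simp add: coeff_sum sum_distrib_right mult_ac flip: power_mult power_add)
      (simp add: algebra_simps sum_distrib_left flip: power_mult power_add)
  also have "(\<Sum>i<p. (w ^ (n + (p - j))) ^ i) = (if n mod p = j then of_nat p else 0)"
  proof -
    have iff: "p dvd n + (p - j) \<longleftrightarrow> n mod p = j"
    proof -
      have "p dvd n + (p - j) \<longleftrightarrow> [n + (p - j) = j + (p - j)] (mod p)"
        using assms by (simp add: cong_0_iff cong_def mod_eq_0_iff_dvd)
      also have "\<dots> \<longleftrightarrow> [n = j] (mod p)"
        by (rule cong_add_rcancel_nat)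
      finally show ?thesis
        using assms by (simp add: cong_def)
    qed
    show ?thesis
    proof (cases "n mod p = j")
      case True
      then have "w ^ (n + (p - j)) = 1"
        using w iff by blast
      then show ?thesis
        using True by simp
    next
      case False
      then have "w ^ (n + (p - j)) \<noteq> 1"
        using w iff by blast
      moreover have "(w ^ (n + (p - j))) ^ p = 1"
        using w by (simp flip: power_mult)
      ultimately show ?thesis
        using False by (simp add: geometric_sum)
    qed
  qed
  finally show "coeff (\<Sum>i<p. smult (w ^ (i * (p - j))) (scale_poly (w ^ i) f)) n =
      coeff (smult (of_nat p) (monom 1 j * pcompose (poly_section p j f) (monom 1 p))) n"
    using assms by (auto simp: coeff_monom_times_pcompose coeff_poly_section)
qed

text \<open>The divisor \<open>\<mu>\<close> of such an \<open>M\<close> satisfies \<open>\<mu>(x) - \<mu>(\<zeta> x) - \<mu>(\<xi> x) + \<mu>(\<zeta> \<xi> x) = 0\<close> and is therefore a sum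
  of a \<open>\<zeta>\<close>-invariant and a \<open>\<xi>\<close>-invariant one. Taking for the first one the largest \<open>\<zeta>\<close>-invariant divisor
  below \<open>\<mu>\<close>, that is the gcd of the sections of \<open>M\<close>, keeps both effective and rational.\<close>

lemma split_bi_invariant:
  fixes M :: "int poly"
  assumes M0: "coeff M 0 = 1" and p: "p1 > 0" "p2 > 0"
    and inv: "\<And>z x :: complex. z ^ p1 = 1 \<Longrightarrow> x ^ p2 = 1 \<Longrightarrow>
      cpoly (rat_poly M) * scale_poly (z * x) (cpoly (rat_poly M)) =
      scale_poly z (cpoly (rat_poly M)) * scale_poly x (cpoly (rat_poly M))"
  shows "\<exists>q1 q2. M = pcompose q1 (monom 1 p1) * pcompose q2 (monom 1 p2)"
proof -
  define N where "N = rat_poly M"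
  define S where "S = (\<lambda>j. poly_section p1 j N)"
  obtain a where a: "\<And>i. i < p1 \<Longrightarrow> (\<Sum>j<p1. a j * S j) dvd S i"
    using bezout_finite [of "{..<p1}" S] by auto
  define g where "g = (\<Sum>j<p1. a j * S j)"
  have "coeff (S 0) 0 = 1"
    using p M0 by (simp add: S_def coeff_poly_section N_def)
  moreover have "g dvd S 0"
    using a [of 0] p by (simp add: g_def)
  ultimately have g0: "coeff g 0 \<noteq> 0"
    by (auto simp: coeff_mult_0 elim!: dvdE)
  define h where "h = smult (inverse (coeff g 0)) g"
  have h0: "coeff h 0 = 1"
    using g0 by (simp add: h_def)
  then have "h \<noteq> 0"
    by auto
  have "\<exists>r. S j = h * r" if j: "j < p1" for j
  proof -
    obtain r where "S j = g * r"
      using a [OF j] by (auto simp: g_def)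
    then have "S j = h * smult (coeff g 0) r"
      using g0 by (simp add: h_def)
    then show ?thesis ..
  qed
  then obtain R where R: "\<And>j. j < p1 \<Longrightarrow> S j = h * R j"
    by metis
  \<comment> \<open>Division by the gcd leaves quotients that generate the unit ideal, so no further
    nonconstant factor in \<open>X ^ p1\<close> is left in \<open>Q\<close>.\<close>
  have bez: "(\<Sum>j<p1. smult (inverse (coeff g 0)) (a j) * R j) = 1"
  proof -
    have "h * (\<Sum>j<p1. smult (inverse (coeff g 0)) (a j) * R j) =
        (\<Sum>j<p1. smult (inverse (coeff g 0)) (a j) * S j)"
      by (simp add: sum_distrib_left R mult_ac)
    also have "\<dots> = h * 1"
      by (simp add: h_def g_def poly_eq_iff coeff_sum sum_distrib_left)
    finally show ?thesis
      using \<open>h \<noteq> 0\<close> by simp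
  qed
  define H where "H = pcompose h (monom 1 p1)"
  define Q where "Q = (\<Sum>j<p1. monom 1 j * pcompose (R j) (monom 1 p1))"
  have N: "N = H * Q"
  proof -
    have "N = (\<Sum>j<p1. monom 1 j * pcompose (S j) (monom 1 p1))"
      using sum_poly_sections [OF p(1), of N] by (simp add: S_def)
    also have "\<dots> = H * Q"
      by (simp add: R pcompose_mult H_def Q_def sum_distrib_left mult_ac)
    finally show ?thesis .
  qed
  have H0: "coeff H 0 = 1"
    using h0 p coeff_pcompose_monom [of p1 h 0] by (simp add: H_def del: coeff_pcompose_0)
  have Q0: "coeff Q 0 = 1"
    using arg_cong [OF N, of "\<lambda>p. coeff p 0"] H0 M0 by (simp add: coeff_mult_0 N_def)
  \<comment> \<open>\<open>H\<close> is unchanged by the rotation \<open>z\<close>, so both sides of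
    the identity for \<open>N\<close> carry the same nonzero factor, which cancels.\<close>
  have invQ: "cpoly Q * scale_poly (z * x) (cpoly Q) = scale_poly z (cpoly Q) * scale_poly x (cpoly Q)"
    if z: "z ^ p1 = 1" and x: "x ^ p2 = 1" for z x
  proof -
    have rot: "scale_poly (z * y) (cpoly H) = scale_poly y (cpoly H)" for y
      using p z by (auto simp: poly_eq_iff H_def coeff_pcompose_monom power_mult_distrib power_mult
          elim!: dvdE)
    from rot [of 1] have rot1: "scale_poly z (cpoly H) = cpoly H"
      by (simp add: scale_poly_def)
    have "(cpoly H * scale_poly x (cpoly H)) * (cpoly Q * scale_poly (z * x) (cpoly Q)) =
        cpoly N * scale_poly (z * x) (cpoly N)"
      using rot [of x] by (simp add: N cpoly_mult scale_poly_mult mult_ac)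
    also have "\<dots> = scale_poly z (cpoly N) * scale_poly x (cpoly N)"
      using inv [OF z x] by (simp add: N_def)
    also have "\<dots> = (cpoly H * scale_poly x (cpoly H)) * (scale_poly z (cpoly Q) * scale_poly x (cpoly Q))"
      by (simp add: N cpoly_mult scale_poly_mult rot1 mult_ac)
    finally have eq: "(cpoly H * scale_poly x (cpoly H)) * (cpoly Q * scale_poly (z * x) (cpoly Q)) =
      (cpoly H * scale_poly x (cpoly H)) * (scale_poly z (cpoly Q) * scale_poly x (cpoly Q))" .
    have "coeff (cpoly H * scale_poly x (cpoly H)) 0 = 1"
      using H0 by (simp add: coeff_mult_0)
    then have "cpoly H * scale_poly x (cpoly H) \<noteq> 0"
      by auto
    then show ?thesis
      using eq by (rule mult_left_cancel [THEN iffD1])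
  qed
  obtain w :: complex where w: "\<And>n. w ^ n = 1 \<longleftrightarrow> p1 dvd n"
    using exists_primitive_root [OF p(1)] by blast
  obtain x :: complex where x: "\<And>n. x ^ n = 1 \<longleftrightarrow> p2 dvd n"
    using exists_primitive_root [OF p(2)] by blast
  have x1: "x ^ p2 = 1"
    using x by simp
  let ?C = "cpoly Q"
  \<comment> \<open>Apply the identity with \<open>z = w ^ i\<close>: its left side is a multiple of
    \<open>?C\<close>. Averaging over \<open>i\<close> then replaces the rotations by the sections
    of \<open>?C\<close>.\<close>
  have "?C dvd scale_poly x ?C * scale_poly (w ^ i) ?C" for i
  proof -
    have "(w ^ i) ^ p1 = 1"
      using w by (simp flip: power_mult)
    then show ?thesis
      using invQ [OF _ x1, of "w ^ i"] by (metis dvd_triv_left mult.commute)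
  qed
  then have "?C dvd scale_poly x ?C * smult c (scale_poly (w ^ i) ?C)" for c i
    by (simp add: dvd_smult)
  then have "?C dvd (\<Sum>i<p1. scale_poly x ?C * smult (w ^ (i * (p1 - j))) (scale_poly (w ^ i) ?C))" for j
    by (intro dvd_sum) blast
  then have "?C dvd scale_poly x ?C * (\<Sum>i<p1. smult (w ^ (i * (p1 - j))) (scale_poly (w ^ i) ?C))" for j
    by (simp only: sum_distrib_left)
  then have "?C dvd scale_poly x ?C * smult (of_nat p1) (monom 1 j * pcompose (poly_section p1 j ?C) (monom 1 p1))"
    if "j < p1" for j
    using average_scale_poly [OF p(1) w that, of ?C] by metis
  then have C: "?C dvd scale_poly x ?C * (monom 1 j * pcompose (poly_section p1 j ?C) (monom 1 p1))"
    if "j < p1" for j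
    using that p by (simp add: dvd_smult_iff)
  have sec: "poly_section p1 j ?C = cpoly (R j)" if "j < p1" for j
    using poly_section_sum [OF that, of R] p
    by (simp add: Q_def [symmetric] poly_eq_iff coeff_poly_section)
  have "monom 1 p1 = (\<Sum>j<p1. monom 1 (p1 - j) *
      pcompose (cpoly (smult (inverse (coeff g 0)) (a j))) (monom 1 p1) *
      (monom 1 j * pcompose (poly_section p1 j ?C) (monom 1 p1)))"
  proof -
    have "(1 :: complex poly) = cpoly (\<Sum>j<p1. smult (inverse (coeff g 0)) (a j) * R j)"
      by (simp only: bez) (simp add: cpoly_def)
    also have "\<dots> = (\<Sum>j<p1. cpoly (smult (inverse (coeff g 0)) (a j) * R j))"
      by (simp add: poly_eq_iff coeff_sum of_rat_sum)
    finally have "pcompose (1 :: complex poly) (monom 1 p1) =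
        pcompose (\<Sum>j<p1. cpoly (smult (inverse (coeff g 0)) (a j) * R j)) (monom 1 p1)"
      by (rule arg_cong)
    then have "pcompose (1 :: complex poly) (monom 1 p1) =
        (\<Sum>j<p1. pcompose (cpoly (smult (inverse (coeff g 0)) (a j)) * cpoly (R j)) (monom 1 p1))"
      by (simp only: pcompose_sum cpoly_mult)
    then have "monom 1 p1 = monom 1 p1 *
        (\<Sum>j<p1. pcompose (cpoly (smult (inverse (coeff g 0)) (a j)) * cpoly (R j)) (monom 1 p1))"
      by (simp add: pcompose_1)
    also have "\<dots> = (\<Sum>j<p1. monom 1 (p1 - j) *
      pcompose (cpoly (smult (inverse (coeff g 0)) (a j))) (monom 1 p1) *
      (monom 1 j * pcompose (poly_section p1 j ?C) (monom 1 p1)))"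
    proof -
      have "(monom 1 p1 :: complex poly) = monom 1 (p1 - j) * monom 1 j" if "j < p1" for j
        using that by (simp add: mult_monom)
      then show ?thesis
        unfolding sum_distrib_left
        by (intro sum.cong refl) (simp add: sec pcompose_mult mult_ac)
    qed
    finally show ?thesis .
  qed
  moreover have "?C dvd scale_poly x ?C * (\<Sum>j<p1. monom 1 (p1 - j) *
      pcompose (cpoly (smult (inverse (coeff g 0)) (a j))) (monom 1 p1) *
      (monom 1 j * pcompose (poly_section p1 j ?C) (monom 1 p1)))"
    unfolding sum_distrib_left
  proof (rule dvd_sum)
    fix j
    assume "j \<in> {..<p1}"
    then show "?C dvd scale_poly x ?C * (monom 1 (p1 - j) *
      pcompose (cpoly (smult (inverse (coeff g 0)) (a j))) (monom 1 p1) *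
      (monom 1 j * pcompose (poly_section p1 j ?C) (monom 1 p1)))"
      using C [of j] by (metis dvd_mult lessThan_iff mult.left_commute)
  qed
  ultimately have "?C dvd scale_poly x ?C * monom 1 p1"
    by simp
  then have "?C dvd scale_poly x ?C"
    by (rule dvd_of_dvd_mult_monom [rotated]) (simp add: Q0)
  \<comment> \<open>Rotation keeps the degree and the constant term, so the quotient
    \<open>T\<close> must be 1. Thus \<open>?C\<close> is invariant under a primitive
    \<open>p2\<close>-th root of unity.\<close>
  then obtain T where T: "scale_poly x ?C = ?C * T"
    by auto
  have "x \<noteq> 0"
    using x1 p by (auto simp: power_0_left)
  then have "degree (scale_poly x ?C) = degree ?C"
    by (simp add: scale_poly_def degree_pcompose)
  moreover have "?C \<noteq> 0"
    using Q0 by (metis coeff_0 coeff_cpoly of_rat_1 one_neq_zero)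
  moreover have "coeff T 0 = 1"
    using arg_cong [OF T, of "\<lambda>p. coeff p 0"] Q0 by (simp add: coeff_mult_0)
  ultimately have "degree T = 0"
    by (simp add: T degree_mult_eq) (metis T add_cancel_left_right degree_mult_eq mult_zero_right coeff_0 one_neq_zero)
  then have "T = 1"
    using \<open>coeff T 0 = 1\<close> by (auto elim!: degree_eq_zeroE)
  then have "scale_poly x ?C = ?C"
    using T by simp
  then have "x ^ n * coeff ?C n = coeff ?C n" for n
    by (metis coeff_scale_poly)
  then have Qn: "coeff Q n = 0" if "\<not> p2 dvd n" for n
    using that x [of n] by (metis coeff_cpoly mult_cancel_right1 of_rat_eq_0_iff)
  obtain H' where H': "H = rat_poly H'"
    using gauss_constant_1 [of H Q M] N N_def H0 Q0 by auto
  obtain Q' where Q': "Q = rat_poly Q'"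
    using gauss_constant_1 [of Q H M] N N_def H0 Q0 by (auto simp: mult.commute)
  have "coeff Q' n = 0" if "\<not> p2 dvd n" for n
    using Qn [OF that] by (simp add: Q')
  then have 1: "Q' = pcompose (poly_section p2 0 Q') (monom 1 p2)"
    using p by (intro poly_in_power)
  have "coeff H' n = 0" if "\<not> p1 dvd n" for n
  proof -
    have "coeff H n = 0"
      using that p by (simp add: H_def coeff_pcompose_monom)
    then show ?thesis
      by (simp add: H')
  qed
  then have 2: "H' = pcompose (poly_section p1 0 H') (monom 1 p1)"
    using p by (intro poly_in_power)
  have "rat_poly M = rat_poly (H' * Q')"
    using N by (simp add: N_def H' Q' rat_poly_mult)
  then have "M = H' * Q'"
    by simp
  then show ?thesis
    using 1 2 by metis
qed

section \<open>Logarithmic derivatives\<close>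

text \<open>A relation instead of the quotient \<open>X F' / F\<close>: it makes sense over the
  integers, and its coefficient form is a recursion for \<open>F\<close>.\<close>

definition log_deriv :: "'a::comm_ring_1 fps \<Rightarrow> 'a fps \<Rightarrow> bool" where
  "log_deriv F a \<longleftrightarrow> fps_X * fps_deriv F = F * a"

lemma log_deriv_mult: "log_deriv F a \<Longrightarrow> log_deriv H b \<Longrightarrow> log_deriv (F * H) (a + b)"
  by (simp add: log_deriv_def algebra_simps) (metis mult.assoc mult.commute)

lemma fps_X_deriv_nth: "fps_nth (fps_X * fps_deriv F) n = of_nat n * fps_nth F n"
  by (cases n) (simp_all add: fps_X_mult_nth)

lemma log_derivD:
  assumes "log_deriv F a"
  shows "of_nat n * fps_nth F n = (\<Sum>i=0..n. fps_nth F i * fps_nth a (n - i))"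
  using arg_cong [OF assms [unfolded log_deriv_def], of "\<lambda>F. fps_nth F n"]
  by (simp only: fps_X_deriv_nth fps_mult_nth [of F a])

lemma log_derivI:
  assumes "\<And>n. of_nat n * fps_nth F n = (\<Sum>i=0..n. fps_nth F i * fps_nth a (n - i))"
  shows "log_deriv F a"
  unfolding log_deriv_def by (rule fps_ext) (simp only: fps_X_deriv_nth assms fps_mult_nth [of F a])

lemma log_deriv_unique:
  fixes F H :: "'a::field_char_0 fps"
  assumes "log_deriv F a" "log_deriv H a" "fps_nth a 0 = 0" "fps_nth F 0 = fps_nth H 0"
  shows "F = H"
proof (rule fps_ext)
  fix n
  show "fps_nth F n = fps_nth H n"
  proof (induction n rule: less_induct)
    case (less n)
    show ?case
    proof (cases "n = 0")
      case False
      have "of_nat n * fps_nth F n = of_nat n * fps_nth H n"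
        unfolding log_derivD [OF assms(1)] log_derivD [OF assms(2)]
      proof (rule sum.cong)
        fix i
        assume "i \<in> {0..n}"
        then show "fps_nth F i * fps_nth a (n - i) = fps_nth H i * fps_nth a (n - i)"
          using less.IH [of i] assms(3) by (cases "i = n") auto
      qed simp
      then show ?thesis
        using False by simp
    qed (use assms in simp)
  qed
qed

lemma log_deriv_scale:
  assumes "log_deriv F a"
  shows "log_deriv (Abs_fps (\<lambda>n. z ^ n * fps_nth F n)) (Abs_fps (\<lambda>n. z ^ n * fps_nth a n))"
proof (rule log_derivI)
  fix n
  have "of_nat n * (z ^ n * fps_nth F n) = z ^ n * (\<Sum>i=0..n. fps_nth F i * fps_nth a (n - i))"
    using log_derivD [OF assms, of n] by (metis mult.left_commute)
  also have "\<dots> = (\<Sum>i=0..n. (z ^ i * fps_nth F i) * (z ^ (n - i) * fps_nth a (n - i)))"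
    unfolding sum_distrib_left
  proof (rule sum.cong)
    fix i
    assume "i \<in> {0..n}"
    then have "z ^ n = z ^ i * z ^ (n - i)"
      by (simp flip: power_add)
    then show "z ^ n * (fps_nth F i * fps_nth a (n - i)) =
        (z ^ i * fps_nth F i) * (z ^ (n - i) * fps_nth a (n - i))"
      by (simp add: mult_ac)
  qed simp
  finally show "of_nat n * fps_nth (Abs_fps (\<lambda>n. z ^ n * fps_nth F n)) n =
      (\<Sum>i=0..n. fps_nth (Abs_fps (\<lambda>n. z ^ n * fps_nth F n)) i *
        fps_nth (Abs_fps (\<lambda>n. z ^ n * fps_nth a n)) (n - i))"
    by simp
qed

subsection \<open>Congruences between power sums\<close>

text \<open>Says that \<open>F\<close> reduces to a polynomial modulo \<open>m\<close>, which is why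
  the property is stable under sums and products.\<close>

definition ev_dvd :: "int \<Rightarrow> int fps \<Rightarrow> bool" where
  "ev_dvd m F \<longleftrightarrow> (\<exists>n0. \<forall>n \<ge> n0. m dvd fps_nth F n)"

lemma ev_dvd_add: "ev_dvd m F \<Longrightarrow> ev_dvd m H \<Longrightarrow> ev_dvd m (F + H)"
  unfolding ev_dvd_def
proof (elim exE)
  fix a b
  assume "\<forall>n\<ge>a. m dvd fps_nth F n" "\<forall>n\<ge>b. m dvd fps_nth H n"
  then show "\<exists>n0. \<forall>n\<ge>n0. m dvd fps_nth (F + H) n"
    by (intro exI [of _ "max a b"]) simp
qed

lemma ev_dvd_mult: "ev_dvd m F \<Longrightarrow> ev_dvd m H \<Longrightarrow> ev_dvd m (F * H)"
  unfolding ev_dvd_def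
proof (elim exE)
  fix a b
  assume *: "\<forall>n\<ge>a. m dvd fps_nth F n" "\<forall>n\<ge>b. m dvd fps_nth H n"
  have "m dvd fps_nth F i * fps_nth H (n - i)" if "n \<ge> a + b" for n i
  proof (cases "i \<ge> a")
    case False
    then have "n - i \<ge> b"
      using that by simp
    then show ?thesis
      using * by simp
  qed (use * in simp)
  then show "\<exists>n0. \<forall>n\<ge>n0. m dvd fps_nth (F * H) n"
    by (intro exI [of _ "a + b"]) (auto simp: fps_mult_nth intro!: dvd_sum)
qed

lemma ev_dvd_fps_of_poly: "ev_dvd m (fps_of_poly p)"
  unfolding ev_dvd_def by (intro exI [of _ "Suc (degree p)"]) (simp add: coeff_eq_0)

lemma ev_dvd_0 [simp]: "ev_dvd m 0" and ev_dvd_1 [simp]: "ev_dvd m 1"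
  using ev_dvd_fps_of_poly [of m 0] ev_dvd_fps_of_poly [of m 1] by simp_all

lemma ev_dvd_power: "ev_dvd m F \<Longrightarrow> ev_dvd m (F ^ n)"
  by (induction n) (auto intro: ev_dvd_mult)

lemma ev_dvd_sum: "(\<And>i. i \<in> I \<Longrightarrow> ev_dvd m (F i)) \<Longrightarrow> ev_dvd m (\<Sum>i\<in>I. F i)"
  by (induction I rule: infinite_finite_induct) (auto intro: ev_dvd_add)

lemma ev_dvd_all: "(\<And>n. m dvd fps_nth F n) \<Longrightarrow> ev_dvd m F"
  by (simp add: ev_dvd_def)

text \<open>First-order expansion of \<open>(u + h) ^ j\<close>: the derivative
  \<open>j * u ^ (j - 1)\<close> has the parity of \<open>j\<close> since \<open>u\<close> is odd,
  and the higher terms contain \<open>h ^ 2\<close>, a multiple of \<open>2 * h\<close>.\<close>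

lemma odd_power_diff:
  fixes u h :: int
  assumes "odd u" "even h"
  shows "2 * h dvd (u + h) ^ j - u ^ j - of_nat j * h"
proof (induction j)
  case (Suc j)
  have "(u + h) ^ Suc j - u ^ Suc j - of_nat (Suc j) * h =
      (u + h) * ((u + h) ^ j - u ^ j - of_nat j * h) + (h * (u ^ j - 1) + (u + h - 1) * h * of_nat j)"
    by (simp add: algebra_simps)
  moreover have "2 * h dvd h * (u ^ j - 1)"
    using assms by (subst mult.commute) (intro mult_dvd_mono; simp)
  moreover have "2 * h dvd (u + h - 1) * h * of_nat j"
    using assms by (intro dvd_mult2 mult_dvd_mono) simp_all
  ultimately show ?case
    using Suc by simp
qed simp

text \<open>\<open>u ^ d * A (1 / u)\<close> with \<open>d = degree A\<close>, the reflected
  polynomial at \<open>u\<close>; its zeros are the reciprocal roots of \<open>A\<close>.\<close>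

definition rev_eval :: "int poly \<Rightarrow> int \<Rightarrow> int" where
  "rev_eval A u = (\<Sum>i\<le>degree A. coeff A i * u ^ (degree A - i))"

text \<open>Hensel lifting for the reciprocal polynomial, which is \<open>x ^ d + x ^ (d - 1)\<close> modulo 2.\<close>

lemma two_adic_root:
  fixes A :: "int poly"
  assumes A: "coeff A 0 = 1" "odd (coeff A 1)" "\<And>d. d \<ge> 2 \<Longrightarrow> even (coeff A d)"
  shows "\<exists>u. odd u \<and> 2 ^ Suc N dvd rev_eval A u"
proof (induction N)
  case 0
  obtain d where d: "degree A = Suc d"
    using A(2) by (cases "degree A") (auto simp: coeff_eq_0)
  have "rev_eval A 1 = (\<Sum>i\<le>Suc d. coeff A i)"
    by (simp add: rev_eval_def d)
  also have "\<dots> = coeff A 0 + coeff A 1 + (\<Sum>i=2..Suc d. coeff A i)"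
    by (simp add: atMost_atLeast0 sum.atLeast_Suc_atMost numeral_2_eq_2 del: sum.cl_ivl_Suc)
  also have "even \<dots>"
    using A by (auto intro!: dvd_sum)
  finally show ?case
    by (intro exI [of _ 1]) simp
next
  case (Suc N)
  then obtain u where u: "odd u" "2 ^ Suc N dvd rev_eval A u"
    by blast
  obtain d where d: "degree A = Suc d"
    using A(2) by (cases "degree A") (auto simp: coeff_eq_0)
  define h :: int where "h = 2 ^ Suc N"
  have h: "even h" "odd (u + h)"
    using u by (simp_all add: h_def)
  define D where "D = (\<lambda>j. (u + h) ^ j - u ^ j)"
  have D: "2 * h dvd D j - of_nat j * h" for j
    unfolding D_def using odd_power_diff [OF u(1) h(1)] by simp
  have D': "h dvd D j" for j
  proof -
    have "h dvd D j - of_nat j * h"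
      using D [of j] by (metis dvd_mult_right)
    then show ?thesis
      by (metis dvd_diff_right_iff dvd_triv_right dvd_add_right_iff diff_add_cancel)
  qed
  have "rev_eval A (u + h) - rev_eval A u = (\<Sum>i\<le>Suc d. coeff A i * D (Suc d - i))"
    by (simp add: rev_eval_def d D_def right_diff_distrib sum_subtractf del: sum.atMost_Suc)
  also have "\<dots> = coeff A 0 * D (Suc d) + coeff A 1 * D d + (\<Sum>i=2..Suc d. coeff A i * D (Suc d - i))"
    by (simp add: atMost_atLeast0 sum.atLeast_Suc_atMost numeral_2_eq_2 del: sum.cl_ivl_Suc)
  \<comment> \<open>Up to multiples of \<open>2 * h\<close> the change is
    \<open>(Suc d + A_1 * d) * h = h + d * (A_1 + 1) * h\<close>, that is \<open>h\<close>, because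
    \<open>A_1\<close> is odd. The derivative is thus odd, and adding \<open>h\<close> to
    \<open>u\<close> repairs an odd \<open>c\<close>.\<close>
  finally have "rev_eval A (u + h) - rev_eval A u - h =
      (D (Suc d) - of_nat (Suc d) * h) + coeff A 1 * (D d - of_nat d * h) +
      (h * of_nat d * (coeff A 1 + 1)) + (\<Sum>i=2..Suc d. coeff A i * D (Suc d - i))"
    by (simp add: A algebra_simps)
  moreover have "2 * h dvd coeff A i * D (Suc d - i)" if "i \<ge> 2" for i
    using A(3) [OF that] D' by (intro mult_dvd_mono)
  moreover have "2 * h dvd h * of_nat d * (coeff A 1 + 1)"
    using A(2) by (subst mult.commute [of 2]) (intro mult_dvd_mono; simp)
  moreover have "2 * h dvd coeff A 1 * (D d - of_nat d * h)"
    using D by (intro dvd_mult)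
  ultimately have step: "2 * h dvd rev_eval A (u + h) - rev_eval A u - h"
    using D [of "Suc d"] by (simp only:) (intro dvd_add dvd_sum; simp)
  obtain c where c: "rev_eval A u = h * c"
    using u(2) by (auto simp: h_def)
  show ?case
  proof (cases "even c")
    case True
    then have "2 * h dvd rev_eval A u"
      unfolding c by (subst mult.commute) (intro mult_dvd_mono; simp)
    then show ?thesis
      using u by (intro exI [of _ u]) (simp add: h_def)
  next
    case False
    have "rev_eval A (u + h) = (rev_eval A (u + h) - rev_eval A u - h) + h * (c + 1)"
      by (simp add: c algebra_simps)
    moreover have "2 * h dvd h * (c + 1)"
      using False by (subst mult.commute [of 2]) (intro mult_dvd_mono; simp)
    ultimately have "2 * h dvd rev_eval A (u + h)"
      using step by (metis dvd_add)
    then show ?thesis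
      using h by (intro exI [of _ "u + h"]) (simp add: h_def)
  qed
qed

definition geo :: "int \<Rightarrow> int fps" where
  "geo u = Abs_fps (\<lambda>n. u ^ n)"

lemma geo_eq: "geo u * (1 - fps_const u * fps_X) = 1"
proof (rule fps_ext)
  fix n
  show "fps_nth (geo u * (1 - fps_const u * fps_X)) n = fps_nth 1 n"
    by (cases n) (simp_all add: geo_def right_diff_distrib mult.assoc [symmetric])
qed

text \<open>From the degree of \<open>A\<close> on, the coefficients of \<open>A / (1 - u X)\<close>
  form a geometric sequence that starts with \<open>rev_eval A u\<close>. A root modulo
  \<open>2 ^ N\<close> therefore makes the quotient a polynomial modulo
  \<open>2 ^ N\<close>.\<close>

lemma geo_times_poly_nth:
  assumes "n \<ge> degree A"
  shows "fps_nth (fps_of_poly A * geo u) n = u ^ (n - degree A) * rev_eval A u"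
proof -
  have "fps_nth (fps_of_poly A * geo u) n = (\<Sum>i\<le>n. coeff A i * u ^ (n - i))"
    by (simp add: fps_mult_nth geo_def atMost_atLeast0)
  also have "\<dots> = (\<Sum>i\<le>degree A. coeff A i * u ^ (n - i))"
    using assms by (intro sum.mono_neutral_right) (auto simp: coeff_eq_0)
  also have "\<dots> = (\<Sum>i\<le>degree A. u ^ (n - degree A) * (coeff A i * u ^ (degree A - i)))"
  proof (intro sum.cong refl)
    fix i
    assume "i \<in> {..degree A}"
    then have "u ^ (n - i) = u ^ (n - degree A) * u ^ (degree A - i)"
      using assms by (simp flip: power_add)
    then show "coeff A i * u ^ (n - i) = u ^ (n - degree A) * (coeff A i * u ^ (degree A - i))"
      by simp
  qed
  finally show ?thesis
    by (simp add: rev_eval_def sum_distrib_left)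
qed

text \<open>Writing \<open>A = (1 - u X) H\<close> with \<open>H\<close> congruent to 1 modulo 2, the logarithmic derivative of \<open>H\<close> is
  polynomial modulo powers of 2; so the power sums of \<open>A\<close> are governed by its 2-adic unit root.\<close>

lemma power_sums_two_adic:
  fixes A :: "int poly"
  assumes A: "coeff A 0 = 1" "odd (coeff A 1)" "\<And>d. d \<ge> 2 \<Longrightarrow> even (coeff A d)"
    and g: "log_deriv (fps_of_poly A) g" "fps_nth g 0 = 0"
  shows "\<exists>u. odd u \<and> ev_dvd (2 ^ N) (fps_of_poly A * geo u) \<and> ev_dvd (2 ^ N) (g + geo u)"
proof -
  obtain u where u: "odd u" "2 ^ Suc N dvd rev_eval A u"
    using two_adic_root [OF A] by blast
  have uN: "2 ^ N dvd rev_eval A u"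
    using u(2) by (metis dvd_trans dvd_triv_right power_Suc)
  define H where "H = fps_of_poly A * geo u"
  have HN: "ev_dvd (2 ^ N) H"
    unfolding ev_dvd_def H_def
    by (intro exI [of _ "degree A"]) (simp add: geo_times_poly_nth uN)
  define W where "W = (1 - fps_const u * fps_X :: int fps)"
  have A_eq: "fps_of_poly A = W * H"
    using geo_eq [of u] by (simp add: H_def W_def mult_ac)
  have H_nth: "fps_nth H n = (\<Sum>i=0..n. coeff A i * u ^ (n - i))" for n
    by (simp add: H_def fps_mult_nth geo_def)
  have A_nth: "coeff A (Suc n) = fps_nth H (Suc n) - u * fps_nth H n" for n
    using arg_cong [OF A_eq, of "\<lambda>F. fps_nth F (Suc n)"]
    by (simp add: W_def left_diff_distrib mult.assoc)
  have H0: "fps_nth H 0 = 1"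
    using A by (simp add: H_nth)
  have H_even: "even (fps_nth H (Suc n))" for n
  proof (induction n)
    case 0
    then show ?case
      using A_nth [of 0] A(2) u(1) H0 by simp
  next
    case (Suc n)
    then show ?case
      using A_nth [of "Suc n"] A(3) [of "Suc (Suc n)"] by simp
  qed
  define E where "E = Abs_fps (\<lambda>n. if n = 0 then 0 else fps_nth H n div 2)"
  have H_E: "H = 1 + fps_const 2 * E"
  proof (rule fps_ext)
    fix n
    show "fps_nth H n = fps_nth (1 + fps_const 2 * E) n"
      using H0 H_even by (cases n) (simp_all add: E_def)
  qed
  define F where "F = fps_const (- 2) * E"
  have HF: "H = 1 - F"
    by (simp add: H_E F_def flip: fps_const_neg)
  have F_N: "ev_dvd (2 ^ N) F"
  proof -
    have "F = 1 + fps_const (- 1) * H"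
      by (simp add: HF flip: fps_const_neg)
    then show ?thesis
      using HN by (auto intro!: ev_dvd_add ev_dvd_mult simp del: fps_const_neg)
        (simp add: ev_dvd_fps_of_poly [of _ "[:- 1:]", simplified fps_of_poly_const])
  qed
  \<comment> \<open>The logarithmic derivative of \<open>H\<close>, since that of
    \<open>1 - u X\<close> is \<open>1 - geo u\<close>.\<close>
  define K where "K = g + (geo u - 1)"
  have KH: "K * H = fps_X * fps_deriv H"
  proof -
    have geoW: "geo u * W = 1"
      by (simp add: W_def geo_eq)
    have dW: "fps_X * fps_deriv W = W - 1"
      by (simp add: W_def mult.commute)
    have "W * (H * g) = fps_of_poly A * g"
      by (simp add: A_eq mult_ac)
    also have "\<dots> = fps_X * fps_deriv (W * H)"
      using g(1) by (simp add: log_deriv_def A_eq)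
    also have "\<dots> = (fps_X * fps_deriv W) * H + W * (fps_X * fps_deriv H)"
      by (simp add: algebra_simps)
    also have "\<dots> = W * H - (geo u * W) * H + W * (fps_X * fps_deriv H)"
      using geoW by (simp add: dW mult.commute [of "geo u"]) (simp add: algebra_simps)
    finally have "W * (K * H) = W * (fps_X * fps_deriv H)"
      by (simp add: K_def algebra_simps)
    moreover have "W \<noteq> 0"
      using geoW by auto
    ultimately show ?thesis
      by simp
  qed
  \<comment> \<open>Partial sum of the geometric series for \<open>1 / H = 1 / (1 - F)\<close>. As
    \<open>F\<close> is a multiple of 2, the error term with \<open>F ^ N\<close> vanishes modulo
    \<open>2 ^ N\<close>.\<close>
  define S where "S = (\<Sum>i<N. F ^ i)"
  have "(1 - F) * S = 1 - F ^ N"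
    unfolding S_def by (rule one_diff_power_eq [symmetric])
  then have "K * (1 - F ^ N) = fps_X * fps_deriv H * S"
    using KH by (metis HF mult.assoc)
  then have K_eq: "K = fps_X * fps_deriv H * S + K * F ^ N"
    by (simp add: algebra_simps)
  have "ev_dvd (2 ^ N) (fps_X * fps_deriv H)"
    using HN unfolding ev_dvd_def fps_X_deriv_nth by (meson dvd_mult)
  moreover have "ev_dvd (2 ^ N) S"
    unfolding S_def by (intro ev_dvd_sum ev_dvd_power F_N)
  moreover have "ev_dvd (2 ^ N) (K * F ^ N)"
  proof (rule ev_dvd_all)
    fix n
    have "K * F ^ N = fps_const ((- 2) ^ N) * (K * E ^ N)"
      by (simp add: F_def power_mult_distrib fps_const_power mult_ac)
    moreover have "(2 ^ N :: int) dvd (- 2) ^ N"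
      by (simp add: power_minus [of 2])
    ultimately show "2 ^ N dvd fps_nth (K * F ^ N) n"
      by (metis dvd_mult2 fps_mult_left_const_nth)
  qed
  ultimately have "ev_dvd (2 ^ N) K"
    by (subst K_eq) (intro ev_dvd_add ev_dvd_mult [of _ "fps_X * fps_deriv H" S])
  then have "ev_dvd (2 ^ N) (K + 1)"
    by (intro ev_dvd_add ev_dvd_1)
  then have "ev_dvd (2 ^ N) (g + geo u)"
    by (simp add: K_def)
  then show ?thesis
    using u(1) HN by (auto simp: H_def)
qed

lemma cancel_odd_power:
  fixes v x :: int
  assumes "odd v" "2 ^ N dvd v ^ n * x"
  shows "2 ^ N dvd x"
proof -
  have "coprime (2 ^ N) (v ^ n)"
    using assms(1) by simp
  then show ?thesis
    using assms(2) by (simp add: coprime_dvd_mult_right_iff)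
qed

lemma diff_dvd_power_diff: "x - y dvd x ^ n - y ^ n" for x y :: int
  by (simp add: power_diff_sumr2)

text \<open>The approximate unit roots \<open>u\<close> and \<open>v\<close> agree modulo
  \<open>2 ^ N\<close>, so \<open>A * geo v\<close>, \<open>B * geo v\<close> and hence
  \<open>c * geo v\<close> are polynomials modulo \<open>2 ^ N\<close>. As \<open>v\<close> is odd,
  \<open>2 ^ N\<close> divides \<open>c\<close>; taking the absolute value of \<open>c\<close> for
  \<open>N\<close> makes this impossible unless \<open>c = 0\<close>.\<close>

lemma not_coprime_if_same_power_sums:
  fixes A B :: "int poly"
  assumes A: "coeff A 0 = 1" "odd (coeff A 1)" "\<And>d. d \<ge> 2 \<Longrightarrow> even (coeff A d)"
    "log_deriv (fps_of_poly A) a" "fps_nth a 0 = 0"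
    and B: "coeff B 0 = 1" "odd (coeff B 1)" "\<And>d. d \<ge> 2 \<Longrightarrow> even (coeff B d)"
    "log_deriv (fps_of_poly B) b" "fps_nth b 0 = 0"
    and same: "\<And>n. coprime k n \<Longrightarrow> fps_nth a n = fps_nth b n" and "k \<ge> 1"
    and bez: "r * A + s * B = [:c:]"
  shows "c = 0"
proof (rule ccontr)
  assume "c \<noteq> 0"
  define N where "N = nat \<bar>c\<bar>"
  obtain u where u: "odd u" "ev_dvd (2 ^ N) (fps_of_poly A * geo u)" "ev_dvd (2 ^ N) (a + geo u)"
    using power_sums_two_adic [OF A] by blast
  obtain v where v: "odd v" "ev_dvd (2 ^ N) (fps_of_poly B * geo v)" "ev_dvd (2 ^ N) (b + geo v)"
    using power_sums_two_adic [OF B] by blast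
  obtain m where m: "\<And>n. n \<ge> m \<Longrightarrow> 2 ^ N dvd fps_nth (a + geo u) n"
    using u(3) by (auto simp: ev_dvd_def)
  obtain l where l: "\<And>n. n \<ge> l \<Longrightarrow> 2 ^ N dvd fps_nth (b + geo v) n"
    using v(3) by (auto simp: ev_dvd_def)
  have *: "2 ^ N dvd u ^ n - v ^ n" if "n \<ge> max m l" "coprime k n" for n
  proof -
    have "fps_nth (a + geo u) n - fps_nth (b + geo v) n = u ^ n - v ^ n"
      using same [OF that(2)] by (simp add: geo_def)
    then show ?thesis
      using m [of n] l [of n] that(1) by (metis dvd_diff max.bounded_iff)
  qed
  define j where "j = max m l"
  have cop: "coprime k (Suc (k * i))" for i
    by (metis coprime_Suc_right_nat coprime_mult_left_iff)
  have j: "max m l \<le> Suc (k * j)"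
  proof -
    have "j \<le> k * j"
      using \<open>k \<ge> 1\<close> by simp
    then show ?thesis
      by (simp add: j_def)
  qed
  then have j': "max m l \<le> Suc (k * j) + k"
    by simp
  \<comment> \<open>Both \<open>n\<close> and \<open>n + k\<close> are 1 modulo \<open>k\<close>.
    Comparing them shows \<open>u ^ k\<close> and \<open>v ^ k\<close> to be congruent modulo
    \<open>2 ^ N\<close>, hence also the powers with exponent \<open>k * j\<close>; exponent
    \<open>n = k * j + 1\<close> then yields the congruence of \<open>u\<close> and
    \<open>v\<close>.\<close>
  define n where "n = Suc (k * j)"
  have 1: "2 ^ N dvd u ^ n - v ^ n" "2 ^ N dvd u ^ (n + k) - v ^ (n + k)"
    using * [OF j cop] * [OF j'] cop [of "Suc j"] by (simp_all add: n_def add.commute)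
  have "v ^ n * (u ^ k - v ^ k) = (u ^ (n + k) - v ^ (n + k)) - u ^ k * (u ^ n - v ^ n)"
    by (simp add: power_add algebra_simps)
  then have "2 ^ N dvd v ^ n * (u ^ k - v ^ k)"
    using 1 by (metis dvd_diff dvd_mult)
  then have uvk: "2 ^ N dvd u ^ k - v ^ k"
    using cancel_odd_power [OF v(1)] by blast
  have "u ^ k - v ^ k dvd (u ^ k) ^ j - (v ^ k) ^ j"
    by (rule diff_dvd_power_diff)
  then have uvkj: "2 ^ N dvd u ^ (k * j) - v ^ (k * j)"
    using uvk by (metis dvd_trans power_mult)
  have "v ^ (k * j) * (u - v) = (u ^ n - v ^ n) - u * (u ^ (k * j) - v ^ (k * j))"
    by (simp add: n_def algebra_simps)
  then have "2 ^ N dvd v ^ (k * j) * (u - v)"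
    using 1 uvkj by (metis dvd_diff dvd_mult)
  then have uv: "2 ^ N dvd u - v"
    using cancel_odd_power [OF v(1)] by blast
  have "ev_dvd (2 ^ N) (geo v - geo u)"
  proof (rule ev_dvd_all)
    fix i
    have "2 ^ N dvd u ^ i - v ^ i"
      using uv diff_dvd_power_diff dvd_trans by blast
    then show "2 ^ N dvd fps_nth (geo v - geo u) i"
      by (simp add: geo_def dvd_diff_commute)
  qed
  then have "ev_dvd (2 ^ N) (fps_of_poly A * (geo v - geo u) + fps_of_poly A * geo u)"
    using ev_dvd_add [OF ev_dvd_mult [OF ev_dvd_fps_of_poly] u(2)] by blast
  then have Av: "ev_dvd (2 ^ N) (fps_of_poly A * geo v)"
    by (simp add: algebra_simps)
  have "ev_dvd (2 ^ N) (fps_of_poly r * (fps_of_poly A * geo v) + fps_of_poly s * (fps_of_poly B * geo v))"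
    using ev_dvd_add [OF ev_dvd_mult [OF ev_dvd_fps_of_poly Av] ev_dvd_mult [OF ev_dvd_fps_of_poly v(2)]]
    by blast
  also have "fps_of_poly r * (fps_of_poly A * geo v) + fps_of_poly s * (fps_of_poly B * geo v) =
      fps_of_poly (r * A + s * B) * geo v"
    by (simp add: fps_of_poly_add fps_of_poly_mult algebra_simps)
  finally have "ev_dvd (2 ^ N) (fps_const c * geo v)"
    by (simp add: bez fps_of_poly_const)
  then obtain i where "2 ^ N dvd c * v ^ i"
    by (auto simp: ev_dvd_def geo_def)
  then have "2 ^ N dvd c"
    using cancel_odd_power [OF v(1)] by (metis mult.commute)
  then have "2 ^ N \<le> \<bar>c\<bar>"
    using \<open>c \<noteq> 0\<close> by (metis abs_ge_self dvd_imp_le_int order_trans)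
  moreover have "\<bar>c\<bar> = int N"
    by (simp add: N_def)
  moreover have "int N < 2 ^ N"
    using less_exp [of N] by (metis of_nat_less_numeral_power_cancel_iff)
  ultimately show False
    by linarith
qed

section \<open>Quotients, rotations and supports of logarithmic derivatives\<close>

lemma log_deriv_quotient:
  fixes A B M :: "'a::idom fps"
  assumes A: "log_deriv A a" and B: "log_deriv B b" and "A = B * M" "B \<noteq> 0"
  shows "log_deriv M (a - b)"
proof -
  have "B * (fps_X * fps_deriv M) = B * (M * (a - b))"
  proof -
    have "B * (fps_X * fps_deriv M) = fps_X * fps_deriv (B * M) - (fps_X * fps_deriv B) * M"
      by (simp add: algebra_simps)
    also have "\<dots> = B * M * a - B * b * M"
      using A B by (simp only: log_deriv_def \<open>A = B * M\<close>)
    finally show ?thesis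
      by (simp add: algebra_simps)
  qed
  then show ?thesis
    using \<open>B \<noteq> 0\<close> by (simp add: log_deriv_def)
qed

lemma log_deriv_of_int:
  assumes "log_deriv F a"
  shows "log_deriv (Abs_fps (\<lambda>n. of_int (fps_nth F n)) :: 'a::comm_ring_1 fps) (Abs_fps (\<lambda>n. of_int (fps_nth a n)))"
proof (rule log_derivI)
  fix n
  have "(of_int (of_nat n * fps_nth F n) :: 'a) = of_int (\<Sum>i=0..n. fps_nth F i * fps_nth a (n - i))"
    by (rule arg_cong [OF log_derivD [OF assms]])
  then show "of_nat n * fps_nth (Abs_fps (\<lambda>n. of_int (fps_nth F n)) :: 'a fps) n =
     (\<Sum>i=0..n. fps_nth (Abs_fps (\<lambda>n. of_int (fps_nth F n))) i *
       fps_nth (Abs_fps (\<lambda>n. of_int (fps_nth a n))) (n - i))"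
    by simp
qed

text \<open>If \<open>p1\<close> or \<open>p2\<close> divides \<open>n\<close>, then
  \<open>z ^ n\<close> or \<open>x ^ n\<close> is 1, so
  \<open>1 + (z * x) ^ n = z ^ n + x ^ n\<close>. The two products therefore have the same
  logarithmic derivative, and both have constant term 1.\<close>

lemma log_deriv_rotation_identity:
  fixes M :: "int poly"
  assumes M: "log_deriv (fps_of_poly M) c" "fps_nth c 0 = 0" "coeff M 0 = 1"
    and supp: "\<And>n. \<not> p1 dvd n \<Longrightarrow> \<not> p2 dvd n \<Longrightarrow> fps_nth c n = 0"
    and z: "z ^ p1 = 1" and x: "x ^ p2 = 1"
  shows "cpoly (rat_poly M) * scale_poly (z * x) (cpoly (rat_poly M)) =
    scale_poly z (cpoly (rat_poly M)) * scale_poly x (cpoly (rat_poly M))"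
proof -
  let ?C = "cpoly (rat_poly M)"
  define a :: "complex fps" where "a = Abs_fps (\<lambda>n. of_int (fps_nth c n))"
  have C: "log_deriv (fps_of_poly ?C) a"
  proof -
    have "fps_of_poly ?C = Abs_fps (\<lambda>n. of_int (fps_nth (fps_of_poly M) n))"
      by (simp add: fps_eq_iff)
    then show ?thesis
      using log_deriv_of_int [OF M(1)] by (simp only: a_def)
  qed
  have S: "log_deriv (fps_of_poly (scale_poly y ?C)) (Abs_fps (\<lambda>n. y ^ n * fps_nth a n))" for y
  proof -
    have "fps_of_poly (scale_poly y ?C) = Abs_fps (\<lambda>n. y ^ n * fps_nth (fps_of_poly ?C) n)"
      by (simp add: fps_eq_iff)
    then show ?thesis
      using log_deriv_scale [OF C] by simp
  qed
  define s where "s = (\<lambda>y. Abs_fps (\<lambda>n. y ^ n * fps_nth a n))"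
  have eq: "a + s (z * x) = s z + s x"
  proof (rule fps_ext)
    fix n
    have "z ^ n = 1" if "p1 dvd n"
      using that z by (auto simp: power_mult elim!: dvdE)
    moreover have "x ^ n = 1" if "p2 dvd n"
      using that x by (auto simp: power_mult elim!: dvdE)
    moreover have "fps_nth a n = 0" if "\<not> p1 dvd n" "\<not> p2 dvd n"
      using supp [OF that] by (simp add: a_def)
    ultimately show "fps_nth (a + s (z * x)) n = fps_nth (s z + s x) n"
      by (cases "p1 dvd n"; cases "p2 dvd n") (auto simp: s_def power_mult_distrib)
  qed
  have "fps_of_poly (?C * scale_poly (z * x) ?C) = fps_of_poly (scale_poly z ?C * scale_poly x ?C)"
  proof (rule log_deriv_unique)
    show "log_deriv (fps_of_poly (?C * scale_poly (z * x) ?C)) (a + s (z * x))"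
      unfolding fps_of_poly_mult s_def by (intro log_deriv_mult C S)
    show "log_deriv (fps_of_poly (scale_poly z ?C * scale_poly x ?C)) (a + s (z * x))"
      unfolding fps_of_poly_mult eq unfolding s_def by (intro log_deriv_mult S)
    show "fps_nth (a + s (z * x)) 0 = 0"
      using M(2) by (simp add: a_def s_def)
  qed (simp add: coeff_mult_0)
  then show ?thesis
    by simp
qed

text \<open>The recursion for \<open>n * coeff M n\<close> pairs indices that add up to
  \<open>n\<close>. If \<open>p\<close> does not divide \<open>n\<close>, it fails to divide one of
  the two, and the corresponding coefficient of \<open>M\<close> or \<open>c\<close> is 0.\<close>

lemma log_deriv_support:
  fixes M :: "int poly"
  assumes M: "log_deriv (fps_of_poly M) c" "fps_nth c 0 = 0" and supp: "\<And>n. \<not> p dvd n \<Longrightarrow> fps_nth c n = 0"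
  shows "\<not> p dvd n \<Longrightarrow> coeff M n = 0"
proof (induction n rule: less_induct)
  case (less n)
  have "int n * coeff M n = (\<Sum>i=0..n. coeff M i * fps_nth c (n - i))"
    using log_derivD [OF M(1), of n] by simp
  also have "\<dots> = 0"
  proof (intro sum.neutral ballI)
    fix i
    assume i: "i \<in> {0..n}"
    show "coeff M i * fps_nth c (n - i) = 0"
    proof (cases "p dvd n - i")
      case True
      then have "\<not> p dvd i"
        using less.prems i by (metis atLeastAtMost_iff dvd_add le_add_diff_inverse)
      then show ?thesis
        using less.IH [of i] i M(2) by (cases "i = n") auto
    qed (simp add: supp)
  qed
  finally show ?case
    using less.prems by (cases n) auto
qed

section \<open>The L-polynomials\<close>

definition char_sum_poly :: "nat \<Rightarrow> int poly" where
  "char_sum_poly k = (\<Sum>d\<le>2 ^ k + 2. monom (chi_sum k d) d)"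

lemma coeff_char_sum_poly [simp]: "coeff (char_sum_poly k) d = chi_sum k d"
proof (cases "d \<le> 2 ^ k + 2")
  case True
  then show ?thesis
    by (simp add: char_sum_poly_def coeff_sum)
next
  case False
  then show ?thesis
    by (simp add: char_sum_poly_def coeff_sum chi_sum_eq_0)
qed

definition G_series :: "nat \<Rightarrow> int fps" where
  "G_series k = Abs_fps (\<lambda>n. if n = 0 then 0 else G_sum k n)"

lemma log_deriv_char_sum_poly: "log_deriv (fps_of_poly (char_sum_poly k)) (G_series k)"
proof (rule log_derivI)
  fix d
  have "int d * chi_sum k d = (\<Sum>n=1..d. chi_sum k (d - n) * fps_nth (G_series k) n)"
    unfolding chi_sum_recurrence by (intro sum.cong) (auto simp: G_series_def)
  also have "\<dots> = (\<Sum>n=0..d. chi_sum k (d - n) * fps_nth (G_series k) n)"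
    by (intro sum.mono_neutral_left) (auto simp: G_series_def not_less_eq_eq)
  also have "\<dots> = (\<Sum>i=0..d. chi_sum k i * fps_nth (G_series k) (d - i))"
    by (rule sum.reindex_bij_witness [of _ "\<lambda>i. d - i" "\<lambda>i. d - i"]) auto
  finally show "of_nat d * fps_nth (fps_of_poly (char_sum_poly k)) d =
      (\<Sum>i=0..d. fps_nth (fps_of_poly (char_sum_poly k)) i * fps_nth (G_series k) (d - i))"
    by simp
qed

text \<open>Comparison of logarithmic derivatives: the zeta series contributes the point counts
  \<open>2 ^ n + 1 + G_sum k n\<close>, and the two linear factors remove
  \<open>2 ^ n + 1\<close>.\<close>

lemma zeta_fps_eq:
  assumes "k \<ge> 1"
  shows "zeta_fps k * ((1 - fps_X) * (1 - 2 * fps_X)) = fps_of_poly (rat_poly (char_sum_poly k))"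
proof -
  define a :: "rat fps" where "a = Abs_fps (\<lambda>n. if n = 0 then 0 else
    of_nat (card (curve_points k n)) / of_nat n)"
  define g :: "rat fps" where "g = Abs_fps (\<lambda>n. of_int (fps_nth (G_series k) n))"
  define p q r :: "rat fps" where "p = 1 - fps_X" and "q = 1 - 2 * fps_X"
    and "r = Abs_fps (\<lambda>n. if n = 0 then 0 else 1) + Abs_fps (\<lambda>n. if n = 0 then 0 else 2 ^ n)"
  have Z: "zeta_fps k = fps_exp 1 oo a"
    by (simp add: zeta_fps_def a_def)
  have "fps_deriv (fps_exp 1 oo a) = (fps_exp 1 oo a) * fps_deriv a"
    by (subst fps_compose_deriv) (simp_all add: a_def)
  then have lZ: "log_deriv (zeta_fps k) (fps_X * fps_deriv a)"
    by (simp add: log_deriv_def Z mult_ac)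
  have Xa: "fps_X * fps_deriv a = r + g"
  proof (rule fps_ext)
    fix n
    show "fps_nth (fps_X * fps_deriv a) n = fps_nth (r + g) n"
    proof (cases "n = 0")
      case False
      then have "(of_nat (card (curve_points k n)) :: rat) = of_int (2 ^ n + 1 + G_sum k n)"
        using card_curve_points [OF assms, of n] by (metis One_nat_def Suc_leI gr0I of_int_of_nat_eq)
      then show ?thesis
        unfolding fps_X_deriv_nth using False by (simp add: a_def r_def g_def G_series_def)
    qed (simp add: r_def g_def G_series_def)
  qed
  have lpq: "log_deriv (p * q) (- r)"
  proof -
    have "Abs_fps (\<lambda>n. if n = 0 then 0 else 1) * p = fps_X"
      unfolding p_def
    proof (rule fps_ext)
      fix n
      show "fps_nth (Abs_fps (\<lambda>n. if n = 0 then 0 else 1) * (1 - fps_X)) n = fps_nth (fps_X :: rat fps) n"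
        by (cases n) (auto simp: right_diff_distrib fps_X_nth)
    qed
    then have 1: "log_deriv p (- Abs_fps (\<lambda>n. if n = 0 then 0 else 1))"
      by (simp add: log_deriv_def mult.commute) (simp add: p_def)
    have two: "2 * F = fps_const 2 * F" for F :: "rat fps"
      by (metis numeral_fps_const)
    have "Abs_fps (\<lambda>n. if n = 0 then 0 else 2 ^ n) * q = 2 * fps_X"
      unfolding q_def
    proof (rule fps_ext)
      fix n
      show "fps_nth (Abs_fps (\<lambda>n. if n = 0 then 0 else 2 ^ n) * (1 - 2 * fps_X)) n =
          fps_nth (2 * fps_X :: rat fps) n"
        unfolding two mult.assoc [symmetric] right_diff_distrib
        by (cases n) (auto simp: fps_X_nth mult.left_commute [of _ "fps_const 2"]
            mult.commute [of _ "fps_const 2"])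
    qed
    then have 2: "log_deriv q (- Abs_fps (\<lambda>n. if n = 0 then 0 else 2 ^ n))"
      by (simp add: log_deriv_def mult.commute) (simp add: q_def mult.commute)
    show ?thesis
      using log_deriv_mult [OF 1 2] by (simp add: r_def)
  qed
  show ?thesis
    unfolding p_def [symmetric] q_def [symmetric]
  proof (rule log_deriv_unique)
    show "log_deriv (zeta_fps k * (p * q)) g"
      using log_deriv_mult [OF lZ lpq] by (simp add: Xa)
    have "fps_of_poly (rat_poly (char_sum_poly k)) =
        Abs_fps (\<lambda>n. of_int (fps_nth (fps_of_poly (char_sum_poly k)) n))"
      by (simp add: fps_eq_iff)
    then show "log_deriv (fps_of_poly (rat_poly (char_sum_poly k))) g"
      unfolding g_def using log_deriv_of_int [OF log_deriv_char_sum_poly] by simp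
    show "fps_nth g 0 = 0"
      by (simp add: g_def G_series_def)
    show "fps_nth (zeta_fps k * (p * q)) 0 = fps_nth (fps_of_poly (rat_poly (char_sum_poly k))) 0"
      by (simp add: Z p_def q_def)
  qed
qed

lemma L_poly_eq:
  assumes "k \<ge> 1"
  shows "L_poly k = char_sum_poly k"
proof -
  define D :: "rat fps" where "D = (1 - fps_X) * (1 - 2 * fps_X)"
  have D0: "fps_nth D 0 = 1"
    by (simp add: D_def)
  then have "D \<noteq> 0"
    by auto
  have iff: "zeta_fps k = F / D \<longleftrightarrow> zeta_fps k * D = F" for F
  proof -
    have "F / D * D = F"
      using D0 by (simp add: fps_divide_unit mult.assoc inverse_mult_eq_1)
    moreover have "H * D / D = H" for H
      using \<open>D \<noteq> 0\<close> by simp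
    ultimately show ?thesis
      by metis
  qed
  show ?thesis
    unfolding L_poly_def D_def [symmetric] iff
    using zeta_fps_eq [OF assms]
    by (intro the_equality) (simp_all add: D_def rat_poly_def [symmetric])
qed

text \<open>Both constant terms are 1 and the leading coefficients multiply to 4, which leaves
  finitely many cases. For two quadratics, \<open>a * (a - 1) = b + d\<close> with
  \<open>b * d = 4\<close>; then \<open>b + d\<close> is one of -5, -4, 4, 5, and none of these is a
  product of two consecutive integers.\<close>

lemma quartic_no_factor:
  fixes g h :: "int poly"
  assumes gh: "g * h = [:1, 1, 0, 2, 4:]" and g0: "coeff g 0 = 1"
  shows "degree g = 0 \<or> degree h = 0"
proof (rule ccontr)
  assume *: "\<not> ?thesis"
  have h0: "coeff h 0 = 1"
    using arg_cong [OF gh, of "\<lambda>p. coeff p 0"] g0 by (simp add: coeff_mult_0)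
  have nz: "g \<noteq> 0" "h \<noteq> 0"
    using g0 h0 by auto
  have deg: "degree g + degree h = 4"
    using arg_cong [OF gh, of degree] nz by (simp add: degree_mult_eq)
  have small: False
    if gh: "g * h = [:1, 1, 0, 2, 4:]" and "coeff g 0 = 1" "coeff h 0 = 1" "degree g = 1" "degree h = 3"
    for g h :: "int poly"
  proof -
    define a where "a = coeff g 1"
    define b c d where "b = coeff h 1" and "c = coeff h 2" and "d = coeff h 3"
    have g: "g = [:1, a:]"
      using that by (auto simp: poly_eq_iff coeff_pCons a_def coeff_eq_0 split: nat.splits)
    have h: "h = [:1, b, c, d:]"
      using that
      by (auto simp: poly_eq_iff coeff_pCons b_def c_def d_def coeff_eq_0 numeral_2_eq_2 numeral_3_eq_3
          split: nat.splits)
    have e: "a + b = 1" "a * b + c = 0" "a * c + d = 2" "a * d = 4"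
      using gh by (simp_all add: g h algebra_simps)
    have "a dvd 4"
      using e(4) by (metis dvd_triv_left)
    then have "\<bar>a\<bar> \<le> 4"
      using dvd_imp_le_int [of 4 a] by simp
    then have "a \<in> {-4, -3, -2, -1, 0, 1, 2, 3, 4}"
      by auto
    moreover have "b = 1 - a" "c = - a * b" "d = 2 - a * c"
      using e by simp_all
    ultimately show False
      using e(4) by auto
  qed
  consider "degree g = 1" "degree h = 3" | "degree g = 3" "degree h = 1" | "degree g = 2" "degree h = 2"
    using * deg by linarith
  then show False
  proof cases
    case 1
    then show ?thesis
      using small gh g0 h0 by blast
  next
    case 2
    then show ?thesis
      using small [of h g] gh g0 h0 by (simp add: mult.commute)
  next
    case 3
    define a b c d where "a = coeff g 1" and "b = coeff g 2" and "c = coeff h 1" and "d = coeff h 2"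
    have g: "g = [:1, a, b:]"
      using 3 g0 by (auto simp: poly_eq_iff coeff_pCons a_def b_def coeff_eq_0 numeral_2_eq_2 split: nat.splits)
    have h: "h = [:1, c, d:]"
      using 3 h0 by (auto simp: poly_eq_iff coeff_pCons c_def d_def coeff_eq_0 numeral_2_eq_2 split: nat.splits)
    have e: "a + c = 1" "b + d + a * c = 0" "a * d + b * c = 2" "b * d = 4"
      using gh by (simp_all add: g h algebra_simps)
    have "b dvd 4"
      using e(4) by (metis dvd_triv_left)
    then have "\<bar>b\<bar> \<le> 4"
      using dvd_imp_le_int [of 4 b] by simp
    then have "b \<in> {-4, -3, -2, -1, 0, 1, 2, 3, 4}"
      by auto
    then have bd: "b + d \<in> {-5, -4, 4, 5}"
      using e(4) by auto
    have c: "c = 1 - a"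
      using e by simp
    have aa: "a * (a - 1) = b + d"
      using e(2) by (simp add: c algebra_simps)
    have "\<bar>a\<bar> \<le> 3"
    proof (rule ccontr)
      assume "\<not> \<bar>a\<bar> \<le> 3"
      then consider "a \<ge> 4" | "a \<le> - 4"
        by linarith
      then have "a * (a - 1) \<ge> 6"
      proof cases
        case 1
        then show ?thesis
          using mult_mono [of 4 a 3 "a - 1"] by simp
      next
        case 2
        then show ?thesis
          using mult_mono [of 4 "- a" 3 "1 - a"] by (simp add: algebra_simps)
      qed
      then show False
        using aa bd by auto
    qed
    then have "a \<in> {-3, -2, -1, 0, 1, 2, 3}"
      by auto
    then show False
      using aa bd by auto
  qed
qed

lemma char_sum_poly_1: "char_sum_poly 1 = [:1, 1, 0, 2, 4:]"
proof (rule poly_eqI)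
  fix n :: nat
  consider "n = 0" | "n = 1" | "n = 2" | "n = 3" | "n = 4" | "n \<ge> 5"
    by linarith
  then show "coeff (char_sum_poly 1) n = coeff [:1, 1, 0, 2, 4:] n"
  proof cases
    case 6
    then have "coeff [:1, 1, 0, 2, 4 :: int:] n = 0"
      by (intro coeff_eq_0) simp
    then show ?thesis
      using 6 chi_sum_eq_0 [of 1 n] by simp
  qed (use chi_sum_1_values in \<open>simp_all add: eval_nat_numeral\<close>)
qed

lemma char_sum_poly_parity:
  "coeff (char_sum_poly k) 0 = 1" "odd (coeff (char_sum_poly k) 1)"
  "d \<ge> 2 \<Longrightarrow> even (coeff (char_sum_poly k) d)"
  using odd_chi_sum_1 even_chi_sum by auto

text \<open>The rational gcd of the two polynomials, scaled to constant term 1, is integral by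
  Gauss's lemma and divides the irreducible \<open>L_1\<close>. If it were 1, clearing denominators
  in Bezout's relation would give the positive constant \<open>D * E\<close> as an integral
  combination, against \<open>not_coprime_if_same_power_sums\<close>.\<close>

lemma char_sum_poly_1_dvd:
  assumes "k \<ge> 1" and same: "\<And>n. n \<ge> 1 \<Longrightarrow> coprime k n \<Longrightarrow> G_sum k n = G_sum 1 n"
  shows "\<exists>M. char_sum_poly k = char_sum_poly 1 * M \<and> coeff M 0 = 1"
proof -
  define A B where "A = char_sum_poly k" and "B = char_sum_poly 1"
  have A0: "coeff A 0 = 1" and B0: "coeff B 0 = 1"
    by (simp_all add: A_def B_def)
  have ncop: "c = 0" if "r * A + s * B = [:c:]" for r s c
  proof (rule not_coprime_if_same_power_sums)
    show "fps_nth (G_series k) n = fps_nth (G_series 1) n" if "coprime k n" for n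
      using same [of n] that by (simp add: G_series_def)
    show "r * char_sum_poly k + s * char_sum_poly 1 = [:c:]"
      using that by (simp add: A_def B_def)
    show "fps_nth (G_series k) 0 = 0" "fps_nth (G_series 1) 0 = 0"
      by (simp_all add: G_series_def)
  qed (use char_sum_poly_parity log_deriv_char_sum_poly \<open>k \<ge> 1\<close> in blast)+
  define G where "G = gcd (rat_poly A) (rat_poly B)"
  obtain K where K: "rat_poly B = G * K"
    unfolding G_def by (meson dvdE gcd_dvd2)
  have G0: "coeff G 0 \<noteq> 0"
    using arg_cong [OF K, of "\<lambda>p. coeff p 0"] B0 by (auto simp: coeff_mult_0)
  define H where "H = smult (inverse (coeff G 0)) G"
  have H0: "coeff H 0 = 1"
    using G0 by (simp add: H_def)
  have "H dvd rat_poly B" "H dvd rat_poly A"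
    using G0 by (simp_all add: H_def smult_dvd_iff G_def)
  then obtain S T where S: "rat_poly B = H * S" and T: "rat_poly A = H * T"
    by (auto elim!: dvdE)
  have S0: "coeff S 0 = 1"
    using arg_cong [OF S, of "\<lambda>p. coeff p 0"] H0 B0 by (simp add: coeff_mult_0)
  have T0: "coeff T 0 = 1"
    using arg_cong [OF T, of "\<lambda>p. coeff p 0"] H0 A0 by (simp add: coeff_mult_0)
  obtain H' where H': "H = rat_poly H'"
    using gauss_constant_1 [OF S [symmetric] H0 S0] by blast
  obtain S' where S': "S = rat_poly S'"
    using gauss_constant_1 [of S H B] S H0 S0 by (auto simp: mult.commute)
  obtain M where M: "T = rat_poly M"
    using gauss_constant_1 [of T H A] T H0 T0 by (auto simp: mult.commute)
  have "rat_poly B = rat_poly (H' * S')"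
    by (simp add: S H' S' rat_poly_mult)
  then have B: "H' * S' = B"
    by simp
  have AM: "A = H' * M"
  proof -
    have "rat_poly A = rat_poly (H' * M)"
      by (simp add: T H' M rat_poly_mult)
    then show ?thesis
      by simp
  qed
  have "degree H' = 0 \<or> degree S' = 0"
  proof (rule quartic_no_factor)
    show "H' * S' = [:1, 1, 0, 2, 4:]"
      by (simp only: B B_def char_sum_poly_1)
    show "coeff H' 0 = 1"
      using H0 by (simp add: H')
  qed
  then show ?thesis
  proof
    assume "degree S' = 0"
    moreover have "coeff S' 0 = 1"
      using S0 by (simp add: S')
    ultimately have "S' = 1"
      by (auto elim!: degree_eq_zeroE)
    then have "A = B * M"
      using AM B by simp
    moreover have "coeff M 0 = 1"
      using T0 by (simp add: M)
    ultimately show ?thesis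
      by (auto simp: A_def B_def)
  next
    assume "degree H' = 0"
    moreover have "coeff H' 0 = 1"
      using H0 by (simp add: H')
    ultimately have "H' = 1"
      by (auto elim!: degree_eq_zeroE)
    then have "H = 1"
      by (simp add: H')
    then have "G = [:coeff G 0:]"
      using G0 by (simp add: H_def)
        (metis inverse_inverse_eq mult.right_neutral smult_1_left smult_smult right_inverse smult_one)
    obtain r s where rs: "r * rat_poly A + s * rat_poly B = G"
      using bezout_coefficients_fst_snd unfolding G_def by blast
    define r' s' where "r' = smult (inverse (coeff G 0)) r" and "s' = smult (inverse (coeff G 0)) s"
    have 1: "r' * rat_poly A + s' * rat_poly B = 1"
      using rs \<open>H = 1\<close> by (simp add: r'_def s'_def H_def flip: smult_add_right)
    obtain D u where D: "D > 0" "smult (of_int D) r' = rat_poly u"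
      using common_denominator by blast
    obtain E v where E: "E > 0" "smult (of_int E) s' = rat_poly v"
      using common_denominator by blast
    have "rat_poly (smult E u * A + smult D v * B) =
        smult (of_int (D * E)) (r' * rat_poly A + s' * rat_poly B)"
      by (simp add: rat_poly_add rat_poly_mult rat_poly_smult D(2) [symmetric] E(2) [symmetric]
          smult_add_right mult.commute)
    also have "\<dots> = rat_poly [:D * E:]"
      by (simp add: 1 poly_eq_iff coeff_pCons split: nat.splits)
    finally have "smult E u * A + smult D v * B = [:D * E:]"
      by simp
    then have "D * E = 0"
      by (rule ncop)
    then show ?thesis
      using D E by simp
  qed
qed

theorem theorem26:
  fixes k :: nat
  assumes "\<forall>k' m. k' \<ge> 1 \<longrightarrow> m \<ge> 1 \<longrightarrow> coprime k' m \<longrightarrow> G_sum k' m = G_sum 1 m"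
    and "k \<ge> 1"
    and "card (prime_factors k) \<le> 2"
  shows "\<exists>q :: nat \<Rightarrow> int poly.
           L_poly k = (\<Prod>p\<in>prime_factors k. pcompose (q p) (monom 1 p)) * L_poly 1"
proof -
  have same: "G_sum k n = G_sum 1 n" if "n \<ge> 1" "coprime k n" for n
    using assms(1,2) that by blast
  obtain M where M: "char_sum_poly k = char_sum_poly 1 * M" "coeff M 0 = 1"
    using char_sum_poly_1_dvd [OF assms(2) same] by blast
  define c where "c = G_series k - G_series 1"
  have c0: "fps_nth c 0 = 0"
    by (simp add: c_def G_series_def)
  have "fps_of_poly (char_sum_poly 1) \<noteq> 0"
    using char_sum_poly_parity(1) [of 1] by (metis coeff_0 fps_of_poly_eq_iff fps_of_poly_0 one_neq_zero)
  then have lM: "log_deriv (fps_of_poly M) c"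
    unfolding c_def
    by (intro log_deriv_quotient [OF log_deriv_char_sum_poly log_deriv_char_sum_poly])
      (simp_all add: M fps_of_poly_mult)
  \<comment> \<open>A positive \<open>n\<close> that avoids all prime factors of \<open>k\<close> is
    coprime to \<open>k\<close>, and there the hypothesis makes the two series agree. So the
    logarithmic derivative of \<open>M\<close> lives on the multiples of these primes.\<close>
  have c: "fps_nth c n = 0" if "\<And>p. p \<in> prime_factors k \<Longrightarrow> \<not> p dvd n" for n
  proof (cases "n = 0")
    case False
    have "coprime k n"
    proof (rule ccontr)
      assume "\<not> coprime k n"
      then obtain p where "prime p" "p dvd k" "p dvd n"
        by (metis coprime_iff_gcd_eq_1 gcd_dvd1 gcd_dvd2 dvd_trans prime_factor_nat)
      then show False
        using that assms(2) by (auto simp: in_prime_factors_iff)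
    qed
    then show ?thesis
      using same False by (simp add: c_def G_series_def)
  qed (simp add: c0)
  have pos: "p > 0" if "p \<in> prime_factors k" for p
    using that by (auto intro: prime_gt_0_nat)
  have "\<exists>q. M = (\<Prod>p\<in>prime_factors k. pcompose (q p) (monom 1 p))"
  proof -
    consider "card (prime_factors k) = 0" | "card (prime_factors k) = 1" | "card (prime_factors k) = 2"
      using assms(3) by linarith
    then show ?thesis
    proof cases
      case 1
      then have pf: "prime_factors k = {}"
        by simp
      then have "k = 1"
        using assms(2) by (simp add: prime_factorization_empty_iff)
      then have "char_sum_poly 1 * M = char_sum_poly 1 * 1"
        using M by simp
      then have "M = 1"
        using char_sum_poly_parity(1) [of 1] by (metis coeff_0 mult_cancel_left one_neq_zero)
      then show ?thesis
        by (simp add: pf)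
    next
      case 2
      then obtain p where p: "prime_factors k = {p}"
        by (auto simp: card_1_singleton_iff)
      have "coeff M n = 0" if "\<not> p dvd n" for n
        by (rule log_deriv_support [OF lM c0 _ that]) (use c p in auto)
      then have "M = pcompose (poly_section p 0 M) (monom 1 p)"
        using pos p by (intro poly_in_power) auto
      then show ?thesis
        using p by (intro exI [of _ "\<lambda>_. poly_section p 0 M"]) simp
    next
      case 3
      then obtain p1 p2 where p: "prime_factors k = {p1, p2}" "p1 \<noteq> p2"
        by (auto simp: card_2_iff)
      have "\<exists>q1 q2. M = pcompose q1 (monom 1 p1) * pcompose q2 (monom 1 p2)"
      proof (rule split_bi_invariant [OF M(2)])
        show "p1 > 0" "p2 > 0"
          using pos p by auto
        show "cpoly (rat_poly M) * scale_poly (z * x) (cpoly (rat_poly M)) =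
            scale_poly z (cpoly (rat_poly M)) * scale_poly x (cpoly (rat_poly M))"
          if "z ^ p1 = 1" "x ^ p2 = 1" for z x
          using that c p by (intro log_deriv_rotation_identity [OF lM c0 M(2)]) auto
      qed
      then obtain q1 q2 where "M = pcompose q1 (monom 1 p1) * pcompose q2 (monom 1 p2)"
        by blast
      then show ?thesis
        using p by (intro exI [of _ "\<lambda>p. if p = p1 then q1 else q2"]) simp
    qed
  qed
  then show ?thesis
    using M(1) assms(2) by (metis L_poly_eq le_refl mult.commute)
qed

end
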